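(* Let $n\ge 5$, $s\ge 3$, and let $d_1,\dots,d_s$ be positive integers with $n=d_1+\cdots+d_s$. Let $(G,H,K)$ be one of the following triples (block-diagonally embedded): - $G=\operatorname{SO}(n)$, $H=\operatorname{S}(\operatorname{O}(d_1+d_2)\times\operatorname{O}(d_3)\times\cdots\times\operatorname{O}(d_s))$, $K=\operatorname{S}(\operatorname{O}(d_1)\times\cdots\times\operatorname{O}(d_s))$; - $G=\operatorname{SU}(n)$, $H=\operatorname{S}(\operatorname{U}(d_1+d_2)\times\operatorname{U}(d_3)\times\cdots\times\operatorname{U}(d_s))$, $K=\operatorname{S}(\operatorname{U}(d_1)\times\cdots\times\operatorname{U}(d_s))$; - $G=\operatorname{Sp}(n)$, $H=\operatorname{Sp}(d_1+d_2)\times\operatorname{Sp}(d_3)\times\cdots\times\operatorname{Sp}(d_s)$, $K=\operatorname{Sp}(d_1)\times\cdots\times\operatorname{Sp}(d_s)$. Let $g_b$ be a $G$-invariant metric on $G/H$. Its metric operator has the form $$\Lambda_b=\sum_{r=3}^s\mu_r\operatorname{Id}_{\mathfrak m_{1r}\oplus\mathfrak m_{2r}}+\sum_{3\le i<j\le s}\mu_{ij}\operatorname{Id}_{\mathfrak m_{ij}},\qquad \mu_r>0,\ \mu_{ij}>0 .$$ Every vector of $\mathfrak p$ is equigeodesic on the fiber $H/K$. Moreover, for $X=X_{\mathfrak p}+X_{\mathfrak n}\in\mathfrak p\oplus\mathfrak n$ with blocks $X_{ij}$, the following are equivalent: (i) $X$ is a $\pi$-equigeodesic vector with respect to $g_b$;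 (ii) $X_{\mathfrak n}$ is a geodesic vector on $(G/H,g_b)$ and $[X_{\mathfrak p},X_{\mathfrak n}]=0$; (iii) the following equations hold: $$X_{12}X_{2r}=0,\qquad X_{12}^*X_{1r}=0,\qquad r=3,\dots,s,$$ $$\sum_{k=3}^{r-1}(\mu_{kr}-\mu_k)X_{ik}X_{kr}+\sum_{k=r+1}^{s}(\mu_k-\mu_{rk})X_{ik}X_{rk}^*=0,\qquad i=1,2,\ r=3,\dots,s,$$ and, for all $3\le i<j\le s$, $$(\mu_i-\mu_j)(X_{1i}^*X_{1j}+X_{2i}^*X_{2j})+\sum_{k=3}^{i-1}(\mu_{ki}-\mu_{kj})X_{ki}^*X_{kj}+\sum_{k=i+1}^{j-1}(\mu_{kj}-\mu_{ik})X_{ik}X_{kj}+\sum_{k=j+1}^{s}(\mu_{ik}-\mu_{jk})X_{ik}X_{jk}^*=0 .$$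
   Context: Let $\mathbb F=\mathbb R,\mathbb C,\mathbb H$ for $G=\operatorname{SO}(n),\operatorname{SU}(n),\operatorname{Sp}(n)$ respectively. The Lie algebras are $\mathfrak{so}(n)=\{X\in M_n(\mathbb R):X+X^*=0\}$, $\mathfrak{su}(n)=\{X\in M_n(\mathbb C):X+X^*=0,\ \operatorname{Tr}X=0\}$, $\mathfrak{sp}(n)=\{X\in M_n(\mathbb H):X+X^*=0\}$, where $X^*$ is the transpose, conjugate transpose, or quaternionic conjugate transpose. $\operatorname{S}(\cdots)$ denotes the determinant-one subgroup. Write $X\in M_n(\mathbb F)$ in blocks $X=(X_{ij})$, $X_{ij}\in M_{d_i\times d_j}(\mathbb F)$, $1\le i,j\le s$. Fix the $\operatorname{Ad}(G)$-invariant inner product $(X,Y)=-\frac12\operatorname{Re}\operatorname{Tr}(XY)$ on $\mathfrak g$. For $1\le i<j\le s$ let $$\mathfrak m_{ij}=\{X\in M_n(\mathbb F):X_{k\ell}=0\text{ for }(k,\ell)\notin\{(i,j),(j,i)\},\ X_{ji}=-X_{ij}^*\}.$$ Then $\mathfrak g=\mathfrak h\oplus\mathfrak n$, $\mathfrak h=\mathfrak k\oplus\mathfrak p$ orthogonally, where $\mathfrak p=\mathfrak m_{12}$ and $\mathfrak n=\bigoplus_{1\le i<j\le s,\ (i,j)\ne(1,2)}\mathfrak m_{ij}$. Here $X_{\mathfrak p},X_{\mathfrak n}$ are the components of $X$ in $\mathfrak p,\mathfrak n$. The map $\pi:G/K\to G/H$ is $\pi(aK)=aH$. Identify $\mathfrak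 n\simeq T_{eH}(G/H)$ via $X\mapsto\frac{d}{dt}\exp(tX)H|_{t=0}$. The metric operator of a $G$-invariant metric $g_b$ on $G/H$ is the linear map $\Lambda_b:\mathfrak n\to\mathfrak n$ with $(g_b)_{eH}(X,Y)=(\Lambda_bX,Y)$ for $X,Y\in\mathfrak n$. A vector $X$ is a geodesic vector on a homogeneous Riemannian space $(G/K,g)$ ($g$ being $G$-invariant) if $t\mapsto\exp(tX)K$ is a geodesic; similarly for $G/H$ and $H/K$. $X\in\mathfrak p$ is equigeodesic on $H/K$ if it is a geodesic vector for every $H$-invariant metric on $H/K$. $X\in\mathfrak p\oplus\mathfrak n$ is $\pi$-equigeodesic with respect to $g_b$ if it is a geodesic vector on $(G/K,g)$ for every $G$-invariant metric $g$ on $G/K$ such that $\pi:(G/K,g)\to(G/H,g_b)$ is a Riemannian submersion. *)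

theory Defs
  imports "HOL-Analysis.Analysis"
begin

section \<open>Quaternions\<close>

codatatype quat = Quat (qre: real) (qi: real) (qj: real) (qk: real)

lemma quat_eq_iff: "x = y \<longleftrightarrow> qre x = qre y \<and> qi x = qi y \<and> qj x = qj y \<and> qk x = qk y"
  by (auto intro: quat.expand)

instantiation quat :: ab_group_add
begin

primcorec zero_quat where
  "qre 0 = 0" | "qi 0 = 0" | "qj 0 = 0" | "qk 0 = 0"

primcorec plus_quat where
  "qre (x + y) = qre x + qre y"
| "qi (x + y) = qi x + qi y"
| "qj (x + y) = qj x + qj y"
| "qk (x + y) = qk x + qk y"

primcorec uminus_quat where
  "qre (- x) = - qre x" | "qi (- x) = - qi x" | "qj (- x) = - qj x" | "qk (- x) = - qk x"

primcorec minus_quat where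
  "qre (x - y) = qre x - qre y"
| "qi (x - y) = qi x - qi y"
| "qj (x - y) = qj x - qj y"
| "qk (x - y) = qk x - qk y"

instance
  by standard (simp_all add: quat_eq_iff)

end

instantiation quat :: ring_1
begin

primcorec one_quat where
  "qre 1 = 1" | "qi 1 = 0" | "qj 1 = 0" | "qk 1 = 0"

primcorec times_quat where
  "qre (x * y) = qre x * qre y - qi x * qi y - qj x * qj y - qk x * qk y"
| "qi (x * y) = qre x * qi y + qi x * qre y + qj x * qk y - qk x * qj y"
| "qj (x * y) = qre x * qj y - qi x * qk y + qj x * qre y + qk x * qi y"
| "qk (x * y) = qre x * qk y + qi x * qj y - qj x * qi y + qk x * qre y"

instance
  by standard (simp_all add: quat_eq_iff algebra_simps)

end

lemma quat_sumsq_eq_0_iff: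
  "(qre x)\<^sup>2 + (qi x)\<^sup>2 + (qj x)\<^sup>2 + (qk x)\<^sup>2 = 0 \<longleftrightarrow> x = 0"
  by (simp add: quat_eq_iff add_nonneg_eq_0_iff)

instantiation quat :: real_div_algebra
begin

primcorec scaleR_quat where
  "qre (scaleR r x) = r * qre x"
| "qi (scaleR r x) = r * qi x"
| "qj (scaleR r x) = r * qj x"
| "qk (scaleR r x) = r * qk x"

definition inverse_quat :: "quat \<Rightarrow> quat" where
  "inverse x = scaleR (1 / ((qre x)\<^sup>2 + (qi x)\<^sup>2 + (qj x)\<^sup>2 + (qk x)\<^sup>2))
     (Quat (qre x) (- qi x) (- qj x) (- qk x))"

definition divide_quat :: "quat \<Rightarrow> quat \<Rightarrow> quat" where
  "x div y = x * inverse y" for x y :: quat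

instance
proof
  fix a :: quat
  assume "a \<noteq> 0"
  then have "(qre a)\<^sup>2 + (qi a)\<^sup>2 + (qj a)\<^sup>2 + (qk a)\<^sup>2 \<noteq> 0"
    by (simp add: quat_sumsq_eq_0_iff)
  then show "inverse a * a = 1" "a * inverse a = 1"
    by (simp_all add: quat_eq_iff inverse_quat_def divide_simps)
      (simp_all add: power2_eq_square algebra_simps)
qed (simp_all add: quat_eq_iff inverse_quat_def divide_quat_def algebra_simps)

end

instantiation quat :: real_normed_div_algebra
begin

definition norm_quat :: "quat \<Rightarrow> real" where
  "norm x = sqrt ((qre x)\<^sup>2 + (qi x)\<^sup>2 + (qj x)\<^sup>2 + (qk x)\<^sup>2)"

definition sgn_quat :: "quat \<Rightarrow> quat" where
  "sgn x = x /\<^sub>R norm x" for x :: quat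

definition dist_quat :: "quat \<Rightarrow> quat \<Rightarrow> real" where
  "dist x y = norm (x - y)" for x y :: quat

definition uniformity_quat :: "(quat \<times> quat) filter" where
  "uniformity = (INF e\<in>{0 <..}. principal {(x :: quat, y). dist x y < e})"

definition open_quat :: "quat set \<Rightarrow> bool" where
  "open U \<longleftrightarrow> (\<forall>x\<in>U. eventually (\<lambda>(x', y). x' = x \<longrightarrow> y \<in> U) uniformity)" for U :: "quat set"

instance
proof
  fix r :: real and x y :: quat
  show "(norm x = 0) = (x = 0)"
    using quat_sumsq_eq_0_iff[of x] by (simp add: norm_quat_def)
  define P where "P z = (Complex (qre z) (qi z), Complex (qj z) (qk z))" for z
  have n: "norm z = norm (P z)" for z :: quat
    by (simp add: norm_quat_def P_def norm_prod_def norm_complex_def add.assoc)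
  have "P (x + y) = P x + P y"
    by (simp add: P_def complex_eq_iff)
  then show "norm (x + y) \<le> norm x + norm y"
    using norm_triangle_ineq[of "P x" "P y"] by (simp add: n)
  have "P (scaleR r x) = scaleR r (P x)"
    by (simp add: P_def complex_eq_iff)
  then show "norm (scaleR r x) = \<bar>r\<bar> * norm x"
    by (simp add: n)
  show "norm (x * y) = norm x * norm y"
    by (simp add: norm_quat_def real_sqrt_mult [symmetric] power2_eq_square algebra_simps)
qed (rule sgn_quat_def dist_quat_def open_quat_def uniformity_quat_def)+

end

instantiation quat :: euclidean_space
begin

definition inner_quat :: "quat \<Rightarrow> quat \<Rightarrow> real" where
  "inner x y = qre x * qre y + qi x * qi y + qj x * qj y + qk x * qk y"

definition Basis_quat :: "quat set" where
  "Basis = {Quat 1 0 0 0, Quat 0 1 0 0, Quat 0 0 1 0, Quat 0 0 0 1}"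

instance
proof
  fix x y z :: quat and r :: real
  show "0 \<le> inner x x" by (simp add: inner_quat_def)
  show "inner x x = 0 \<longleftrightarrow> x = 0"
    using quat_sumsq_eq_0_iff[of x] by (simp add: inner_quat_def power2_eq_square)
  show "norm x = sqrt (inner x x)"
    by (simp add: inner_quat_def norm_quat_def power2_eq_square)
  show "(\<forall>u\<in>Basis. inner x u = 0) \<longleftrightarrow> x = 0"
    by (simp add: Basis_quat_def inner_quat_def) (simp add: quat_eq_iff)
qed (auto simp: inner_quat_def Basis_quat_def algebra_simps)

end

section \<open>Scalars and matrices\<close>

class star_scalar = euclidean_space + real_normed_div_algebra +
  fixes cj :: "'a \<Rightarrow> 'a"
  assumes cj_add: "cj (x + y) = cj x + cj y"
    and cj_scaleR: "cj (scaleR r x) = scaleR r (cj x)"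
    and cj_mult: "cj (x * y) = cj y * cj x"
    and cj_cj: "cj (cj x) = x"
    and mult_cj: "x * cj x = scaleR ((norm x)\<^sup>2) 1"
    and add_cj: "x + cj x = scaleR (2 * inner x 1) 1"

instantiation real :: star_scalar
begin
definition cj_real :: "real \<Rightarrow> real" where "cj x = x" for x :: real
instance by standard (simp_all add: cj_real_def power2_eq_square)
end

instantiation complex :: star_scalar
begin
definition cj_complex :: "complex \<Rightarrow> complex" where "cj = cnj"
instance
  by standard (simp_all add: cj_complex_def complex_eq_iff complex_norm_square[symmetric] cmod_power2
    power2_eq_square)
end

instantiation quat :: star_scalar
begin
definition cj_quat :: "quat \<Rightarrow> quat" where "cj x = Quat (qre x) (- qi x) (- qj x) (- qk x)"
instance
  by standard (simp_all add: cj_quat_def quat_eq_iff norm_quat_def inner_quat_def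
    power2_eq_square algebra_simps)
end

definition re :: "'f::star_scalar \<Rightarrow> real" where
  "re x = inner x 1"

lemma re_real: "re (x::real) = x" and re_complex: "re z = Re z" and re_quat: "re q = qre q"
  by (simp_all add: re_def inner_quat_def)

definition mstar :: "'f::star_scalar^'n^'n \<Rightarrow> 'f^'n^'n" where
  "mstar A = (\<chi> a b. cj (A $ b $ a))"

definition commutator :: "'f::star_scalar^'n^'n \<Rightarrow> 'f^'n^'n \<Rightarrow> 'f^'n^'n" where
  "commutator X Y = X ** Y - Y ** X"

definition ip :: "'f::star_scalar^'n^'n \<Rightarrow> 'f^'n^'n \<Rightarrow> real" where
  "ip X Y = - (1/2) * re (trace (X ** Y))"

text \<open>The product \<open>*\<close> of the type \<open>'f^'n^'n\<close> is componentwise, so the library function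
  \<open>exp\<close> is not the matrix exponential.\<close>

definition mexp :: "'f::star_scalar^'n^'n \<Rightarrow> 'f^'n^'n" where
  "mexp X = (\<Sum>k. (1 / fact k) *\<^sub>R (((\<lambda>Y. X ** Y) ^^ k) (mat 1)))"

type_synonym ('f, 'n) sqmat = "'f^'n^'n"

section \<open>Homogeneous spaces of closed matrix groups\<close>

definition lie_algebra :: "('f::star_scalar^'n^'n) set \<Rightarrow> ('f^'n^'n) set" where
  "lie_algebra G = {X. \<forall>t. mexp (t *\<^sub>R X) \<in> G}"

definition coset :: "('f::star_scalar^'n^'n) set \<Rightarrow> 'f^'n^'n \<Rightarrow> ('f^'n^'n) set" where
  "coset K a = {a ** k |k. k \<in> K}"

text \<open>The tangent bundle of \<open>G/K\<close> is the quotient of the group \<open>TG\<close> by its subgroup \<open>TK\<close>.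
  For \<open>a \<in> G\<close> and \<open>v \<in> T\<^sub>aG = a\<gg>\<close>, the image of \<open>v\<close> in \<open>T\<^bsub>aK\<^esub>(G/K)\<close> is the \<open>TK\<close>-orbit of
  \<open>(a, v)\<close>. In particular \<open>tangent K (mat 1) X\<close> is the velocity at \<open>t = 0\<close> of \<open>exp(tX)K\<close>,
  left translation by \<open>b\<close> sends \<open>tangent K a v\<close> to \<open>tangent K (b ** a) (b ** v)\<close>, and for
  \<open>K \<subseteq> H\<close> the differential of \<open>G/K \<rightarrow> G/H\<close> sends \<open>tangent K a v\<close> to \<open>tangent H a v\<close>.\<close>

type_synonym ('f, 'n) tangent_vector = "(('f^'n^'n) \<times> ('f^'n^'n)) set"

type_synonym ('f, 'n) metric_tensor =
  "('f, 'n) tangent_vector \<Rightarrow> ('f, 'n) tangent_vector \<Rightarrow> real"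

definition tangent ::
    "('f::star_scalar^'n^'n) set \<Rightarrow> 'f^'n^'n \<Rightarrow> 'f^'n^'n \<Rightarrow> ('f, 'n) tangent_vector" where
  "tangent K a v = {(a ** k, (v + a ** w) ** k) |k w. k \<in> K \<and> w \<in> lie_algebra K}"

text \<open>A \<open>G\<close>-invariant Riemannian metric on \<open>G/K\<close>: an inner product on every tangent space,
  preserved by left translations. Smoothness follows from invariance.\<close>

definition invariant_metric ::
    "('f::star_scalar^'n^'n) set \<Rightarrow> ('f^'n^'n) set \<Rightarrow> ('f, 'n) metric_tensor \<Rightarrow> bool" where
  "invariant_metric G K g \<longleftrightarrow>
    (\<forall>a\<in>G. \<forall>X\<in>lie_algebra G. \<forall>Y\<in>lie_algebra G.
       g (tangent K a (a ** X)) (tangent K a (a ** Y)) =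
         g (tangent K a (a ** Y)) (tangent K a (a ** X)) \<and>
       (\<forall>Z\<in>lie_algebra G. g (tangent K a (a ** (X + Y))) (tangent K a (a ** Z)) =
         g (tangent K a (a ** X)) (tangent K a (a ** Z)) +
         g (tangent K a (a ** Y)) (tangent K a (a ** Z))) \<and>
       (\<forall>r. g (tangent K a (a ** (r *\<^sub>R X))) (tangent K a (a ** Y)) =
         r * g (tangent K a (a ** X)) (tangent K a (a ** Y))) \<and>
       (X \<notin> lie_algebra K \<longrightarrow> 0 < g (tangent K a (a ** X)) (tangent K a (a ** X))) \<and>
       (\<forall>b\<in>G. g (tangent K (b ** a) (b ** a ** X)) (tangent K (b ** a) (b ** a ** Y)) =
         g (tangent K a (a ** X)) (tangent K a (a ** Y))))"

definition complement ::
    "('f::star_scalar^'n^'n) set \<Rightarrow> ('f^'n^'n) set \<Rightarrow> ('f^'n^'n) set" where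
  "complement G K = {X \<in> lie_algebra G. \<forall>Y\<in>lie_algebra K. ip X Y = 0}"

text \<open>Let \<open>\<mm>\<close> be the orthogonal complement of the Lie algebra of \<open>K\<close> in that of \<open>G\<close>. For
  \<open>a \<in> G\<close>, the map \<open>x \<mapsto> a exp(x) K\<close> is a chart of \<open>G/K\<close> on a neighbourhood of \<open>0\<close> in \<open>\<mm>\<close>,
  centred at \<open>aK\<close>. The next two definitions are the metric tensor and the Christoffel symbols
  of the first kind in this chart. A curve \<open>\<gamma>\<close> is a geodesic if, at every time \<open>t0\<close>, it
  satisfies \<open>g\<^sub>w\<^sub>k c''\<^sup>k + \<Gamma>\<^sub>w\<^sub>,\<^sub>k\<^sub>l c'\<^sup>k c'\<^sup>l = 0\<close> in the chart centred at \<open>\<gamma>(t0)\<close>, where \<open>c\<close> is the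
  coordinate expression of \<open>\<gamma>\<close>, i.e. if the Levi-Civita acceleration vanishes.\<close>

definition chart_metric ::
    "('f::star_scalar^'n^'n) set \<Rightarrow> ('f, 'n) metric_tensor \<Rightarrow> 'f^'n^'n \<Rightarrow>
      'f^'n^'n \<Rightarrow> 'f^'n^'n \<Rightarrow> 'f^'n^'n \<Rightarrow> real" where
  "chart_metric K g a x u v =
    g (tangent K (a ** mexp x) (frechet_derivative (\<lambda>y. a ** mexp y) (at x) u))
      (tangent K (a ** mexp x) (frechet_derivative (\<lambda>y. a ** mexp y) (at x) v))"

definition christoffel ::
    "('f::star_scalar^'n^'n) set \<Rightarrow> ('f, 'n) metric_tensor \<Rightarrow> 'f^'n^'n \<Rightarrow>
      'f^'n^'n \<Rightarrow> 'f^'n^'n \<Rightarrow> 'f^'n^'n \<Rightarrow> 'f^'n^'n \<Rightarrow> real" where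
  "christoffel K g a x u v w = 1/2 *
    (vector_derivative (\<lambda>t. chart_metric K g a (x + t *\<^sub>R u) v w) (at 0) +
     vector_derivative (\<lambda>t. chart_metric K g a (x + t *\<^sub>R v) u w) (at 0) -
     vector_derivative (\<lambda>t. chart_metric K g a (x + t *\<^sub>R w) u v) (at 0))"

definition geodesic ::
    "('f::star_scalar^'n^'n) set \<Rightarrow> ('f^'n^'n) set \<Rightarrow> ('f, 'n) metric_tensor \<Rightarrow>
      (real \<Rightarrow> ('f^'n^'n) set) \<Rightarrow> bool" where
  "geodesic G K g \<gamma> \<longleftrightarrow>
    (\<forall>t0. \<exists>a\<in>G. \<exists>c c' c''. c t0 = 0 \<and>
      (\<forall>\<^sub>F t in nhds t0. c t \<in> complement G K \<and> \<gamma> t = coset K (a ** mexp (c t)) \<and>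
         (c has_vector_derivative c' t) (at t)) \<and>
      (c' has_vector_derivative c'') (at t0) \<and>
      (\<forall>w\<in>complement G K.
         chart_metric K g a 0 c'' w + christoffel K g a 0 (c' t0) (c' t0) w = 0))"

definition geodesic_vector ::
    "('f::star_scalar^'n^'n) set \<Rightarrow> ('f^'n^'n) set \<Rightarrow> ('f, 'n) metric_tensor \<Rightarrow> 'f^'n^'n \<Rightarrow> bool"
  where "geodesic_vector G K g X \<longleftrightarrow> geodesic G K g (\<lambda>t. coset K (mexp (t *\<^sub>R X)))"

definition equigeodesic ::
    "('f::star_scalar^'n^'n) set \<Rightarrow> ('f^'n^'n) set \<Rightarrow> 'f^'n^'n \<Rightarrow> bool" where
  "equigeodesic G K X \<longleftrightarrow> (\<forall>g. invariant_metric G K g \<longrightarrow> geodesic_vector G K g X)"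

definition horizontal ::
    "('f::star_scalar^'n^'n) set \<Rightarrow> ('f^'n^'n) set \<Rightarrow> ('f, 'n) metric_tensor \<Rightarrow>
      'f^'n^'n \<Rightarrow> 'f^'n^'n \<Rightarrow> bool" where
  "horizontal H K g a v \<longleftrightarrow>
    (\<forall>Z\<in>lie_algebra H. g (tangent K a v) (tangent K a (a ** Z)) = 0)"

text \<open>\<open>G/K \<rightarrow> G/H\<close>, \<open>aK \<mapsto> aH\<close>, is a Riemannian submersion from \<open>g\<close> to \<open>gb\<close>; being a smooth
  surjective submersion is automatic, and the vertical space at \<open>aK\<close> is the image of \<open>a\<hh>\<close>.\<close>

definition riemannian_submersion ::
    "('f::star_scalar^'n^'n) set \<Rightarrow> ('f^'n^'n) set \<Rightarrow> ('f^'n^'n) set \<Rightarrow>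
      ('f, 'n) metric_tensor \<Rightarrow> ('f, 'n) metric_tensor \<Rightarrow> bool" where
  "riemannian_submersion G H K g gb \<longleftrightarrow>
    (\<forall>a\<in>G. \<forall>X\<in>lie_algebra G. \<forall>Y\<in>lie_algebra G.
       horizontal H K g a (a ** X) \<longrightarrow> horizontal H K g a (a ** Y) \<longrightarrow>
       gb (tangent H a (a ** X)) (tangent H a (a ** Y)) =
         g (tangent K a (a ** X)) (tangent K a (a ** Y)))"

definition pi_equigeodesic ::
    "('f::star_scalar^'n^'n) set \<Rightarrow> ('f^'n^'n) set \<Rightarrow> ('f^'n^'n) set \<Rightarrow>
      ('f, 'n) metric_tensor \<Rightarrow> 'f^'n^'n \<Rightarrow> bool" where
  "pi_equigeodesic G H K gb X \<longleftrightarrow>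
    (\<forall>g. invariant_metric G K g \<longrightarrow> riemannian_submersion G H K g gb \<longrightarrow> geodesic_vector G K g X)"

definition metric_operator ::
    "('f::star_scalar^'n^'n) set \<Rightarrow> ('f^'n^'n) set \<Rightarrow> ('f, 'n) metric_tensor \<Rightarrow>
      ('f^'n^'n \<Rightarrow> 'f^'n^'n) \<Rightarrow> bool" where
  "metric_operator N H gb L \<longleftrightarrow>
    (\<forall>X\<in>N. L X \<in> N) \<and>
    (\<forall>X\<in>N. \<forall>Y\<in>N. L (X + Y) = L X + L Y) \<and> (\<forall>r. \<forall>X\<in>N. L (r *\<^sub>R X) = r *\<^sub>R L X) \<and>
    (\<forall>X\<in>N. \<forall>Y\<in>N. gb (tangent H (mat 1) X) (tangent H (mat 1) Y) = ip (L X) Y)"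

section \<open>Block matrices and the three families\<close>

text \<open>Number (from \<open>1\<close>) of the block containing the index \<open>a\<close>, when the ordered index type is cut
  into consecutive intervals of lengths \<open>d 1, d 2, \<dots>\<close>.\<close>

definition blk :: "(nat \<Rightarrow> nat) \<Rightarrow> 'n::{finite,linorder} \<Rightarrow> nat" where
  "blk d a = (LEAST i. card {b. b \<le> a} \<le> (\<Sum>k=1..i. d k))"

text \<open>The block \<open>X\<^sub>i\<^sub>j\<close>, padded with zeros to the full size and left in place; products of blocks
  of composable shapes, adjoints and vanishing agree with those of the rectangular blocks.\<close>

definition block ::
    "(nat \<Rightarrow> nat) \<Rightarrow> ('f::star_scalar, 'n::{finite,linorder}) sqmat \<Rightarrow> nat \<Rightarrow> nat \<Rightarrow> ('f, 'n) sqmat" where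
  "block d X i j = (\<chi> a b. if blk d a = i \<and> blk d b = j then X $ a $ b else 0)"

definition mm ::
    "(nat \<Rightarrow> nat) \<Rightarrow> nat \<Rightarrow> nat \<Rightarrow> nat \<Rightarrow> ('f::star_scalar, 'n::{finite,linorder}) sqmat set" where
  "mm d s i j = {X. (\<forall>k\<in>{1..s}. \<forall>l\<in>{1..s}. (k, l) \<notin> {(i, j), (j, i)} \<longrightarrow> block d X k l = 0) \<and>
     block d X j i = - mstar (block d X i j)}"

definition pp :: "(nat \<Rightarrow> nat) \<Rightarrow> nat \<Rightarrow> ('f::star_scalar, 'n::{finite,linorder}) sqmat set" where
  "pp d s = mm d s 1 2"

definition nn :: "(nat \<Rightarrow> nat) \<Rightarrow> nat \<Rightarrow> ('f::star_scalar, 'n::{finite,linorder}) sqmat set" where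
  "nn d s = span (\<Union>(i, j)\<in>{(i, j). 1 \<le> i \<and> i < j \<and> j \<le> s \<and> (i, j) \<noteq> (1, 2)}. mm d s i j)"

definition unitary_group :: "('f::star_scalar^'n^'n) set" where
  "unitary_group = {A. A ** mstar A = mat 1 \<and> mstar A ** A = mat 1}"

definition SO_group :: "(real^'n^'n) set" where
  "SO_group = {A \<in> unitary_group. det A = 1}"

definition SU_group :: "(complex^'n^'n) set" where
  "SU_group = {A \<in> unitary_group. det A = 1}"

definition Sp_group :: "(quat^'n^'n) set" where
  "Sp_group = unitary_group"

text \<open>A block-diagonal matrix is unitary iff its diagonal blocks are, so for
  \<open>G = SO(n), SU(n), Sp(n)\<close> this is \<open>S(O(d\<^sub>1) \<times> \<dots>)\<close>, \<open>S(U(d\<^sub>1) \<times> \<dots>)\<close>, \<open>Sp(d\<^sub>1) \<times> \<dots>\<close>.\<close>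

definition block_subgroup ::
    "(nat \<Rightarrow> nat) \<Rightarrow> ('f::star_scalar, 'n::{finite,linorder}) sqmat set \<Rightarrow> ('f, 'n) sqmat set" where
  "block_subgroup d G = {A \<in> G. \<forall>a b. blk d a \<noteq> blk d b \<longrightarrow> A $ a $ b = 0}"

definition merge12 :: "(nat \<Rightarrow> nat) \<Rightarrow> nat \<Rightarrow> nat" where
  "merge12 d i = (if i = 1 then d 1 + d 2 else d (i + 1))"

text \<open>The operator \<open>\<Sum>\<^sub>r \<mu>\<^sub>r Id + \<Sum>\<^sub>i\<^sub><\<^sub>j \<mu>\<^sub>i\<^sub>j Id\<close>; the projection of a matrix in
  \<open>\<nn>\<close> to \<open>\<mm>\<^sub>i\<^sub>j\<close> keeps its blocks \<open>(i,j)\<close> and \<open>(j,i)\<close>.\<close>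

definition mm_proj ::
    "(nat \<Rightarrow> nat) \<Rightarrow> nat \<Rightarrow> nat \<Rightarrow> ('f::star_scalar, 'n::{finite,linorder}) sqmat \<Rightarrow> ('f, 'n) sqmat" where
  "mm_proj d i j X = block d X i j + block d X j i"

definition diagonal_operator ::
    "(nat \<Rightarrow> nat) \<Rightarrow> nat \<Rightarrow> (nat \<Rightarrow> real) \<Rightarrow> (nat \<Rightarrow> nat \<Rightarrow> real) \<Rightarrow>
      ('f::star_scalar, 'n::{finite,linorder}) sqmat \<Rightarrow> ('f, 'n) sqmat" where
  "diagonal_operator d s \<mu> \<nu> X =
    (\<Sum>r=3..s. \<mu> r *\<^sub>R (mm_proj d 1 r X + mm_proj d 2 r X)) +
    (\<Sum>(i, j)\<in>{(i, j). 3 \<le> i \<and> i < j \<and> j \<le> s}. \<nu> i j *\<^sub>R mm_proj d i j X)"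

definition block_equations ::
    "(nat \<Rightarrow> nat) \<Rightarrow> nat \<Rightarrow> (nat \<Rightarrow> real) \<Rightarrow> (nat \<Rightarrow> nat \<Rightarrow> real) \<Rightarrow>
      ('f::star_scalar, 'n::{finite,linorder}) sqmat \<Rightarrow> bool" where
  "block_equations d s \<mu> \<nu> X \<longleftrightarrow> (let B = block d X in
    (\<forall>r\<in>{3..s}. B 1 2 ** B 2 r = 0 \<and> mstar (B 1 2) ** B 1 r = 0) \<and>
    (\<forall>i\<in>{1, 2}. \<forall>r\<in>{3..s}.
       (\<Sum>k\<in>{3..<r}. (\<nu> k r - \<mu> k) *\<^sub>R (B i k ** B k r)) +
       (\<Sum>k\<in>{r+1..s}. (\<mu> k - \<nu> r k) *\<^sub>R (B i k ** mstar (B r k))) = 0) \<and>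
    (\<forall>i j. 3 \<le> i \<and> i < j \<and> j \<le> s \<longrightarrow>
       (\<mu> i - \<mu> j) *\<^sub>R (mstar (B 1 i) ** B 1 j + mstar (B 2 i) ** B 2 j) +
       (\<Sum>k\<in>{3..<i}. (\<nu> k i - \<nu> k j) *\<^sub>R (mstar (B k i) ** B k j)) +
       (\<Sum>k\<in>{i+1..<j}. (\<nu> k j - \<nu> i k) *\<^sub>R (B i k ** B k j)) +
       (\<Sum>k\<in>{j+1..s}. (\<nu> i k - \<nu> j k) *\<^sub>R (B i k ** mstar (B j k))) = 0))"

end

(*
In blocks, the isotropy groups contain all signed and unit-scalar diagonal matrices that their
determinant condition admits and quarter turns inside blocks. As n >= 5, these force every
invariant inner product on the tangent space to be (Lambda X, Y) with Lambda an entrywise weight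
that depends only on the blocks. A vector X of the reductive complement m is geodesic iff the
m-part of [Lambda X, X] vanishes: the curve exp(tX)K reads tX in the exponential chart at its
base point, and the Christoffel symbol of X, X, w there is (Lambda X, [w, X]).

A metric on G/K that submerses onto g_b is lambda on p and Lambda_b on n, with lambda > 0
arbitrary. For X = P + N the condition becomes
  [Lambda_b N, N] + Lambda_b [N, P] + lambda [P, N] = 0  for all lambda,
that is, [P, N] = 0 and [Lambda_b N, N] = 0; the block equations are these two, read block by block.
*)
theory Submission
  imports Defs
begin

section \<open>Scalars and matrices\<close>

text \<open>The definition of a geodesic admits every chart representative and every coordinate
  curve, so the converse half of the criterion needs uniqueness of the coordinate curve. It is
  obtained without local injectivity of the chart: the projection to m annihilates the isotropy
  group itself, not only its Lie algebra, so applied to a curve in that group it can simply be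
  differentiated twice. The Christoffel symbols come from the first-order term of the differential
  of exp near 0. One argument serves R, C and H. A unit scalar in one diagonal place multiplies an
  elementary skew matrix by that scalar, and unit scalars act transitively on the unit sphere of F;
  so the form is a multiple of the norm on each elementary line, with no decomposition of the
  isotropy representation. Since quaternions do not commute, only the real part of the trace is
  cyclic. Lambda_b commutes with ad P because its weights are constant on the blocks of H; hence the
  middle term of the displayed condition. All three terms have zero diagonal blocks of H, so
  projecting to m loses nothing.\<close>

lemma linear_cj: "linear (cj :: 'f::star_scalar \<Rightarrow> 'f)"
  by (rule linearI) (simp_all add: cj_add cj_scaleR)

lemma cj_0 [simp]: "cj 0 = (0 :: 'f::star_scalar)"
  and cj_minus [simp]: "cj (- x) = - cj (x :: 'f)"
  and cj_sum: "cj (sum f A) = (\<Sum>i\<in>A. cj (f i :: 'f))"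
  using linear_cj by (auto intro: linear_0 linear_neg linear_sum)

lemma cj_1 [simp]: "cj 1 = (1 :: 'f::star_scalar)"
  by (metis cj_cj cj_mult mult_1_left mult_1_right)

lemma norm_cj [simp]: "norm (cj x) = norm (x :: 'f::star_scalar)"
proof (cases "x = 0")
  case False
  have "norm x * norm (cj x) = norm x * norm x"
    using arg_cong[OF mult_cj[of x], of norm] by (simp add: norm_mult power2_eq_square)
  then show ?thesis using False by simp
qed simp

lemma cj_mult_self: "cj x * x = (norm (x :: 'f::star_scalar))\<^sup>2 *\<^sub>R 1"
  using mult_cj[of "cj x"] by (simp add: cj_cj)

lemma re_add: "re (x + y) = re x + re y" and re_diff: "re (x - y) = re x - re y"
  and re_minus: "re (- x) = - re x" and re_scaleR: "re (r *\<^sub>R x) = r * re x"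
  and re_0 [simp]: "re 0 = 0" and re_sum: "re (sum f A) = (\<Sum>i\<in>A. re (f i))"
  by (simp_all add: re_def inner_left_distrib inner_diff_left inner_sum_left)

lemma re_1 [simp]: "re (1 :: 'f::star_scalar) = 1"
  by (simp add: re_def dot_square_norm)

lemma add_cj_re: "x + cj x = (2 * re x) *\<^sub>R 1"
  by (simp add: re_def add_cj)

text \<open>Polarization: the class provides only \<open>x * cj x\<close>, and the mixed terms of
  \<open>(x + y) * cj (x + y)\<close> are an element plus its conjugate, hence twice a real
  part.\<close>

lemma re_mult_cj: "re (x * cj y) = inner x (y :: 'f::star_scalar)"
proof -
  have "(x + y) * cj (x + y) = x * cj x + y * cj y + (x * cj y + cj (x * cj y))"
    by (simp add: cj_add cj_mult cj_cj algebra_simps)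
  then have "(norm (x + y))\<^sup>2 *\<^sub>R (1 :: 'f) = ((norm x)\<^sup>2 + (norm y)\<^sup>2 + 2 * re (x * cj y)) *\<^sub>R 1"
    by (simp add: mult_cj add_cj_re scaleR_add_left)
  then have "(norm (x + y))\<^sup>2 = (norm x)\<^sup>2 + (norm y)\<^sup>2 + 2 * re (x * cj y)"
    by simp
  then show ?thesis
    by (simp add: power2_norm_eq_inner inner_add inner_commute)
qed

lemma re_cj_mult: "re (cj x * y) = inner x (y :: 'f::star_scalar)"
proof -
  have "cj (x + y) * (x + y) = cj x * x + cj y * y + (cj x * y + cj (cj x * y))"
    by (simp add: cj_add cj_mult cj_cj algebra_simps)
  then have "(norm (x + y))\<^sup>2 *\<^sub>R (1 :: 'f) = ((norm x)\<^sup>2 + (norm y)\<^sup>2 + 2 * re (cj x * y)) *\<^sub>R 1"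
    by (simp add: cj_mult_self add_cj_re scaleR_add_left)
  then have "(norm (x + y))\<^sup>2 = (norm x)\<^sup>2 + (norm y)\<^sup>2 + 2 * re (cj x * y)"
    by simp
  then show ?thesis
    by (simp add: power2_norm_eq_inner inner_add inner_commute)
qed

text \<open>For quaternions \<open>x * y\<close> and \<open>y * x\<close> differ, but both orders
  polarize to the same Euclidean inner product. Cyclicity of the trace form rests on this.\<close>

lemma re_mult_commute: "re (x * y) = re (y * (x :: 'f::star_scalar))"
  using re_mult_cj[of x "cj y"] re_cj_mult[of "cj y" x] by (simp add: cj_cj inner_commute)

section \<open>Matrix product, adjoint and invariant form\<close>

lemma bilinear_matrix_mult: "bilinear ((**) :: 'f::star_scalar^'n^'n \<Rightarrow> _)"
  unfolding bilinear_def
  by (intro conjI allI linearI)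
    (simp_all add: vec_eq_iff matrix_matrix_mult_def sum.distrib algebra_simps scaleR_sum_right)

lemma bounded_bilinear_matrix_mult:
  "bounded_bilinear ((**) :: 'f::star_scalar^'n^'n \<Rightarrow> _)"
  using bilinear_matrix_mult by (simp add: bilinear_conv_bounded_bilinear)

lemmas matrix_bilinear = bounded_bilinear_matrix_mult
lemmas matrix_mult_simps [simp] =
  bounded_bilinear.add_left[OF matrix_bilinear] bounded_bilinear.add_right[OF matrix_bilinear]
  bounded_bilinear.diff_left[OF matrix_bilinear] bounded_bilinear.diff_right[OF matrix_bilinear]
  bounded_bilinear.minus_left[OF matrix_bilinear] bounded_bilinear.minus_right[OF matrix_bilinear]
  bounded_bilinear.scaleR_left[OF matrix_bilinear] bounded_bilinear.scaleR_right[OF matrix_bilinear]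
  bounded_bilinear.zero_left[OF matrix_bilinear] bounded_bilinear.zero_right[OF matrix_bilinear]

text \<open>The norm of the nested vector type is the Frobenius norm: Cauchy-Schwarz bounds each
  entry by a row norm times the column norm \<open>c b\<close>, and these bounds are summed in
  squares.\<close>

lemma norm_matrix_mult: "norm (A ** B) \<le> norm A * norm (B :: 'f::star_scalar^'n^'n)"
proof -
  define c where "c b = L2_set (\<lambda>k. norm (B $ k $ b)) UNIV" for b
  have "L2_set c UNIV = norm B"
    by (simp add: c_def L2_set_def norm_vec_def sum_nonneg)
      (subst sum.swap, simp)
  moreover have entry: "norm ((A ** B) $ a $ b) \<le> norm (A $ a) * c b" for a b
  proof -
    have "norm ((A ** B) $ a $ b) \<le> (\<Sum>k\<in>UNIV. \<bar>norm (A $ a $ k)\<bar> * \<bar>norm (B $ k $ b)\<bar>)"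
      by (simp add: matrix_matrix_mult_def sum_norm_le norm_mult)
    also have "\<dots> \<le> norm (A $ a) * c b"
      using L2_set_mult_ineq[of "\<lambda>k. norm (A $ a $ k)" "\<lambda>k. norm (B $ k $ b)" UNIV]
      by (simp add: c_def norm_vec_def)
    finally show ?thesis .
  qed
  have "norm ((A ** B) $ a) \<le> norm (A $ a) * L2_set c UNIV" for a
    unfolding norm_vec_def[of "(A ** B) $ a"]
    using L2_set_mono[of UNIV "\<lambda>b. norm ((A ** B) $ a $ b)" "\<lambda>b. norm (A $ a) * c b"]
    by (simp add: entry L2_set_right_distrib)
  then show ?thesis
    using L2_set_mono[of UNIV "\<lambda>a. norm ((A ** B) $ a)" "\<lambda>a. norm (A $ a) * norm B"]
      \<open>L2_set c UNIV = norm B\<close>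
    by (simp add: norm_vec_def[of "A ** B"] norm_vec_def[of A] L2_set_left_distrib)
qed

lemma linear_mstar: "linear (mstar :: 'f::star_scalar^'n^'n \<Rightarrow> _)"
  by (rule linearI) (simp_all add: mstar_def vec_eq_iff cj_add cj_scaleR)

lemma mstar_0 [simp]: "mstar 0 = 0"
  and mstar_add: "mstar (A + B) = mstar A + mstar B"
  and mstar_diff: "mstar (A - B) = mstar A - mstar B"
  and mstar_scaleR: "mstar (r *\<^sub>R A) = r *\<^sub>R mstar A"
  using linear_mstar
  by (auto intro: linear_0 linear_add linear_diff linear_scale)

lemma mstar_nth: "mstar A $ a $ b = cj (A $ b $ a)"
  by (simp add: mstar_def)

lemma mstar_mstar [simp]: "mstar (mstar A) = A"
  by (simp add: mstar_def vec_eq_iff cj_cj)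

lemma mstar_mult: "mstar (A ** B) = mstar B ** mstar A"
  by (simp add: mstar_def vec_eq_iff matrix_matrix_mult_def cj_sum cj_mult)

lemma mstar_mat_1 [simp]: "mstar (mat 1) = mat 1"
  by (auto simp: mstar_def vec_eq_iff mat_def)

lemma re_trace_mult_commute: "re (trace (A ** B)) = re (trace (B ** A))"
proof -
  have "re (trace (A ** B)) = (\<Sum>i\<in>UNIV. \<Sum>j\<in>UNIV. re (A $ i $ j * B $ j $ i))"
    by (simp add: trace_def matrix_matrix_mult_def re_sum)
  also have "\<dots> = (\<Sum>j\<in>UNIV. \<Sum>i\<in>UNIV. re (A $ i $ j * B $ j $ i))"
    by (rule sum.swap)
  also have "\<dots> = re (trace (B ** A))"
    by (simp add: trace_def matrix_matrix_mult_def re_sum re_mult_commute)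
  finally show ?thesis .
qed

lemma trace_linear: "trace (A + B) = trace A + trace B" "trace (A - B) = trace A - trace B"
  "trace (r *\<^sub>R A) = r *\<^sub>R trace (A :: 'f::star_scalar^'n^'n)" "trace (- A) = - trace A" "trace (0 :: 'f^'n^'n) = 0"
  by (simp_all add: trace_def sum.distrib sum_subtractf sum_negf scaleR_sum_right)

lemma ip_add_left: "ip (X + Y) Z = ip X Z + ip Y Z"
  and ip_add_right: "ip X (Y + Z) = ip X Y + ip X Z"
  and ip_diff_left: "ip (X - Y) Z = ip X Z - ip Y Z"
  and ip_scaleR_left: "ip (r *\<^sub>R X) Y = r * ip X Y"
  and ip_zero [simp]: "ip 0 X = 0" "ip X 0 = 0"
  by (simp_all add: ip_def trace_linear re_add re_diff re_scaleR re_minus field_simps)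

lemma ip_commute: "ip X Y = ip Y X"
  unfolding ip_def by (subst re_trace_mult_commute) (rule refl)

text \<open>Infinitesimal Ad-invariance of the form. It later turns a pairing with
  \<open>commutator X w\<close> into a pairing of one fixed matrix with the free vector
  \<open>w\<close>.\<close>

lemma ip_commutator: "ip (commutator X Y) Z = ip X (commutator Y Z)"
proof -
  have "re (trace (Y ** X ** Z)) = re (trace (X ** Z ** Y))"
    using re_trace_mult_commute[of Y "X ** Z"] by (simp add: matrix_mul_assoc)
  then show ?thesis
    by (simp add: ip_def commutator_def trace_linear re_diff matrix_mul_assoc)
qed

lemma ip_conj:
  assumes "mstar A ** A = mat 1"
  shows "ip (A ** X ** mstar A) (A ** Y ** mstar A) = ip X Y"
proof -
  have "A ** X ** mstar A ** (A ** Y ** mstar A) = A ** X ** (mstar A ** A) ** Y ** mstar A"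
    by (simp add: matrix_mul_assoc)
  then have "re (trace (A ** X ** mstar A ** (A ** Y ** mstar A))) = re (trace (A ** (X ** Y ** mstar A)))"
    by (simp add: assms matrix_mul_assoc)
  also have "\<dots> = re (trace (X ** Y ** (mstar A ** A)))"
    by (subst re_trace_mult_commute) (simp add: matrix_mul_assoc)
  finally show ?thesis by (simp add: ip_def assms)
qed

lemma ip_mstar_left: "ip (- mstar X) Y = 1/2 * inner X Y"
proof -
  have "re (trace (mstar X ** Y)) = (\<Sum>i\<in>UNIV. \<Sum>j\<in>UNIV. inner (X $ j $ i) (Y $ j $ i))"
    by (simp add: trace_def matrix_matrix_mult_def re_sum mstar_nth re_cj_mult)
  also have "\<dots> = inner X Y"
    by (subst sum.swap) (simp add: inner_vec_def)
  finally show ?thesis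
    by (simp add: ip_def trace_linear re_minus)
qed

text \<open>Positive definiteness on skew matrices comes from here, and orthogonality can be read
  off from disjoint supports of entries.\<close>

lemma ip_skew: "mstar X = - X \<Longrightarrow> ip X Y = 1/2 * inner X Y"
  using ip_mstar_left[of X Y] by simp

section \<open>The matrix exponential\<close>

definition mpow :: "'f::star_scalar^'n^'n \<Rightarrow> nat \<Rightarrow> 'f^'n^'n" where
  "mpow X k = ((\<lambda>Y. X ** Y) ^^ k) (mat 1)"

lemma mpow_0 [simp]: "mpow X 0 = mat 1" and mpow_Suc: "mpow X (Suc k) = X ** mpow X k"
  by (simp_all add: mpow_def)

lemma mpow_Suc2: "mpow X (Suc k) = mpow X k ** X"
  by (induction k) (simp_all add: mpow_Suc matrix_mul_assoc)

lemma mexp_mpow: "mexp X = (\<Sum>k. (1 / fact k) *\<^sub>R mpow X k)"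
  by (simp add: mexp_def mpow_def)

text \<open>The directional derivative of the k-th power: the sum of all x^i h x^j with i + j = k -
  1, kept recursive because \<open>x\<close> and \<open>h\<close> need not commute.\<close>

primrec dpow :: "'f::star_scalar^'n^'n \<Rightarrow> nat \<Rightarrow> 'f^'n^'n \<Rightarrow> 'f^'n^'n" where
  "dpow x 0 h = 0"
| "dpow x (Suc k) h = h ** mpow x k + x ** dpow x k h"

definition dexp :: "'f::star_scalar^'n^'n \<Rightarrow> 'f^'n^'n \<Rightarrow> 'f^'n^'n" where
  "dexp x h = (\<Sum>k. (1 / fact k) *\<^sub>R dpow x k h)"

text \<open>The factor \<open>norm (mat 1)\<close> appears because the Frobenius norm of the
  identity need not be 1.\<close>

lemma norm_mpow: "norm (mpow X k) \<le> norm (mat 1 :: 'f^'n^'n) * norm X ^ k"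
  for X :: "'f::star_scalar^'n^'n"
proof (induction k)
  case (Suc k)
  have "norm (mpow X (Suc k)) \<le> norm X * norm (mpow X k)"
    by (simp add: mpow_Suc norm_matrix_mult)
  also have "\<dots> \<le> norm X * (norm (mat 1 :: 'f^'n^'n) * norm X ^ k)"
    by (intro mult_left_mono Suc) simp
  finally show ?case by (simp add: mult_ac)
qed simp

lemma summable_mexp: "summable (\<lambda>k. (1 / fact k) *\<^sub>R mpow X k)" for X :: "'f::star_scalar^'n^'n"
proof (rule summable_comparison_test')
  show "summable (\<lambda>k. norm (mat 1 :: 'f^'n^'n) * (norm X ^ k /\<^sub>R fact k))"
    by (intro summable_mult summable_exp_generic)
  show "norm ((1 / fact k) *\<^sub>R mpow X k) \<le> norm (mat 1 :: 'f^'n^'n) * (norm X ^ k /\<^sub>R fact k)" for k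
    using norm_mpow[of X k] by (simp add: divide_simps)
qed

lemma norm_dpow_Suc: "norm (dpow x (Suc k) h) \<le> norm (mat 1 :: 'f^'n^'n) * real (Suc k) * norm x ^ k * norm h"
  for x :: "'f::star_scalar^'n^'n"
proof (induction k)
  case 0
  then show ?case using norm_matrix_mult[of h "mat 1"] by (simp add: mult.commute)
next
  case (Suc k)
  define M where "M = norm (mat 1 :: 'f^'n^'n)"
  have "norm (dpow x (Suc (Suc k)) h) \<le> norm h * norm (mpow x (Suc k)) + norm x * norm (dpow x (Suc k) h)"
    by (subst dpow.simps) (intro norm_triangle_le add_mono norm_matrix_mult)
  also have "\<dots> \<le> norm h * (M * norm x ^ Suc k) + norm x * (M * real (Suc k) * norm x ^ k * norm h)"
    using Suc norm_mpow[of x "Suc k"] unfolding M_def by (intro add_mono mult_left_mono) auto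
  also have "\<dots> = M * real (Suc (Suc k)) * norm x ^ Suc k * norm h"
    by (simp add: algebra_simps)
  finally show ?case by (simp add: M_def)
qed

text \<open>The k + 1 summands of \<open>dpow x (Suc k) h\<close> cancel one factor of the
  factorial, so the differentiated series is again dominated by an exponential series, shifted by
  one.\<close>

lemma norm_dexp_term:
  "norm ((1 / fact (Suc k)) *\<^sub>R dpow x (Suc k) h) \<le> norm (mat 1 :: 'f^'n^'n) * norm h * (norm x ^ k /\<^sub>R fact k)"
  for x :: "'f::star_scalar^'n^'n"
proof -
  have "norm ((1 / fact (Suc k)) *\<^sub>R dpow x (Suc k) h)
      \<le> (1 / fact (Suc k)) * (norm (mat 1 :: 'f^'n^'n) * real (Suc k) * norm x ^ k * norm h)"
    unfolding norm_scaleR using norm_dpow_Suc[of x k h] by (intro mult_mono) auto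
  also have "\<dots> = norm (mat 1 :: 'f^'n^'n) * norm h * (norm x ^ k /\<^sub>R fact k)"
    by (simp add: divide_simps)
  finally show ?thesis .
qed

lemma summable_dexp: "summable (\<lambda>k. (1 / fact k) *\<^sub>R dpow x k h)"
  for x :: "'f::star_scalar^'n^'n"
proof -
  have "summable (\<lambda>k. (1 / fact (Suc k)) *\<^sub>R dpow x (Suc k) h)"
    by (rule summable_comparison_test'[OF _ norm_dexp_term])
      (intro summable_mult summable_exp_generic)
  then show ?thesis by (rule summable_Suc_iff[THEN iffD1])
qed

lemma mpow_has_derivative: "((\<lambda>x. mpow x k) has_derivative dpow x k) (at x within S)"
proof (induction k)
  case (Suc k)
  have "((\<lambda>x. x ** mpow x k) has_derivative (\<lambda>h. x ** dpow x k h + h ** mpow x k)) (at x within S)"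
    by (rule bounded_bilinear.FDERIV[OF matrix_bilinear has_derivative_ident Suc])
  then show ?case by (simp add: mpow_Suc[abs_def] add.commute)
qed simp

lemma mexp_has_derivative: "(mexp has_derivative dexp x) (at x)" for x :: "'f::star_scalar^'n^'n"
proof -
  \<comment> \<open>Termwise differentiation needs uniform tails on a convex set. The bounds are
    uniform on balls around 0, and this radius puts \<open>x\<close> inside.\<close>
  define R where "R = norm x + 1"
  define M where "M = norm (mat 1 :: 'f^'n^'n)"
  let ?f = "\<lambda>k x. (1 / fact k) *\<^sub>R mpow x k :: 'f^'n^'n"
  let ?S = "ball (0 :: 'f^'n^'n) R"
  have x: "x \<in> ?S" by (simp add: R_def)
  have "M \<ge> 0" "R > 0" by (simp_all add: M_def R_def add_nonneg_pos)
  have "\<exists>g. \<forall>x\<in>?S. (\<lambda>n. ?f n x) sums g x \<and> (g has_derivative dexp x) (at x within ?S)"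
  proof (rule has_derivative_series[OF _ _ _ x])
    show "convex ?S" by simp
    show "(?f n has_derivative (\<lambda>h. (1 / fact n) *\<^sub>R dpow x n h)) (at x within ?S)" for n x
      by (intro has_derivative_scaleR_right mpow_has_derivative)
    show "(\<lambda>n. ?f n x) sums mexp x"
      unfolding mexp_mpow by (rule summable_sums[OF summable_mexp])
    fix e :: real assume "e > 0"
    have sm: "summable (\<lambda>k. M * (R ^ k /\<^sub>R fact k))"
      by (intro summable_mult summable_exp_generic)
    from suminf_exist_split[OF \<open>e > 0\<close> sm] obtain n0 where
      n0: "\<And>n. n \<ge> n0 \<Longrightarrow> norm (\<Sum>i. M * (R ^ (i + n) /\<^sub>R fact (i + n))) < e" by blast
    show "\<forall>\<^sub>F n in sequentially. \<forall>y\<in>?S. \<forall>h.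
        norm ((\<Sum>i<n. (1 / fact i) *\<^sub>R dpow y i h) - dexp y h) \<le> e * norm h"
    \<comment> \<open>The dominating series is shifted by one against the differentiated one, hence
      the threshold \<open>Suc n0\<close>.\<close>
    proof (rule eventually_sequentiallyI[of "Suc n0"], intro ballI allI)
      fix n y h assume "n \<ge> Suc n0" and y: "y \<in> ?S"
      then obtain m where n: "n = Suc m" "m \<ge> n0" by (cases n) auto
      let ?d = "\<lambda>k. (1 / fact k) *\<^sub>R dpow y k h"
      have b: "norm (?d (k + n)) \<le> norm h * (M * (R ^ (k + m) /\<^sub>R fact (k + m)))" for k
      proof -
        have "norm (?d (k + n)) \<le> M * norm h * (norm y ^ (k + m) /\<^sub>R fact (k + m))"
          using norm_dexp_term[of "k + m" y h] by (simp add: n M_def)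
        also have "\<dots> \<le> M * norm h * (R ^ (k + m) /\<^sub>R fact (k + m))"
          using y \<open>M \<ge> 0\<close> by (intro mult_left_mono scaleR_left_mono power_mono) auto
        finally show ?thesis by (simp add: mult_ac)
      qed
      have sm': "summable (\<lambda>k. norm h * (M * (R ^ (k + m) /\<^sub>R fact (k + m))))"
        using summable_ignore_initial_segment[OF sm, of m] by (rule summable_mult)
      have "norm ((\<Sum>i<n. ?d i) - dexp y h) = norm (\<Sum>k. ?d (k + n))"
        unfolding dexp_def
        by (simp add: suminf_minus_initial_segment[OF summable_dexp] norm_minus_commute)
      also have "\<dots> \<le> (\<Sum>k. norm h * (M * (R ^ (k + m) /\<^sub>R fact (k + m))))"
      proof -
        have "summable (\<lambda>k. norm (?d (k + n)))"
          by (rule summable_comparison_test'[OF sm']) (use b in simp)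
        then show ?thesis
          by (intro order_trans[OF summable_norm suminf_le] b sm')
      qed
      also have "\<dots> = norm h * (\<Sum>k. M * (R ^ (k + m) /\<^sub>R fact (k + m)))"
        using summable_ignore_initial_segment[OF sm, of m] by (rule suminf_mult)
      also have "\<dots> \<le> norm h * e"
        using n0[OF n(2)] by (intro mult_left_mono) auto
      finally show "norm ((\<Sum>i<n. ?d i) - dexp y h) \<le> e * norm h"
        by (simp add: mult.commute)
    qed
  qed
  then obtain g where g: "\<And>x. x \<in> ?S \<Longrightarrow> (\<lambda>n. ?f n x) sums g x"
    "\<And>x. x \<in> ?S \<Longrightarrow> (g has_derivative dexp x) (at x within ?S)" by blast
  have "g y = mexp y" if "y \<in> ?S" for y
    using g(1)[OF that] by (simp add: mexp_mpow sums_iff)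
  then have "(mexp has_derivative dexp x) (at x within ?S)"
    by (metis (mono_tags, lifting) g(2)[OF x] has_derivative_transform x)
  then show ?thesis by (simp only: at_within_open[OF x open_ball])
qed

text \<open>Taylor expansion in \<open>x\<close>: the terms k = 1, 2 of the series are the explicit
  part, and the tail from k = 3 carries the square of \<open>norm x\<close>. First order is all that
  the geodesic equation at a chart centre asks for.\<close>

lemma dexp_second_order:
  "norm (dexp x h - (h + (1/2) *\<^sub>R (x ** h + h ** x)))
    \<le> norm (mat 1 :: 'f^'n^'n) * norm h * (norm x)\<^sup>2 * exp (norm x)"
  for x :: "'f::star_scalar^'n^'n"
proof -
  define M where "M = norm (mat 1 :: 'f^'n^'n)"
  let ?d = "\<lambda>k. (1 / fact k) *\<^sub>R dpow x k h"
  let ?b = "\<lambda>k. M * norm h * (norm x)\<^sup>2 * (norm x ^ k /\<^sub>R fact k)"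
  have b: "norm (?d (k + 3)) \<le> ?b k" for k
  proof -
    have "norm (?d (k + 3)) \<le> M * norm h * (norm x ^ (k + 2) /\<^sub>R fact (k + 2))"
      using norm_dexp_term[of "k + 2" x h] by (simp add: M_def numeral_3_eq_3)
    also have "\<dots> \<le> M * norm h * (norm x ^ (k + 2) /\<^sub>R fact k)"
      by (intro mult_left_mono scaleR_right_mono le_imp_inverse_le fact_mono) (auto simp: M_def)
    also have "\<dots> = ?b k" by (simp add: power_add power2_eq_square mult_ac)
    finally show ?thesis .
  qed
  have sm: "summable ?b" by (intro summable_mult summable_exp_generic)
  have "dexp x h - (h + (1/2) *\<^sub>R (x ** h + h ** x)) = dexp x h - (\<Sum>k<3. ?d k)"
    by (simp add: numeral_3_eq_3 mpow_Suc algebra_simps)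
  also have "\<dots> = (\<Sum>k. ?d (k + 3))"
    unfolding dexp_def by (rule suminf_minus_initial_segment[OF summable_dexp, symmetric])
  finally have "norm (dexp x h - (h + (1/2) *\<^sub>R (x ** h + h ** x))) = norm (\<Sum>k. ?d (k + 3))" by simp
  also have "\<dots> \<le> (\<Sum>k. ?b k)"
  proof -
    have "summable (\<lambda>k. norm (?d (k + 3)))"
      by (rule summable_comparison_test'[OF sm]) (use b in simp)
    then show ?thesis
      by (intro order_trans[OF summable_norm suminf_le] b sm)
  qed
  also have "\<dots> = M * norm h * (norm x)\<^sup>2 * exp (norm x)"
    by (subst suminf_mult[OF summable_exp_generic]) (simp add: exp_def)
  finally show ?thesis by (simp add: M_def)
qed

lemmas matrix_mult_vector_derivative =
  bounded_bilinear.has_vector_derivative[OF matrix_bilinear]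

text \<open>As \<open>c\<close> vanishes at t0, the remainder of the expansion is quadratic in
  \<open>c\<close> and has derivative 0 there; the second derivative of the exponential map is never
  formed.\<close>

lemma dexp_curve:
  fixes c h :: "real \<Rightarrow> 'f::star_scalar^'n^'n"
  assumes c: "(c has_vector_derivative c') (at t0)" "c t0 = 0"
    and h: "(h has_vector_derivative h') (at t0)"
  shows "((\<lambda>t. dexp (c t) (h t)) has_vector_derivative
    h' + (1/2) *\<^sub>R (c' ** h t0 + h t0 ** c')) (at t0)"
proof -
  define r where "r t = dexp (c t) (h t) - (h t + (1/2) *\<^sub>R (c t ** h t + h t ** c t))" for t
  define b where "b t = norm (mat 1 :: 'f^'n^'n) * norm (h t) * exp (norm (c t))" for t
  \<comment> \<open>A differentiable majorant of the remainder: \<open>b\<close> stays below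
    \<open>b t0 + 1\<close> near t0, and \<open>inner (c t) (c t)\<close> has derivative 0 at
    t0.\<close>
  define q where "q t = (b t0 + 1) * inner (c t) (c t)" for t
  have r0: "r t0 = 0" using dexp_second_order[of "c t0" "h t0"] by (simp add: r_def c)
  have "continuous (at t0) c" "continuous (at t0) h"
    using c h by (auto dest: has_vector_derivative_continuous)
  then have "(b \<longlongrightarrow> b t0) (at t0)"
    unfolding b_def continuous_at by (intro tendsto_intros)
  then have "\<forall>\<^sub>F t in at t0. b t < b t0 + 1"
    by (rule order_tendstoD) simp
  moreover have "norm (r t) \<le> b t * (norm (c t))\<^sup>2" for t
    using dexp_second_order[of "c t" "h t"] by (simp add: r_def b_def mult_ac)
  ultimately have le: "\<forall>\<^sub>F t in at t0. norm (r t) \<le> q t"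
  proof (elim eventually_mono)
    fix t assume "b t < b t0 + 1"
    then have "b t * (norm (c t))\<^sup>2 \<le> q t"
      unfolding q_def power2_norm_eq_inner by (intro mult_right_mono) auto
    then show "norm (r t) \<le> q t"
      using \<open>\<And>t. norm (r t) \<le> b t * (norm (c t))\<^sup>2\<close>[of t] by linarith
  qed
  have "(q has_vector_derivative (b t0 + 1) *\<^sub>R (inner (c t0) c' + inner c' (c t0))) (at t0)"
    unfolding q_def real_scaleR_def[symmetric]
    by (rule bounded_linear.has_vector_derivative[OF bounded_linear_scaleR_right
      bounded_bilinear.has_vector_derivative[OF bounded_bilinear_inner c(1) c(1)]])
  then have lim: "((\<lambda>t. norm (q t) / norm (t - t0)) \<longlongrightarrow> 0) (at t0)"
    by (simp add: c q_def has_vector_derivative_def has_derivative_iff_norm)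
  have "((\<lambda>t. norm (r t) / norm (t - t0)) \<longlongrightarrow> 0) (at t0)"
  proof (rule tendsto_sandwich[OF _ _ tendsto_const lim])
    show "\<forall>\<^sub>F t in at t0. 0 \<le> norm (r t) / norm (t - t0)"
      by (rule always_eventually) simp
    show "\<forall>\<^sub>F t in at t0. norm (r t) / norm (t - t0) \<le> norm (q t) / norm (t - t0)"
      using le by (rule eventually_mono) (simp add: divide_right_mono)
  qed
  then have "(r has_vector_derivative 0) (at t0)"
    by (simp add: has_vector_derivative_def has_derivative_iff_norm r0)
  then have "((\<lambda>t. r t + (h t + (1/2) *\<^sub>R (c t ** h t + h t ** c t))) has_vector_derivative
      0 + (h' + (1/2) *\<^sub>R ((c t0 ** h' + c' ** h t0) + (h t0 ** c' + h' ** c t0)))) (at t0)"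
    by (rule has_vector_derivative_add[OF _ has_vector_derivative_add[OF h
      bounded_linear.has_vector_derivative[OF bounded_linear_scaleR_right has_vector_derivative_add[OF
        matrix_mult_vector_derivative[OF c(1) h] matrix_mult_vector_derivative[OF h c(1)]]]]])
  then show ?thesis by (simp add: r_def c)
qed

lemma bounded_linear_dexp: "bounded_linear (dexp x)"
  using mexp_has_derivative by (rule has_derivative_bounded_linear)

lemma mexp_has_vector_derivative:
  assumes "(c has_vector_derivative c') (at t)"
  shows "((\<lambda>t. mexp (c t)) has_vector_derivative dexp (c t) c') (at t)"
proof -
  have "((\<lambda>t. mexp (c t)) has_derivative (\<lambda>s. dexp (c t) (s *\<^sub>R c'))) (at t)"
    using has_derivative_compose[OF assms[unfolded has_vector_derivative_def] mexp_has_derivative] .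
  then show ?thesis
    by (simp add: has_vector_derivative_def linear_simps(5)[OF bounded_linear_dexp])
qed

section \<open>One-parameter groups, conjugation and adjoints\<close>

lemma linear_matrix_mult_left: "linear (\<lambda>X :: 'f::star_scalar^'n^'n. A ** X)"
  and linear_matrix_mult_right: "linear (\<lambda>X :: 'f::star_scalar^'n^'n. X ** A)"
  and linear_matrix_mult_both: "linear (\<lambda>X :: 'f::star_scalar^'n^'n. A ** X ** B)"
  by (rule linearI; simp)+

lemma linear_suminf_mexp:
  fixes L :: "'f::star_scalar^'n^'n \<Rightarrow> 'b::real_normed_vector"
  assumes "linear L"
  shows "L (mexp X) = (\<Sum>k. (1 / fact k) *\<^sub>R L (mpow X k))"
proof -
  have "bounded_linear L" using assms by (simp add: linear_conv_bounded_linear)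
  from bounded_linear.suminf[OF this summable_mexp[of X]] show ?thesis
    by (simp add: mexp_mpow linear_scale[OF assms])
qed

lemma mexp_linear_zero:
  fixes L :: "'f::star_scalar^'n^'n \<Rightarrow> 'b::real_normed_vector"
  assumes "linear L" "\<And>k. L (mpow X k) = 0"
  shows "L (mexp X) = 0"
  using assms by (simp add: linear_suminf_mexp)

lemma dexp_0 [simp]: "dexp 0 h = h"
  using dexp_second_order[of 0 h] by simp

lemma mexp_0 [simp]: "mexp (0 :: 'f::star_scalar^'n^'n) = mat 1"
proof -
  have "mpow (0 :: 'f^'n^'n) k = (if k = 0 then mat 1 else 0)" for k
    by (cases k) (simp_all add: mpow_Suc)
  then have "(\<lambda>k. (1 / fact k) *\<^sub>R mpow (0 :: 'f^'n^'n) k) = (\<lambda>k. if k = 0 then mat 1 else 0)"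
    by auto
  then show ?thesis
    unfolding mexp_mpow using sums_single[of 0 "\<lambda>_. mat 1 :: 'f^'n^'n"] by (simp add: sums_iff)
qed

lemma mpow_commute: "X ** A = A ** X \<Longrightarrow> mpow X k ** A = A ** mpow X k"
  by (induction k) (simp_all add: mpow_Suc matrix_mul_assoc, metis matrix_mul_assoc)

lemma mexp_mult_linear:
  "(A :: 'f::star_scalar^'n^'n) ** mexp X = (\<Sum>k. (1 / fact k) *\<^sub>R (A ** mpow X k))"
  by (rule linear_suminf_mexp[OF linear_matrix_mult_left])

lemma mexp_commute:
  assumes "X ** A = A ** X" shows "mexp X ** A = A ** mexp X"
proof -
  have "mexp X ** A = (\<Sum>k. (1 / fact k) *\<^sub>R (mpow X k ** A))"
    by (rule linear_suminf_mexp[OF linear_matrix_mult_right])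
  then show ?thesis by (simp add: mexp_mult_linear mpow_commute[OF assms])
qed

text \<open>When \<open>x\<close> and \<open>h\<close> commute, all k summands of
  \<open>dpow x k h\<close> coincide, and the factor k lowers the factorial.\<close>

lemma dexp_commuting:
  assumes "x ** h = h ** x" shows "dexp x h = h ** mexp x"
proof -
  have d: "dpow x (Suc k) h = real (Suc k) *\<^sub>R (h ** mpow x k)" for k
  proof (induction k)
    case (Suc k)
    have "x ** (h ** mpow x k) = h ** mpow x (Suc k)"
      by (simp add: mpow_Suc matrix_mul_assoc assms)
    then show ?case
      by (subst dpow.simps, subst Suc) (simp add: scaleR_add_left scaleR_2)
  qed simp
  have "dexp x h = (\<Sum>k. (1 / fact (Suc k)) *\<^sub>R dpow x (Suc k) h)"
    unfolding dexp_def by (subst suminf_split_head[OF summable_dexp]) simp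
  also have "\<dots> = (\<Sum>k. (1 / fact k) *\<^sub>R (h ** mpow x k))"
    unfolding d by simp
  finally show ?thesis by (simp add: mexp_mult_linear)
qed

lemma mexp_line_derivative:
  "((\<lambda>t. mexp (t *\<^sub>R X)) has_vector_derivative X ** mexp (t *\<^sub>R X)) (at t)"
proof -
  have "((\<lambda>t. t *\<^sub>R X) has_vector_derivative X) (at t)"
    by (auto intro!: derivative_eq_intros simp: has_vector_derivative_def)
  from mexp_has_vector_derivative[OF this] show ?thesis
    by (simp add: dexp_commuting)
qed

text \<open>In place of a Cauchy product of series: exp(-sX) exp((s+t)X) has derivative 0 in s,
  hence keeps its value at s = 0.\<close>

lemma mexp_add_line: "mexp ((s + t) *\<^sub>R X) = mexp (s *\<^sub>R X) ** mexp (t *\<^sub>R X)"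
proof -
  have neg: "((\<lambda>s. mexp (- s *\<^sub>R X)) has_vector_derivative - (mexp (- s *\<^sub>R X) ** X)) (at s)" for s
  proof -
    have "((\<lambda>s. - s *\<^sub>R X) has_vector_derivative - X) (at s)"
      by (auto intro!: derivative_eq_intros simp: has_vector_derivative_def)
    from mexp_has_vector_derivative[OF this] show ?thesis
      by (simp add: dexp_commuting mexp_commute)
  qed
  have pos: "((\<lambda>s. mexp ((s + t) *\<^sub>R X)) has_vector_derivative X ** mexp ((s + t) *\<^sub>R X)) (at s)" for s t
  proof -
    have "((\<lambda>s. (s + t) *\<^sub>R X) has_vector_derivative X) (at s)"
      by (auto intro!: derivative_eq_intros simp: has_vector_derivative_def)
    from mexp_has_vector_derivative[OF this] show ?thesis
      by (simp add: dexp_commuting)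
  qed
  have const: "mexp (- s *\<^sub>R X) ** mexp ((s + t) *\<^sub>R X) = mexp (t *\<^sub>R X)" for s t
  proof -
    let ?f = "\<lambda>s. mexp (- s *\<^sub>R X) ** mexp ((s + t) *\<^sub>R X)"
    have "(?f has_vector_derivative 0) (at s within UNIV)" for s
      using matrix_mult_vector_derivative[OF neg[of s] pos[of t s]] by (simp add: matrix_mul_assoc)
    then obtain k where "\<And>s. ?f s = k"
      using has_vector_derivative_zero_constant[of UNIV ?f] by auto
    from this[of s] this[of 0] show ?thesis by simp
  qed
  have "mexp (s *\<^sub>R X) ** mexp (t *\<^sub>R X) = mexp (s *\<^sub>R X) ** mexp (- s *\<^sub>R X) ** mexp ((s + t) *\<^sub>R X)"
    by (simp only: const[symmetric, of t s] matrix_mul_assoc)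
  moreover have "mexp (s *\<^sub>R X) ** mexp (- s *\<^sub>R X) = mat 1"
    using const[of "- s" 0] by simp
  ultimately show ?thesis by simp
qed

lemma mexp_neg_mult: "mexp (- X) ** mexp X = mat 1"
  using mexp_add_line[of "-1" 1 X] by simp

lemma mexp_mult_neg: "mexp X ** mexp (- X) = mat 1"
  using mexp_add_line[of 1 "-1" X] by simp

lemma mpow_conj: "B ** A = mat 1 \<Longrightarrow> A ** B = mat 1 \<Longrightarrow> mpow (A ** X ** B) k = A ** mpow X k ** B"
proof (induction k)
  case (Suc k)
  then have "mpow (A ** X ** B) (Suc k) = A ** X ** (B ** A) ** mpow X k ** B"
    unfolding mpow_Suc matrix_mul_assoc by (simp only: matrix_mul_assoc)
  then show ?case using Suc.prems(1) by (simp add: mpow_Suc matrix_mul_assoc)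
qed simp

lemma mexp_conj:
  fixes A B X :: "'f::star_scalar^'n^'n"
  assumes "B ** A = mat 1" "A ** B = mat 1"
  shows "mexp (A ** X ** B) = A ** mexp X ** B"
proof -
  have "A ** mexp X ** B = (\<Sum>k. (1 / fact k) *\<^sub>R (A ** mpow X k ** B))"
    by (rule linear_suminf_mexp[OF linear_matrix_mult_both])
  then show ?thesis by (simp add: mexp_mpow mpow_conj[OF assms])
qed

lemma mexp_mstar: "mexp (mstar X) = mstar (mexp X)"
proof -
  have "mpow (mstar X) k = mstar (mpow X k)" for k
    by (induction k) (simp, simp add: mpow_Suc[of "mstar X"] mpow_Suc2[of X] mstar_mult)
  then show ?thesis
    using linear_suminf_mexp[OF linear_mstar, of X] by (simp add: mexp_mpow)
qed

section \<open>Matrix groups\<close>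

text \<open>\<open>curve_derivative_in\<close> takes the place of the closed subgroup theorem:
  \<open>lie_algebra\<close> is defined by one-parameter groups, and closure under addition is
  obtained by differentiating a product curve. For the concrete groups it follows by differentiating
  their defining equations. Inverses are given by adjoints.\<close>

locale matrix_group =
  fixes G :: "('f::star_scalar^'n^'n) set"
  assumes mat_1_in: "mat 1 \<in> G"
    and mult_in: "A \<in> G \<Longrightarrow> B \<in> G \<Longrightarrow> A ** B \<in> G"
    and mstar_in: "A \<in> G \<Longrightarrow> mstar A \<in> G"
    and mstar_mult_self: "A \<in> G \<Longrightarrow> mstar A ** A = mat 1"
    and curve_derivative_in: "(\<And>t. \<gamma> t \<in> G) \<Longrightarrow> \<gamma> 0 = mat 1 \<Longrightarrow>
      (\<gamma> has_vector_derivative D) (at 0) \<Longrightarrow> D \<in> lie_algebra G"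
begin

lemma mult_mstar_self: "A \<in> G \<Longrightarrow> A ** mstar A = mat 1"
  using mstar_mult_self[OF mstar_in] by simp

lemma mexp_in: "X \<in> lie_algebra G \<Longrightarrow> mexp X \<in> G"
  by (drule lie_algebra_def[THEN equalityD1, THEN subsetD], drule CollectD, drule spec[of _ 1]) simp

lemma lie_scaleR: "X \<in> lie_algebra G \<Longrightarrow> r *\<^sub>R X \<in> lie_algebra G"
  by (simp add: lie_algebra_def)

lemma lie_0: "0 \<in> lie_algebra G"
  by (simp add: lie_algebra_def mat_1_in)

lemma lie_minus: "X \<in> lie_algebra G \<Longrightarrow> - X \<in> lie_algebra G"
  using lie_scaleR[of X "-1"] by simp

lemma lie_add:
  assumes "X \<in> lie_algebra G" "Y \<in> lie_algebra G" shows "X + Y \<in> lie_algebra G"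
proof (rule curve_derivative_in[of "\<lambda>t. mexp (t *\<^sub>R Y) ** mexp (t *\<^sub>R X)"])
  show "mexp (t *\<^sub>R Y) ** mexp (t *\<^sub>R X) \<in> G" for t
    using assms by (intro mult_in mexp_in lie_scaleR)
  show "((\<lambda>t. mexp (t *\<^sub>R Y) ** mexp (t *\<^sub>R X)) has_vector_derivative X + Y) (at 0)"
    using matrix_mult_vector_derivative[OF mexp_line_derivative[of Y 0] mexp_line_derivative[of X 0]]
    by simp
qed simp

lemma lie_diff: "X \<in> lie_algebra G \<Longrightarrow> Y \<in> lie_algebra G \<Longrightarrow> X - Y \<in> lie_algebra G"
  using lie_add[OF _ lie_minus] by simp

lemma lie_skew:
  assumes "X \<in> lie_algebra G" shows "mstar X = - X"
proof -
  let ?f = "\<lambda>t. mstar (mexp (t *\<^sub>R X)) ** mexp (t *\<^sub>R X)"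
  have "((\<lambda>t. mstar (mexp (t *\<^sub>R X))) has_vector_derivative mstar X) (at 0)"
    using bounded_linear.has_vector_derivative[OF _ mexp_line_derivative[of X 0]]
      linear_mstar linear_conv_bounded_linear by fastforce
  from matrix_mult_vector_derivative[OF this mexp_line_derivative[of X 0]]
  have "(?f has_vector_derivative X + mstar X) (at 0)" by simp
  moreover have "?f = (\<lambda>_. mat 1)"
    using assms by (intro ext mstar_mult_self mexp_in lie_scaleR)
  ultimately have "X + mstar X = 0"
    by (metis has_vector_derivative_const vector_derivative_at)
  then show ?thesis by (simp add: add_eq_0_iff)
qed

lemma lie_conj:
  assumes "A \<in> G" "X \<in> lie_algebra G" shows "A ** X ** mstar A \<in> lie_algebra G"
  unfolding lie_algebra_def
proof (intro CollectI allI)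
  fix t
  have "mexp (A ** (t *\<^sub>R X) ** mstar A) = A ** mexp (t *\<^sub>R X) ** mstar A"
    using assms by (intro mexp_conj mstar_mult_self mult_mstar_self)
  also have "\<dots> \<in> G"
    using assms by (intro mult_in mstar_in mexp_in lie_scaleR)
  finally show "mexp (t *\<^sub>R (A ** X ** mstar A)) \<in> G" by simp
qed

text \<open>This is the left logarithmic derivative of exp at \<open>x\<close>. An invariant metric
  constrains only vectors \<open>a ** X\<close> with \<open>X\<close> in the Lie algebra, so this
  membership is what lets it be evaluated in a chart.\<close>

lemma mexp_logarithmic_derivative_in:
  assumes "x \<in> lie_algebra G" "u \<in> lie_algebra G"
  shows "mexp (- x) ** dexp x u \<in> lie_algebra G"
proof (rule curve_derivative_in[of "\<lambda>s. mexp (- x) ** mexp (x + s *\<^sub>R u)"])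
  show "mexp (- x) ** mexp (x + s *\<^sub>R u) \<in> G" for s
    using assms by (intro mult_in mexp_in lie_scaleR lie_add lie_minus)
  have "((\<lambda>s. x + s *\<^sub>R u) has_vector_derivative u) (at 0)"
    by (auto intro!: derivative_eq_intros simp: has_vector_derivative_def)
  from matrix_mult_vector_derivative[OF has_vector_derivative_const mexp_has_vector_derivative[OF this]]
  show "((\<lambda>s. mexp (- x) ** mexp (x + s *\<^sub>R u)) has_vector_derivative mexp (- x) ** dexp x u) (at 0)"
    by simp
qed (simp add: mexp_neg_mult)

end

section \<open>Invariant metrics and geodesic vectors\<close>

context matrix_group
begin

lemma tangent_add_lie_subset:
  assumes "W \<in> lie_algebra G"
  shows "tangent G a (v + a ** W) \<subseteq> tangent G a v"
proof
  fix z assume "z \<in> tangent G a (v + a ** W)"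
  then obtain k w where z: "z = (a ** k, (v + a ** W + a ** w) ** k)" "k \<in> G" "w \<in> lie_algebra G"
    unfolding tangent_def by blast
  have "z = (a ** k, (v + a ** (W + w)) ** k)" by (simp add: z)
  with z show "z \<in> tangent G a v"
    unfolding tangent_def using lie_add[OF assms] by blast
qed

lemma tangent_add_lie:
  assumes "W \<in> lie_algebra G"
  shows "tangent G a (v + a ** W) = tangent G a v"
  using tangent_add_lie_subset[OF assms, of a v]
    tangent_add_lie_subset[OF lie_minus[OF assms], of a "v + a ** W"] by simp

lemma tangent_right_subset:
  assumes "k0 \<in> G"
  shows "tangent G (a ** k0) (v ** k0) \<subseteq> tangent G a v"
proof
  fix z assume "z \<in> tangent G (a ** k0) (v ** k0)"
  then obtain k w where z: "z = (a ** k0 ** k, (v ** k0 + a ** k0 ** w) ** k)" "k \<in> G" "w \<in> lie_algebra G"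
    unfolding tangent_def by blast
  have "a ** (k0 ** w ** mstar k0) ** (k0 ** k) = a ** k0 ** w ** (mstar k0 ** k0) ** k"
    by (simp only: matrix_mul_assoc)
  then have "z = (a ** (k0 ** k), (v + a ** (k0 ** w ** mstar k0)) ** (k0 ** k))"
    by (simp add: z(1) mstar_mult_self[OF assms]) (simp add: matrix_mul_assoc)
  then show "z \<in> tangent G a v"
    unfolding tangent_def using mult_in[OF assms z(2)] lie_conj[OF assms z(3)] by blast
qed

lemma tangent_right:
  assumes "k \<in> G" shows "tangent G (a ** k) (v ** k) = tangent G a v"
proof
  have "tangent G (a ** k ** mstar k) (v ** k ** mstar k) \<subseteq> tangent G (a ** k) (v ** k)"
    by (rule tangent_right_subset[OF mstar_in[OF assms]])
  then show "tangent G a v \<subseteq> tangent G (a ** k) (v ** k)"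
    by (simp add: matrix_mul_assoc[symmetric] mult_mstar_self[OF assms])
qed (rule tangent_right_subset[OF assms])

text \<open>Right translation by \<open>k\<close> does not change a tangent vector of the quotient,
  so Ad(k) at the base point is left translation by \<open>k\<close>. Left invariance thereby
  becomes Ad-invariance of \<open>base_form\<close>.\<close>

lemma tangent_conj:
  assumes "k \<in> G" shows "tangent G (mat 1) (k ** X ** mstar k) = tangent G k (k ** X)"
proof -
  have "k ** X ** mstar k ** k = k ** X"
    by (simp add: matrix_mul_assoc[symmetric] mstar_mult_self[OF assms])
  then show ?thesis
    using tangent_right[OF assms, of "mat 1" "k ** X ** mstar k"] by simp
qed

end

definition base_form ::
    "('f::star_scalar^'n^'n) set \<Rightarrow> ('f, 'n) metric_tensor \<Rightarrow> 'f^'n^'n \<Rightarrow> 'f^'n^'n \<Rightarrow> real" where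
  "base_form K g U V = g (tangent K (mat 1) U) (tangent K (mat 1) V)"

lemma commutator_conj:
  assumes "mstar A ** A = mat 1"
  shows "A ** commutator X Y ** mstar A = commutator (A ** X ** mstar A) (A ** Y ** mstar A)"
proof -
  have "A ** X ** mstar A ** (A ** Y ** mstar A) = A ** X ** (mstar A ** A) ** Y ** mstar A" for X Y
    by (simp only: matrix_mul_assoc)
  then show ?thesis
    by (simp add: commutator_def assms) (simp add: matrix_mul_assoc)
qed

text \<open>\<open>P\<close> is the projection to the complement, extended to all matrices. Being
  total it can be applied along any curve and differentiated, and by \<open>P_group\<close> it sends
  a curve inside \<open>K\<close> to 0 although such a curve does not run in the Lie
  algebra.\<close>

locale reductive_pair = G: matrix_group G + K: matrix_group K
  for G K :: "('f::star_scalar^'n^'n) set" +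
  fixes P :: "'f^'n^'n \<Rightarrow> 'f^'n^'n"
  assumes subgroup: "K \<subseteq> G"
    and linear_P: "linear P"
    and P_group: "k \<in> K \<Longrightarrow> P k = 0"
    and P_in: "P X \<in> lie_algebra G"
    and P_idem: "P (P X) = P X"
    and diff_P_in: "X \<in> lie_algebra G \<Longrightarrow> X - P X \<in> lie_algebra K"
    and complement_eq: "complement G K = range P"
    and P_conj: "k \<in> K \<Longrightarrow> P (k ** X ** mstar k) = k ** P X ** mstar k"
begin

lemma bounded_linear_P: "bounded_linear P"
  using linear_P by (simp add: linear_conv_bounded_linear)

lemma complement_iff: "X \<in> complement G K \<longleftrightarrow> P X = X"
  unfolding complement_eq using P_idem by (metis rangeE rangeI)

lemma complement_in: "P X = X \<Longrightarrow> X \<in> lie_algebra G"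
  using P_in by metis

lemma tangent_P: "X \<in> lie_algebra G \<Longrightarrow> tangent K (mat 1) (P X) = tangent K (mat 1) X"
  using K.tangent_add_lie[OF diff_P_in, of X "mat 1" "P X"] by simp

section \<open>A fixed invariant metric: chart expressions and the geodesic criterion\<close>

context
  fixes g :: "('f, 'n) metric_tensor"
  assumes metric: "invariant_metric G K g"
begin

abbreviation "B \<equiv> base_form K g"

lemma base_form_axioms:
  assumes "X \<in> lie_algebra G" "Y \<in> lie_algebra G"
  shows "B X Y = B Y X" "Z \<in> lie_algebra G \<Longrightarrow> B (X + Y) Z = B X Z + B Y Z"
    "B (r *\<^sub>R X) Y = r * B X Y" "X \<notin> lie_algebra K \<Longrightarrow> 0 < B X X"
    "b \<in> G \<Longrightarrow> g (tangent K b (b ** X)) (tangent K b (b ** Y)) = B X Y"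
  using metric[unfolded invariant_metric_def, THEN bspec, OF G.mat_1_in, THEN bspec, OF assms(1), THEN bspec, OF assms(2)]
  unfolding base_form_def by simp_all

lemma base_form_P: "X \<in> lie_algebra G \<Longrightarrow> Y \<in> lie_algebra G \<Longrightarrow> B (P X) (P Y) = B X Y"
  by (simp add: base_form_def tangent_P)

lemma base_form_conj:
  assumes "k \<in> K" "X \<in> lie_algebra G" "Y \<in> lie_algebra G"
  shows "B (k ** X ** mstar k) (k ** Y ** mstar k) = B X Y"
  using base_form_axioms(5)[OF assms(2,3), of k] subgroup assms(1)
  by (auto simp: base_form_def K.tangent_conj)

text \<open>The metric is controlled only on the Lie algebra; precomposing with the total map
  \<open>P\<close> gives a bilinear form on all matrices, to which the product rule applies.\<close>

lemma bounded_bilinear_form: "bounded_bilinear (\<lambda>U V. B (P U) (P V))"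
proof -
  have l: "linear (\<lambda>U. B (P U) (P V))" for V
    by (rule linearI) (simp_all add: linear_add[OF linear_P] linear_scale[OF linear_P] base_form_axioms P_in)
  have "B (P U) (P V) = B (P V) (P U)" for U V
    by (simp add: base_form_axioms P_in)
  then have "bilinear (\<lambda>U V. B (P U) (P V))"
    unfolding bilinear_def using l by simp
  then show ?thesis by (simp add: bilinear_conv_bounded_bilinear)
qed

lemmas form_derivative = bounded_bilinear.has_vector_derivative[OF bounded_bilinear_form]

lemma base_form_zero: "Y \<in> lie_algebra G \<Longrightarrow> B 0 Y = 0"
  using base_form_axioms(3)[of 0 Y 0] G.lie_0 by simp

text \<open>Left invariance carries a chart vector from \<open>a ** mexp x\<close> back to the
  identity, where it becomes its logarithmic derivative; \<open>P\<close> then discards only the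
  part tangent to \<open>K\<close>.\<close>

lemma chart_metric_eq:
  assumes "a \<in> G" "x \<in> lie_algebra G" "u \<in> lie_algebra G" "v \<in> lie_algebra G"
  shows "chart_metric K g a x u v = B (P (mexp (- x) ** dexp x u)) (P (mexp (- x) ** dexp x v))"
proof -
  have "((\<lambda>y. a ** mexp y) has_derivative (\<lambda>h. a ** dexp x h)) (at x)"
    by (rule bounded_linear.has_derivative[OF bounded_bilinear.bounded_linear_right[OF matrix_bilinear]
      mexp_has_derivative])
  then have "frechet_derivative (\<lambda>y. a ** mexp y) (at x) = (\<lambda>h. a ** dexp x h)"
    by (rule frechet_derivative_at[symmetric])
  moreover have "a ** dexp x h = a ** mexp x ** (mexp (- x) ** dexp x h)" for h
  proof -
    have "a ** mexp x ** (mexp (- x) ** dexp x h) = a ** (mexp x ** mexp (- x)) ** dexp x h"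
      by (simp only: matrix_mul_assoc)
    then show ?thesis by (simp add: mexp_mult_neg)
  qed
  ultimately have "chart_metric K g a x u v = B (mexp (- x) ** dexp x u) (mexp (- x) ** dexp x v)"
    unfolding chart_metric_def
    using assms by (simp add: base_form_axioms G.mexp_logarithmic_derivative_in G.mult_in G.mexp_in)
  then show ?thesis
    using assms by (simp add: base_form_P G.mexp_logarithmic_derivative_in)
qed

text \<open>The factor exp(-tu) contributes -uv and the expansion of \<open>dexp\<close> contributes
  (uv + vu)/2; together they are -[u, v]/2.\<close>

lemma logarithmic_derivative_line:
  "((\<lambda>t. mexp (- (t *\<^sub>R u)) ** dexp (t *\<^sub>R u) v) has_vector_derivative (- 1/2) *\<^sub>R commutator u v) (at 0)"
proof -
  have c: "((\<lambda>t. t *\<^sub>R u) has_vector_derivative u) (at 0)" "((\<lambda>t. - (t *\<^sub>R u)) has_vector_derivative - u) (at 0)"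
    by (auto intro!: derivative_eq_intros simp: has_vector_derivative_def)
  have "((\<lambda>t. mexp (- (t *\<^sub>R u))) has_vector_derivative - u) (at 0)"
    using mexp_has_vector_derivative[OF c(2)] by simp
  from matrix_mult_vector_derivative[OF this dexp_curve[OF c(1) _ has_vector_derivative_const, of v]]
  have "((\<lambda>t. mexp (- (t *\<^sub>R u)) ** dexp (t *\<^sub>R u) v) has_vector_derivative
      (1/2) *\<^sub>R (u ** v + v ** u) + - (u ** v)) (at 0)"
    by simp
  moreover have "(1/2) *\<^sub>R (u ** v + v ** u) + - (u ** v) = (- 1/2) *\<^sub>R commutator u v"
  proof -
    have "(1/2) *\<^sub>R (u ** v) - u ** v = - ((1/2) *\<^sub>R (u ** v))"
      using scaleR_left_diff_distrib[of "1/2" 1 "u ** v"] by simp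
    then show ?thesis
      unfolding commutator_def by (simp add: scaleR_add_right scaleR_diff_right)
  qed
  ultimately show ?thesis by simp
qed

lemma chart_metric_line_derivative:
  assumes "a \<in> G" "x \<in> lie_algebra G" "u \<in> lie_algebra G" "v \<in> lie_algebra G"
  shows "vector_derivative (\<lambda>t. chart_metric K g a (t *\<^sub>R x) u v) (at 0) =
    - 1/2 * (B (P u) (P (commutator x v)) + B (P (commutator x u)) (P v))"
proof -
  interpret f: bounded_bilinear "\<lambda>U V. B (P U) (P V)" by (rule bounded_bilinear_form)
  have "((\<lambda>t. B (P (mexp (- (t *\<^sub>R x)) ** dexp (t *\<^sub>R x) u)) (P (mexp (- (t *\<^sub>R x)) ** dexp (t *\<^sub>R x) v)))
      has_vector_derivative
      B (P u) (P ((- 1/2) *\<^sub>R commutator x v)) + B (P ((- 1/2) *\<^sub>R commutator x u)) (P v)) (at 0)"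
    using form_derivative[OF logarithmic_derivative_line[of x u] logarithmic_derivative_line[of x v]] by simp
  then show ?thesis
    using assms by (simp add: vector_derivative_at chart_metric_eq G.lie_scaleR f.scaleR_left f.scaleR_right
      distrib_left del: divide_minus_left minus_divide_left)
qed

lemma commutator_self [simp]: "commutator X X = 0"
  by (simp add: commutator_def)

lemma commutator_swap: "commutator Y X = - commutator X Y"
  by (simp add: commutator_def)

text \<open>Because [X, X] = 0, each of the two derivatives along \<open>X\<close> is -1/2 times
  \<open>B X (P (commutator X w))\<close>. The derivative along \<open>w\<close> is +1 times it and
  enters with a minus sign; half of -2 is the coefficient.\<close>

lemma christoffel_eq:
  assumes "a \<in> G" "P X = X" "P w = w"
  shows "christoffel K g a 0 X X w = - B X (P (commutator X w))"
proof -
  interpret f: bounded_bilinear "\<lambda>U V. B (P U) (P V)" by (rule bounded_bilinear_form)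
  have in_G: "X \<in> lie_algebra G" "w \<in> lie_algebra G"
    using assms complement_in by auto
  have sym: "B (P (commutator X w)) X = B X (P (commutator X w))"
    using in_G by (simp add: base_form_axioms P_in)
  have "B X (P (commutator w X)) = - B X (P (commutator X w))"
    using f.minus_right[of X "commutator X w"] assms by (simp add: commutator_swap[of w X])
  moreover have "B (P (commutator w X)) X = - B X (P (commutator X w))"
    using f.minus_left[of "commutator X w" X] assms by (simp add: commutator_swap[of w X] sym)
  moreover have "P 0 = 0" using linear_P by (rule linear_0)
  ultimately show ?thesis
    unfolding christoffel_def
    using in_G assms by (simp add: chart_metric_line_derivative base_form_zero)
qed

lemma base_form_conj_P:
  assumes "k \<in> K" "X \<in> lie_algebra G"
  shows "B (k ** X ** mstar k) (P (commutator (k ** X ** mstar k) (k ** w ** mstar k))) = B X (P (commutator X w))"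
proof -
  have "P (commutator (k ** X ** mstar k) (k ** w ** mstar k)) = k ** P (commutator X w) ** mstar k"
    using assms by (simp add: commutator_conj[symmetric] P_conj K.mstar_mult_self)
  then show ?thesis using assms by (simp add: base_form_conj P_in)
qed

lemma chart_metric_zero:
  assumes "a \<in> G" "w \<in> lie_algebra G" shows "chart_metric K g a 0 0 w = 0"
  using assms by (simp add: chart_metric_eq G.lie_0 linear_0[OF linear_P] base_form_zero P_in)

lemma geodesic_vectorI:
  assumes X: "P X = X" and crit: "\<And>w. P w = w \<Longrightarrow> B X (P (commutator X w)) = 0"
  shows "geodesic_vector G K g X"
  unfolding geodesic_vector_def geodesic_def
proof
  fix t0
  \<comment> \<open>A straight coordinate line has \<open>c'' = 0\<close>, which leaves the
    Christoffel term alone in the geodesic equation.\<close>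
  let ?a = "mexp (t0 *\<^sub>R X)" and ?c = "\<lambda>t. (t - t0) *\<^sub>R X"
  have a: "?a \<in> G" using complement_in[OF X] by (intro G.mexp_in G.lie_scaleR)
  have c: "(?c has_vector_derivative X) (at t)" for t
    by (auto intro!: derivative_eq_intros simp: has_vector_derivative_def)
  have PX: "P (t *\<^sub>R X) = t *\<^sub>R X" for t
    by (simp add: linear_scale[OF linear_P] X)
  have "?a ** mexp (?c t) = mexp (t *\<^sub>R X)" for t
    using mexp_add_line[of t0 "t - t0" X] by simp
  then have ev: "\<forall>\<^sub>F t in nhds t0. ?c t \<in> complement G K \<and>
      coset K (mexp (t *\<^sub>R X)) = coset K (?a ** mexp (?c t)) \<and> (?c has_vector_derivative X) (at t)"
    by (intro always_eventually allI conjI c) (simp_all add: complement_iff PX)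
  show "\<exists>a\<in>G. \<exists>c c' c''. c t0 = 0 \<and>
      (\<forall>\<^sub>F t in nhds t0. c t \<in> complement G K \<and> coset K (mexp (t *\<^sub>R X)) = coset K (a ** mexp (c t)) \<and>
         (c has_vector_derivative c' t) (at t)) \<and>
      (c' has_vector_derivative c'') (at t0) \<and>
      (\<forall>w\<in>complement G K.
         chart_metric K g a 0 c'' w + christoffel K g a 0 (c' t0) (c' t0) w = 0)"
  proof (rule bexI[OF _ a], rule exI[of _ ?c], rule exI[of _ "\<lambda>_. X"], rule exI[of _ 0], intro conjI ev ballI)
    fix w assume "w \<in> complement G K"
    then have w: "P w = w" by (simp add: complement_iff)
    then show "chart_metric K g ?a 0 0 w + christoffel K g ?a 0 X X w = 0"
      by (simp only: chart_metric_zero[OF a complement_in[OF w]] christoffel_eq[OF a X w] crit[OF w] add_0_left neg_0_equal_iff_equal)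
  qed simp_all
qed

lemma P_derivative_zero:
  assumes "\<forall>\<^sub>F t in nhds t0. P (f t) = 0" "(f has_vector_derivative f') (at t0)"
  shows "P f' = 0"
proof -
  have "((\<lambda>t. P (f t)) has_vector_derivative P f') (at t0)"
    by (rule bounded_linear.has_vector_derivative[OF bounded_linear_P assms(2)])
  then have "((\<lambda>t. 0) has_vector_derivative P f') (at t0)"
    using has_vector_derivative_cong_ev[where S = UNIV and x = t0 and f = "\<lambda>t. P (f t)" and g = "\<lambda>_. 0" and f' = "P f'"] assms(1)
      eventually_nhds_x_imp_x[OF assms(1)]
    by (simp add: eventually_mono)
  then show ?thesis
    by (metis has_vector_derivative_const vector_derivative_at)
qed

lemma P_derivative_fixed:
  assumes "\<forall>\<^sub>F t in nhds t0. P (f t) = f t" "(f has_vector_derivative f') (at t0)"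
  shows "P f' = f'"
proof -
  have "((\<lambda>t. P (f t)) has_vector_derivative P f') (at t0)"
    by (rule bounded_linear.has_vector_derivative[OF bounded_linear_P assms(2)])
  then have "(f has_vector_derivative P f') (at t0)"
    using has_vector_derivative_cong_ev[where S = UNIV and x = t0 and f = "\<lambda>t. P (f t)" and g = f and f' = "P f'"] assms(1)
      eventually_nhds_x_imp_x[OF assms(1)]
    by (simp add: eventually_mono)
  then show ?thesis
    using assms(2) by (metis vector_derivative_at)
qed

text \<open>If \<open>exp(c(t))\<close> and \<open>exp(tX)\<close> define the same curve in the quotient, then
  \<open>exp(-tX) exp(c(t))\<close> stays in the subgroup, which is annihilated by \<open>P\<close>. Its first two
  derivatives at \<open>0\<close> are \<open>c' - X\<close> and, once \<open>c' = X\<close>, \<open>c''\<close>.\<close>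

lemma chart_curve_unique:
  assumes X: "P X = X" and c0: "c 0 = 0"
    and ev: "\<forall>\<^sub>F t in nhds (0::real). P (c t) = c t \<and> mexp (- (t *\<^sub>R X)) ** mexp (c t) \<in> K \<and>
      (c has_vector_derivative c' t) (at t)"
    and c'': "(c' has_vector_derivative c'') (at 0)"
  shows "c' 0 = X" "c'' = 0"
proof -
  let ?k = "\<lambda>t. mexp (- (t *\<^sub>R X)) ** mexp (c t)"
  let ?k' = "\<lambda>t. mexp (- (t *\<^sub>R X)) ** dexp (c t) (c' t) + - (mexp (- (t *\<^sub>R X)) ** X) ** mexp (c t)"
  have neg: "((\<lambda>t. mexp (- (t *\<^sub>R X))) has_vector_derivative - (mexp (- (t *\<^sub>R X)) ** X)) (at t)" for t
  proof -
    have "((\<lambda>t. - (t *\<^sub>R X)) has_vector_derivative - X) (at t)"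
      by (auto intro!: derivative_eq_intros simp: has_vector_derivative_def)
    from mexp_has_vector_derivative[OF this] show ?thesis
      by (simp add: dexp_commuting mexp_commute)
  qed
  have "(?k has_vector_derivative ?k' t) (at t)" if "(c has_vector_derivative c' t) (at t)" for t
    by (rule matrix_mult_vector_derivative[OF neg mexp_has_vector_derivative[OF that]])
  then have kd: "\<forall>\<^sub>F t in nhds 0. (?k has_vector_derivative ?k' t) (at t)"
    using ev by (auto elim!: eventually_mono)
  have Pk: "\<forall>\<^sub>F t in nhds 0. P (?k t) = 0"
    using ev by (auto elim!: eventually_mono simp: P_group)
  have cd: "(c has_vector_derivative c' 0) (at 0)" "\<forall>\<^sub>F t in nhds 0. P (c t) = c t"
    using eventually_nhds_x_imp_x[OF ev] ev by (auto elim!: eventually_mono)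
  have Pc': "P (c' 0) = c' 0"
    by (rule P_derivative_fixed[OF cd(2,1)])
  have "P (c' 0 - X) = 0"
    using P_derivative_zero[OF Pk eventually_nhds_x_imp_x[OF kd]] by (simp add: c0)
  then show c'X: "c' 0 = X"
    by (simp add: linear_diff[OF linear_P] Pc' X)
  have "\<forall>\<^sub>F t in nhds 0. P (?k' t) = 0"
  \<comment> \<open>An event near 0 also holds near every nearby time, so the first derivative of
    the curve is annihilated on a whole neighbourhood and may be differentiated again.\<close>
  proof -
    have "\<forall>\<^sub>F s in nhds 0. \<forall>\<^sub>F t in nhds s. P (?k t) = 0"
      using Pk by (simp add: eventually_eventually)
    with kd show ?thesis
      by eventually_elim (rule P_derivative_zero)
  qed
  moreover have "(?k' has_vector_derivative c'') (at 0)"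
  proof -
    note d1 = matrix_mult_vector_derivative[OF neg[of 0] dexp_curve[OF cd(1) c0 c'']]
    have neg': "((\<lambda>t. - (mexp (- (t *\<^sub>R X)) ** X)) has_vector_derivative X ** X) (at 0)"
      using has_vector_derivative_minus[OF matrix_mult_vector_derivative[OF neg[of 0] has_vector_derivative_const[of X]]]
      by simp
    note d2 = matrix_mult_vector_derivative[OF neg' mexp_has_vector_derivative[OF cd(1)]]
    \<comment> \<open>The quadratic terms cancel: (XX + XX)/2 from the expansion of
      \<open>dexp\<close> against -XX from the product rule, and the two terms of \<open>d2\<close>
      against each other. Only \<open>c''\<close> is left.\<close>
    have half: "(1/2) *\<^sub>R (X ** X + X ** X) = X ** X"
      by (simp add: scaleR_2[symmetric])
    from has_vector_derivative_add[OF d1 d2] show ?thesis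
      by (simp add: c0 c'X half)
  qed
  ultimately have "P c'' = 0"
    by (rule P_derivative_zero)
  \<comment> \<open>\<open>c'\<close> is fixed by \<open>P\<close> near 0 because \<open>c\<close>
    is, and \<open>c''\<close> inherits this; fixed and annihilated by \<open>P\<close> at once, it
    is 0.\<close>
  moreover have "P c'' = c''"
  proof (rule P_derivative_fixed[OF _ c''])
    have "\<forall>\<^sub>F s in nhds 0. \<forall>\<^sub>F t in nhds s. P (c t) = c t"
      using cd(2) by (simp add: eventually_eventually)
    with ev show "\<forall>\<^sub>F t in nhds 0. P (c' t) = c' t"
      by eventually_elim (auto intro: P_derivative_fixed)
  qed
  ultimately show "c'' = 0" by simp
qed

text \<open>The definition allows any representative \<open>a\<close> of the point at time 0, and
  such an \<open>a\<close> lies in \<open>K\<close>. Conjugating by \<open>mstar a\<close> moves the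
  chart to the identity and replaces \<open>X\<close> by \<open>X'\<close>; Ad-invariance of the
  form brings the resulting equation back to \<open>X\<close>.\<close>

lemma geodesic_vectorD:
  assumes geo: "geodesic_vector G K g X" and X: "P X = X" and w: "P w = w"
  shows "B X (P (commutator X w)) = 0"
proof -
  from geo[unfolded geodesic_vector_def geodesic_def, THEN spec, of 0]
  obtain a c c' c'' where a: "a \<in> G" and c0: "c 0 = 0"
    and ev: "\<forall>\<^sub>F t in nhds (0::real). c t \<in> complement G K \<and>
      coset K (mexp (t *\<^sub>R X)) = coset K (a ** mexp (c t)) \<and> (c has_vector_derivative c' t) (at t)"
    and c'': "(c' has_vector_derivative c'') (at 0)"
    and eq: "\<And>w. w \<in> complement G K \<Longrightarrow> chart_metric K g a 0 c'' w + christoffel K g a 0 (c' 0) (c' 0) w = 0"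
    by blast
  have self: "b \<in> coset K b" for b
    unfolding coset_def using K.mat_1_in by (auto intro: exI[of _ "mat 1"])
  have "a \<in> coset K (mat 1)"
    using eventually_nhds_x_imp_x[OF ev] self[of a] by (simp add: c0)
  then have aK: "a \<in> K" by (auto simp: coset_def)
  let ?b = "mstar a"
  have b: "?b \<in> K" using aK by (rule K.mstar_in)
  define X' where "X' = ?b ** X ** a"
  have conj_in: "P (?b ** Y ** a) = ?b ** Y ** a" if "P Y = Y" for Y
    using P_conj[OF b, of Y] that by simp
  have X': "P X' = X'" unfolding X'_def by (rule conj_in[OF X])
  have "mexp (- (t *\<^sub>R X')) ** mexp (c t) \<in> K"
    if t: "coset K (mexp (t *\<^sub>R X)) = coset K (a ** mexp (c t))" for t
  proof -
    from self[of "a ** mexp (c t)"] obtain k where k: "k \<in> K" "a ** mexp (c t) = mexp (t *\<^sub>R X) ** k"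
      unfolding t[symmetric] by (auto simp: coset_def)
    have "mexp (- (t *\<^sub>R X')) = ?b ** mexp (- (t *\<^sub>R X)) ** a"
      using mexp_conj[of a ?b "- (t *\<^sub>R X)"] aK by (simp add: X'_def K.mstar_mult_self K.mult_mstar_self)
    then have "mexp (- (t *\<^sub>R X')) ** mexp (c t) = ?b ** mexp (- (t *\<^sub>R X)) ** (a ** mexp (c t))"
      by (simp add: matrix_mul_assoc)
    also have "\<dots> = ?b ** (mexp (- (t *\<^sub>R X)) ** mexp (t *\<^sub>R X)) ** k"
      unfolding k(2) by (simp only: matrix_mul_assoc)
    finally show ?thesis using b k(1) by (simp add: mexp_neg_mult K.mult_in)
  qed
  with ev have ev': "\<forall>\<^sub>F t in nhds 0. P (c t) = c t \<and> mexp (- (t *\<^sub>R X')) ** mexp (c t) \<in> K \<and>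
      (c has_vector_derivative c' t) (at t)"
    by (auto elim!: eventually_mono simp: complement_iff)
  note c = chart_curve_unique[OF X' c0 ev' c'']
  \<comment> \<open>The test vector is conjugated too, so that undoing the conjugation yields the
    equation for \<open>w\<close>.\<close>
  define w' where "w' = ?b ** w ** a"
  have w': "P w' = w'" unfolding w'_def by (rule conj_in[OF w])
  have "chart_metric K g a 0 c'' w' + christoffel K g a 0 (c' 0) (c' 0) w' = 0"
    using w' by (intro eq) (simp add: complement_iff)
  then have "B X' (P (commutator X' w')) = 0"
    unfolding c chart_metric_zero[OF a complement_in[OF w']] christoffel_eq[OF a X' w'] by simp
  then show ?thesis
    using base_form_conj_P[OF b complement_in[OF X], of w] by (simp add: X'_def w'_def)
qed

text \<open>The geodesic lemma of Kowalski and Vanhecke for vectors of the reductive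
  complement.\<close>

theorem geodesic_vector_iff:
  assumes "P X = X"
  shows "geodesic_vector G K g X \<longleftrightarrow> (\<forall>w. P w = w \<longrightarrow> B X (P (commutator X w)) = 0)"
  using geodesic_vectorI[OF assms] geodesic_vectorD[OF _ assms] by blast

end

end

section \<open>Block-diagonal subgroups\<close>

text \<open>Hadamard multiplication by real coefficients; all metric operators here have this
  shape.\<close>

definition weigh :: "('n \<Rightarrow> 'n \<Rightarrow> real) \<Rightarrow> 'f::star_scalar^'n^'n \<Rightarrow> 'f^'n^'n" where
  "weigh l X = (\<chi> a b. l a b *\<^sub>R X $ a $ b)"

text \<open>Only the first index is moved inside its class; symmetry carries this over to the
  second.\<close>

definition class_weight :: "('n \<Rightarrow> nat) \<Rightarrow> ('n \<Rightarrow> 'n \<Rightarrow> real) \<Rightarrow> bool" where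
  "class_weight \<beta> l \<longleftrightarrow> (\<forall>a b. l a b = l b a) \<and> (\<forall>a a' b. \<beta> a = \<beta> a' \<longrightarrow> l a b = l a' b)"

definition block_diagonal :: "('n \<Rightarrow> nat) \<Rightarrow> 'f::star_scalar^'n^'n \<Rightarrow> bool" where
  "block_diagonal \<beta> X \<longleftrightarrow> (\<forall>a b. \<beta> a \<noteq> \<beta> b \<longrightarrow> X $ a $ b = 0)"

text \<open>Labels are arbitrary functions. The constant labelling gives the whole group, so G/K,
  G/H and H/K are all quotients of groups of this form.\<close>

definition diag_group :: "('n \<Rightarrow> nat) \<Rightarrow> ('f::star_scalar^'n^'n) set \<Rightarrow> ('f^'n^'n) set" where
  "diag_group \<beta> G = {A \<in> G. block_diagonal \<beta> A}"

text \<open>The indicator of the positions of p, when \<open>\<alpha>\<close> labels the blocks of H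
  and \<open>\<beta>\<close> those of K.\<close>

definition sep :: "('n \<Rightarrow> nat) \<Rightarrow> ('n \<Rightarrow> nat) \<Rightarrow> 'n \<Rightarrow> 'n \<Rightarrow> real" where
  "sep \<alpha> \<beta> a b = (if \<alpha> a = \<alpha> b \<and> \<beta> a \<noteq> \<beta> b then 1 else 0)"

text \<open>The orthogonal projection to the complement of the \<open>\<beta>\<close>-block-diagonal matrices in the
  \<open>\<alpha>\<close>-block-diagonal ones; the skew part is taken first to have it defined on all matrices.\<close>

definition proj :: "('n \<Rightarrow> nat) \<Rightarrow> ('n \<Rightarrow> nat) \<Rightarrow> 'f::star_scalar^'n^'n \<Rightarrow> 'f^'n^'n" where
  "proj \<alpha> \<beta> X = weigh (sep \<alpha> \<beta>) ((1/2) *\<^sub>R (X - mstar X))"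

lemma weigh_nth [simp]: "weigh l X $ a $ b = l a b *\<^sub>R X $ a $ b"
  by (simp add: weigh_def)

lemma linear_weigh: "linear (weigh l)"
  by (rule linearI) (simp_all add: vec_eq_iff scaleR_add_right)

lemma weigh_add: "weigh l (X + Y) = weigh l X + weigh l Y"
  and weigh_diff: "weigh l (X - Y) = weigh l X - weigh l Y"
  and weigh_scaleR: "weigh l (r *\<^sub>R X) = r *\<^sub>R weigh l X"
  using linear_weigh by (auto intro: linear_add linear_diff linear_scale)

lemma class_weight_sym: "class_weight \<beta> l \<Longrightarrow> l a b = l b a"
  unfolding class_weight_def by blast

lemma class_weight_cong: "class_weight \<beta> l \<Longrightarrow> \<beta> a = \<beta> a' \<Longrightarrow> \<beta> b = \<beta> b' \<Longrightarrow> l a b = l a' b'"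
  unfolding class_weight_def by metis

lemma class_weight_sep:
  assumes "\<And>a b. \<beta> a = \<beta> b \<Longrightarrow> \<alpha> a = \<alpha> b" shows "class_weight \<beta> (sep \<alpha> \<beta>)"
  unfolding class_weight_def sep_def using assms by (smt (verit))

lemma class_weight_coarser:
  "class_weight \<alpha> l \<Longrightarrow> (\<And>a b. \<beta> a = \<beta> b \<Longrightarrow> \<alpha> a = \<alpha> b) \<Longrightarrow> class_weight \<beta> l"
  unfolding class_weight_def by blast

text \<open>A nonzero term of the sum joins \<open>a\<close> and \<open>c\<close> in one class,
  where the weights of (a, b) and (c, b) agree. With the right-hand version this is equivariance of
  the metric operator.\<close>

lemma weigh_mult_left:
  assumes "block_diagonal \<beta> A" "class_weight \<beta> l"
  shows "weigh l (A ** X) = A ** weigh l X"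
proof -
  have "l a b *\<^sub>R (A $ a $ c * X $ c $ b) = A $ a $ c * l c b *\<^sub>R X $ c $ b" for a b c
    using assms class_weight_cong[OF assms(2), of a c b b]
    by (cases "\<beta> a = \<beta> c") (auto simp: block_diagonal_def)
  then show ?thesis
    by (simp add: vec_eq_iff matrix_matrix_mult_def scaleR_sum_right del: mult_scaleR_right)
qed

lemma weigh_mult_right:
  assumes "block_diagonal \<beta> A" "class_weight \<beta> l"
  shows "weigh l (X ** A) = weigh l X ** A"
proof -
  have "l a b *\<^sub>R (X $ a $ c * A $ c $ b) = (l a c *\<^sub>R X $ a $ c) * A $ c $ b" for a b c
    using assms class_weight_cong[OF assms(2), of a a b c]
    by (cases "\<beta> b = \<beta> c") (auto simp: block_diagonal_def)
  then show ?thesis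
    by (simp add: vec_eq_iff matrix_matrix_mult_def scaleR_sum_right del: mult_scaleR_left)
qed

lemma mstar_weigh: "(\<And>a b. l a b = l b a) \<Longrightarrow> mstar (weigh l X) = weigh l (mstar X)"
  by (simp add: vec_eq_iff mstar_nth cj_scaleR)

lemma ip_weigh:
  assumes "\<And>a b. l a b = l b a" shows "ip (weigh l X) Y = ip X (weigh l Y)"
proof -
  have "weigh l X $ a $ b * Y $ b $ a = X $ a $ b * weigh l Y $ b $ a" for a b
    using assms[of a b] by simp
  then show ?thesis
    by (simp add: ip_def trace_def matrix_matrix_mult_def del: weigh_nth)
qed

lemma block_diagonal_mat_1: "block_diagonal \<beta> (mat 1)"
  by (auto simp: block_diagonal_def mat_def)

lemma block_diagonal_mult:
  assumes "block_diagonal \<beta> A" "block_diagonal \<beta> B" shows "block_diagonal \<beta> (A ** B)"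
proof -
  have "\<beta> a \<noteq> \<beta> b \<Longrightarrow> A $ a $ c * B $ c $ b = 0" for a b c
    using assms by (cases "\<beta> a = \<beta> c") (auto simp: block_diagonal_def)
  then show ?thesis by (simp add: block_diagonal_def matrix_matrix_mult_def del: mult_eq_0_iff)
qed

lemma block_diagonal_mstar: "block_diagonal \<beta> A \<Longrightarrow> block_diagonal \<beta> (mstar A)"
  by (auto simp: block_diagonal_def mstar_nth)

lemma linear_entry: "linear (\<lambda>X :: 'f::star_scalar^'n^'n. X $ a $ b)"
  by (rule linearI) simp_all

lemma block_diagonal_mexp:
  assumes "block_diagonal \<beta> X" shows "block_diagonal \<beta> (mexp X)"
proof -
  have "block_diagonal \<beta> (mpow X k)" for k
    by (induction k) (simp_all add: mpow_Suc block_diagonal_mat_1 block_diagonal_mult assms)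
  then show ?thesis
    unfolding block_diagonal_def using mexp_linear_zero[OF linear_entry] by blast
qed

lemma diagonal_derivative:
  assumes "\<And>t. block_diagonal \<beta> (\<gamma> t)" "(\<gamma> has_vector_derivative D) (at t0)"
  shows "block_diagonal \<beta> D"
  unfolding block_diagonal_def
proof (intro allI impI)
  fix a b assume "\<beta> a \<noteq> \<beta> b"
  have "((\<lambda>t. \<gamma> t $ a $ b) has_vector_derivative D $ a $ b) (at t0)"
    using linear_entry[of a b] bounded_linear.has_vector_derivative[OF _ assms(2)]
    by (simp add: linear_conv_bounded_linear)
  moreover have "(\<lambda>t. \<gamma> t $ a $ b) = (\<lambda>t. 0)"
    using assms(1) \<open>\<beta> a \<noteq> \<beta> b\<close> by (simp add: block_diagonal_def)
  ultimately show "D $ a $ b = 0"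
    by (metis has_vector_derivative_const vector_derivative_at)
qed

context matrix_group
begin

text \<open>Vanishing of entries is a linear condition, so it passes to derivatives in one direction
  and to the exponential series in the other.\<close>

lemma lie_diag_group: "lie_algebra (diag_group \<beta> G) = {X \<in> lie_algebra G. block_diagonal \<beta> X}"
proof (intro equalityI subsetI)
  fix X assume X: "X \<in> lie_algebra (diag_group \<beta> G)"
  then have "block_diagonal \<beta> (mexp (t *\<^sub>R X))" for t
    by (simp add: lie_algebra_def diag_group_def)
  then have "block_diagonal \<beta> X"
    using diagonal_derivative[OF _ mexp_line_derivative[of X 0], of \<beta>] by simp
  with X show "X \<in> {X \<in> lie_algebra G. block_diagonal \<beta> X}"
    by (simp add: lie_algebra_def diag_group_def)
next
  fix X assume X: "X \<in> {X \<in> lie_algebra G. block_diagonal \<beta> X}"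
  then have "block_diagonal \<beta> (t *\<^sub>R X)" for t by (simp add: block_diagonal_def)
  with X show "X \<in> lie_algebra (diag_group \<beta> G)"
    by (simp add: lie_algebra_def diag_group_def block_diagonal_mexp)
qed

lemma matrix_group_diag_group: "matrix_group (diag_group \<beta> G)"
proof
  fix \<gamma> :: "real \<Rightarrow> 'f^'n^'n" and D
  assume c: "\<And>t. \<gamma> t \<in> diag_group \<beta> G" "\<gamma> 0 = mat 1" "(\<gamma> has_vector_derivative D) (at 0)"
  have "\<gamma> t \<in> G" "block_diagonal \<beta> (\<gamma> t)" for t
    using c(1)[of t] by (simp_all add: diag_group_def)
  with c(2,3) show "D \<in> lie_algebra (diag_group \<beta> G)"
    unfolding lie_diag_group using curve_derivative_in[of \<gamma> D] diagonal_derivative[of \<beta> \<gamma> D 0] by simp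
qed (auto simp: diag_group_def mat_1_in mult_in mstar_in mstar_mult_self block_diagonal_mat_1
    block_diagonal_mult block_diagonal_mstar)

end

lemma proj_skew: "mstar X = - X \<Longrightarrow> proj \<alpha> \<beta> X = weigh (sep \<alpha> \<beta>) X"
  by (simp add: proj_def scaleR_2[symmetric])

lemma sep_sym: "sep \<alpha> \<beta> a b = sep \<alpha> \<beta> b a"
  by (auto simp: sep_def)

lemma skew_proj: "mstar (proj \<alpha> \<beta> X) = - proj \<alpha> \<beta> X"
proof -
  have "mstar (proj \<alpha> \<beta> X) = weigh (sep \<alpha> \<beta>) (mstar ((1/2) *\<^sub>R (X - mstar X)))"
    unfolding proj_def by (rule mstar_weigh[OF sep_sym])
  also have "\<dots> = - proj \<alpha> \<beta> X"
    by (simp add: proj_def mstar_scaleR mstar_diff vec_eq_iff scaleR_diff_right)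
  finally show ?thesis .
qed

lemma proj_fixed_iff:
  "proj \<alpha> \<beta> X = X \<longleftrightarrow> mstar X = - X \<and> (\<forall>a b. \<alpha> a = \<alpha> b \<and> \<beta> a \<noteq> \<beta> b \<or> X $ a $ b = 0)"
proof (intro iffI conjI)
  assume X: "proj \<alpha> \<beta> X = X"
  then show sk: "mstar X = - X" using skew_proj[of \<alpha> \<beta> X] by simp
  show "\<forall>a b. \<alpha> a = \<alpha> b \<and> \<beta> a \<noteq> \<beta> b \<or> X $ a $ b = 0"
    using X unfolding proj_skew[OF sk] by (auto simp: vec_eq_iff sep_def split: if_splits)
next
  assume X: "mstar X = - X \<and> (\<forall>a b. \<alpha> a = \<alpha> b \<and> \<beta> a \<noteq> \<beta> b \<or> X $ a $ b = 0)"
  then show "proj \<alpha> \<beta> X = X"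
    by (auto simp: proj_skew vec_eq_iff sep_def)
qed

lemma proj_proj: "proj \<alpha> \<beta> (proj \<alpha> \<beta> X) = proj \<alpha> \<beta> X"
  by (simp add: proj_skew[OF skew_proj]) (simp add: proj_def vec_eq_iff sep_def)

lemma linear_proj: "linear (proj \<alpha> \<beta>)"
  unfolding proj_def
  by (rule linearI) (simp_all add: vec_eq_iff mstar_add mstar_scaleR algebra_simps)

text \<open>The trace condition of su(n) concerns the diagonal only, so skew matrices with zero
  diagonal lie in the Lie algebra for all three families. Every value of \<open>proj\<close> is of
  this kind.\<close>

locale full_matrix_group = matrix_group G for G :: "('f::star_scalar^'n^'n) set" +
  assumes zero_diagonal_in: "mstar X = - X \<Longrightarrow> (\<And>a. X $ a $ a = 0) \<Longrightarrow> X \<in> lie_algebra G"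
begin

lemma reductive_pair_diag_group:
  assumes finer: "\<And>a b. \<beta> a = \<beta> b \<Longrightarrow> \<alpha> a = \<alpha> b"
  shows "reductive_pair (diag_group \<alpha> G) (diag_group \<beta> G) (proj \<alpha> \<beta>)"
proof -
  interpret H: matrix_group "diag_group \<alpha> G" by (rule matrix_group_diag_group)
  interpret K: matrix_group "diag_group \<beta> G" by (rule matrix_group_diag_group)
  have P_in: "proj \<alpha> \<beta> X \<in> lie_algebra (diag_group \<alpha> G)" for X
    unfolding lie_diag_group
    by (auto intro!: zero_diagonal_in skew_proj simp: block_diagonal_def) (simp_all add: proj_def sep_def)
  have diff_in: "X - proj \<alpha> \<beta> X \<in> lie_algebra (diag_group \<beta> G)" if X: "X \<in> lie_algebra (diag_group \<alpha> G)" for X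
  proof -
    have "(X - proj \<alpha> \<beta> X) $ a $ b = 0" if "\<beta> a \<noteq> \<beta> b" for a b
      using that X by (auto simp: proj_skew[OF H.lie_skew[OF X]] sep_def lie_diag_group block_diagonal_def)
    with H.lie_diff[OF X P_in[of X]] show ?thesis
      by (simp add: lie_diag_group block_diagonal_def)
  qed
  have orth: "ip (proj \<alpha> \<beta> X) Y = 0" if "Y \<in> lie_algebra (diag_group \<beta> G)" for X Y
  proof -
    have "inner (proj \<alpha> \<beta> X $ a $ b) (Y $ a $ b) = 0" for a b
      using that by (cases "\<beta> a = \<beta> b") (auto simp: proj_def sep_def lie_diag_group block_diagonal_def)
    then show ?thesis by (simp add: ip_skew[OF skew_proj] inner_vec_def)
  qed
  show ?thesis
  proof (rule reductive_pair.intro[OF matrix_group_diag_group matrix_group_diag_group reductive_pair_axioms.intro])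
    show "diag_group \<beta> G \<subseteq> diag_group \<alpha> G"
      unfolding diag_group_def block_diagonal_def using finer by blast
    show "linear (proj \<alpha> \<beta>)" by (rule linear_proj)
    show "proj \<alpha> \<beta> k = 0" if "k \<in> diag_group \<beta> G" for k
      using that by (auto simp: diag_group_def block_diagonal_def proj_def vec_eq_iff sep_def mstar_nth)
    show "proj \<alpha> \<beta> X \<in> lie_algebra (diag_group \<alpha> G)" for X by (rule P_in)
    show "proj \<alpha> \<beta> (proj \<alpha> \<beta> X) = proj \<alpha> \<beta> X" for X by (rule proj_proj)
    show "X - proj \<alpha> \<beta> X \<in> lie_algebra (diag_group \<beta> G)" if "X \<in> lie_algebra (diag_group \<alpha> G)" for X
      using that by (rule diff_in)
    show "complement (diag_group \<alpha> G) (diag_group \<beta> G) = range (proj \<alpha> \<beta>)"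
    proof (intro equalityI subsetI)
      fix X assume X: "X \<in> complement (diag_group \<alpha> G) (diag_group \<beta> G)"
      \<comment> \<open>The defect lies in the Lie algebra of the smaller group and is orthogonal to
        it, hence to itself.\<close>
      let ?Y = "X - proj \<alpha> \<beta> X"
      have Y: "?Y \<in> lie_algebra (diag_group \<beta> G)"
        using X by (intro diff_in) (simp add: complement_def)
      then have "ip ?Y ?Y = 0"
        using X orth[OF Y, of X] by (simp add: ip_diff_left complement_def)
      then have "?Y = 0"
        using ip_skew[OF K.lie_skew[OF Y], of ?Y] by simp
      then show "X \<in> range (proj \<alpha> \<beta>)" by (metis eq_iff_diff_eq_0 rangeI)
    qed (auto simp: complement_def P_in orth)
    show "proj \<alpha> \<beta> (k ** X ** mstar k) = k ** proj \<alpha> \<beta> X ** mstar k" if "k \<in> diag_group \<beta> G" for k X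
    proof -
      have k: "block_diagonal \<beta> k" "block_diagonal \<beta> (mstar k)"
        using that by (auto simp: diag_group_def block_diagonal_mstar)
      have w: "class_weight \<beta> (sep \<alpha> \<beta>)" using finer by (rule class_weight_sep)
      have "k ** X ** mstar k - mstar (k ** X ** mstar k) = k ** (X - mstar X) ** mstar k"
        by (simp add: mstar_mult matrix_mul_assoc)
      then show ?thesis
        unfolding proj_def
        by (simp only: weigh_mult_left[OF k(1) w] weigh_mult_right[OF k(2) w] weigh_scaleR matrix_mult_simps(7,8))
    qed
  qed
qed

text \<open>At most two \<open>\<beta>\<close>-blocks in each \<open>\<alpha>\<close>-block give the
  bracket relation of a symmetric space: a product of two elements of p is block diagonal, so [p, p]
  has no component in p and the geodesic criterion holds for every metric.\<close>

lemma equigeodesic_diag_group: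
  assumes finer: "\<And>a b. \<beta> a = \<beta> b \<Longrightarrow> \<alpha> a = \<alpha> b"
    and two: "\<And>a b c. \<alpha> a = \<alpha> b \<Longrightarrow> \<alpha> b = \<alpha> c \<Longrightarrow> \<beta> a = \<beta> b \<or> \<beta> b = \<beta> c \<or> \<beta> a = \<beta> c"
    and X: "proj \<alpha> \<beta> X = X"
  shows "equigeodesic (diag_group \<alpha> G) (diag_group \<beta> G) X"
  unfolding equigeodesic_def
proof (intro allI impI)
  fix g assume g: "invariant_metric (diag_group \<alpha> G) (diag_group \<beta> G) g"
  interpret reductive_pair "diag_group \<alpha> G" "diag_group \<beta> G" "proj \<alpha> \<beta>"
    using finer by (rule reductive_pair_diag_group)
  have "proj \<alpha> \<beta> (commutator X w) = 0" if w: "proj \<alpha> \<beta> w = w" for w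
  proof -
    have prod: "Y $ a $ c * Z $ c $ b = 0"
      if "proj \<alpha> \<beta> Y = Y" "proj \<alpha> \<beta> Z = Z" "\<alpha> a = \<alpha> b" "\<beta> a \<noteq> \<beta> b" for a b c Y Z
    proof -
      have "\<alpha> a = \<alpha> c \<and> \<beta> a \<noteq> \<beta> c \<or> Y $ a $ c = 0" "\<alpha> c = \<alpha> b \<and> \<beta> c \<noteq> \<beta> b \<or> Z $ c $ b = 0"
        using that(1,2) unfolding proj_fixed_iff by blast+
      then show ?thesis using that(3,4) two[of a c b] by auto
    qed
    have "commutator X w $ a $ b = 0" if "\<alpha> a = \<alpha> b" "\<beta> a \<noteq> \<beta> b" for a b
    proof -
      have "(X ** w) $ a $ b = 0" "(w ** X) $ a $ b = 0"
        unfolding matrix_matrix_mult_def using prod[OF X w that] prod[OF w X that]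
        by (simp_all del: mult_eq_0_iff)
      then show ?thesis by (simp add: commutator_def)
    qed
    then show ?thesis
      unfolding proj_def vec_eq_iff weigh_nth sep_def by (simp add: mstar_nth)
  qed
  then show "geodesic_vector (diag_group \<alpha> G) (diag_group \<beta> G) g X"
    using base_form_zero[OF g, of X] base_form_axioms(1)[OF g, of X 0] complement_in[OF X] G.lie_0
    unfolding geodesic_vector_iff[OF g X] by simp
qed

end

section \<open>Classification of the invariant metrics\<close>

definition monomial :: "('n \<Rightarrow> 'n) \<Rightarrow> ('n \<Rightarrow> 'f::star_scalar) \<Rightarrow> 'f^'n^'n" where
  "monomial \<sigma> \<epsilon> = (\<chi> x y. if y = \<sigma> x then \<epsilon> x else 0)"

definition matrix_unit :: "'n \<Rightarrow> 'n \<Rightarrow> 'f::star_scalar \<Rightarrow> 'f^'n^'n" where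
  "matrix_unit a b q = (\<chi> x y. if x = a \<and> y = b then q else 0)"

text \<open>For fixed distinct a, b these matrices form a copy of F; unitary monomial matrices
  permute such copies and multiply the scalar by units from left and right.\<close>

definition elem :: "'n \<Rightarrow> 'n \<Rightarrow> 'f::star_scalar \<Rightarrow> 'f^'n^'n" where
  "elem a b q = matrix_unit a b q - matrix_unit b a (cj q)"

lemma monomial_conj_nth:
  "(monomial \<sigma> \<epsilon> ** X ** mstar (monomial \<sigma> \<epsilon>)) $ x $ y = \<epsilon> x * X $ \<sigma> x $ \<sigma> y * cj (\<epsilon> y)"
proof -
  have l: "(monomial \<sigma> \<epsilon> ** X) $ x $ y = \<epsilon> x * X $ \<sigma> x $ y" for X :: "'a^'b^'b" and x y
    by (simp add: monomial_def matrix_matrix_mult_def if_distrib if_distribR cong: if_cong)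
  have "(Z ** mstar (monomial \<sigma> \<epsilon>)) $ x $ y = Z $ x $ \<sigma> y * cj (\<epsilon> y)" for Z :: "'a^'b^'b" and x y
    by (simp add: monomial_def matrix_matrix_mult_def mstar_nth if_distrib if_distribR cong: if_cong)
  then show ?thesis by (simp add: l)
qed

lemma matrix_unit_nth: "matrix_unit a b q $ x $ y = (if x = a \<and> y = b then q else 0)"
  by (simp add: matrix_unit_def)

lemma matrix_unit_add: "matrix_unit a b (p + q) = matrix_unit a b p + matrix_unit a b q"
  by (simp add: vec_eq_iff matrix_unit_nth)

lemma matrix_unit_scaleR: "matrix_unit a b (r *\<^sub>R q) = r *\<^sub>R matrix_unit a b q"
  by (simp add: vec_eq_iff matrix_unit_nth)

lemma matrix_unit_minus: "matrix_unit a b (- q) = - matrix_unit a b q"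
  by (simp add: vec_eq_iff matrix_unit_nth)

lemma matrix_unit_0 [simp]: "matrix_unit a b 0 = 0"
  by (simp add: vec_eq_iff matrix_unit_nth)

lemma mstar_matrix_unit: "mstar (matrix_unit a b q) = matrix_unit b a (cj q)"
  by (simp add: vec_eq_iff matrix_unit_nth mstar_nth)

lemma weigh_matrix_unit: "weigh l (matrix_unit a b q) = l a b *\<^sub>R matrix_unit a b q"
  by (simp add: vec_eq_iff matrix_unit_nth)

lemma matrix_unit_conj:
  assumes "\<sigma> a' = a" "\<sigma> b' = b" "inj \<sigma>"
  shows "monomial \<sigma> \<epsilon> ** matrix_unit a b q ** mstar (monomial \<sigma> \<epsilon>) =
    matrix_unit a' b' (\<epsilon> a' * q * cj (\<epsilon> b'))"
proof -
  have "\<sigma> x = a \<longleftrightarrow> x = a'" "\<sigma> x = b \<longleftrightarrow> x = b'" for x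
    using assms by (auto dest: injD)
  then show ?thesis
    by (simp add: vec_eq_iff monomial_conj_nth matrix_unit_nth)
qed

lemma elem_add: "elem a b (p + q) = elem a b p + elem a b q"
  by (simp add: elem_def matrix_unit_add cj_add)

lemma elem_scaleR: "elem a b (r *\<^sub>R q) = r *\<^sub>R elem a b q"
  by (simp add: elem_def matrix_unit_scaleR cj_scaleR scaleR_diff_right)

lemma elem_minus: "elem a b (- q) = - elem a b q"
  by (simp add: elem_def matrix_unit_minus)

lemma elem_0 [simp]: "elem a b 0 = 0"
  by (simp add: elem_def)

lemma elem_swap: "elem b a (- cj q) = elem a b q"
  by (simp add: elem_def matrix_unit_minus cj_cj)

lemma skew_elem: "mstar (elem a b q) = - elem a b q"
  by (simp add: elem_def mstar_diff mstar_matrix_unit cj_cj)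

lemma elem_nth_same: "a \<noteq> b \<Longrightarrow> elem a b q $ a $ b = q"
  by (simp add: elem_def matrix_unit_nth)

lemma elem_conj:
  assumes "\<sigma> a' = a" "\<sigma> b' = b" "inj \<sigma>"
  shows "monomial \<sigma> \<epsilon> ** elem a b q ** mstar (monomial \<sigma> \<epsilon>) = elem a' b' (\<epsilon> a' * q * cj (\<epsilon> b'))"
  unfolding elem_def
  by (simp add: matrix_unit_conj[OF assms] matrix_unit_conj[OF assms(2,1,3)] cj_mult cj_cj mult.assoc)

lemma sum_matrix_unit: "(\<Sum>p\<in>UNIV. matrix_unit (fst p) (snd p) (X $ fst p $ snd p)) = X"
proof -
  have "(\<Sum>p\<in>UNIV. matrix_unit (fst p) (snd p) (X $ fst p $ snd p)) $ x $ y = X $ x $ y" for x y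
  proof -
    have "(\<Sum>p\<in>UNIV. matrix_unit (fst p) (snd p) (X $ fst p $ snd p)) $ x $ y =
        (\<Sum>p\<in>UNIV. if p = (x, y) then X $ x $ y else 0)"
      unfolding sum_component by (rule sum.cong) (auto simp: matrix_unit_nth)
    then show ?thesis by simp
  qed
  then show ?thesis by (simp add: vec_eq_iff)
qed

text \<open>All ordered pairs are summed, so every entry is produced twice, and 1/2 corrects this
  without choosing an order of the indices.\<close>

lemma skew_sum_elem:
  assumes "mstar X = - X"
  shows "X = (\<Sum>p\<in>UNIV. (1/2) *\<^sub>R elem (fst p) (snd p) (X $ fst p $ snd p))"
proof -
  have "(\<Sum>p\<in>UNIV. elem (fst p) (snd p) (X $ fst p $ snd p)) = X - mstar X"
    unfolding elem_def mstar_matrix_unit[symmetric]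
    by (simp add: sum_subtractf sum_matrix_unit flip: linear_sum[OF linear_mstar])
  also have "\<dots> = 2 *\<^sub>R X" by (simp add: assms scaleR_2)
  finally show ?thesis by (simp flip: scaleR_sum_right)
qed

lemma weigh_elem:
  assumes "\<And>x y. l x y = l y x" shows "weigh l (elem a b q) = l a b *\<^sub>R elem a b q"
  using assms[of a b] by (simp add: elem_def weigh_diff weigh_matrix_unit scaleR_diff_right)

lemma ip_skew_eq_0: "mstar X = - X \<Longrightarrow> ip X X = 0 \<longleftrightarrow> X = 0"
  by (simp add: ip_skew)

lemma diag_group_trivial: "diag_group (\<lambda>_. 0) G = G"
  by (auto simp: diag_group_def block_diagonal_def)

lemma sep_trivial: "sep (\<lambda>_. 0) \<beta> a b = (if \<beta> a = \<beta> b then 0 else 1)"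
  by (simp add: sep_def)

abbreviation off :: "('n \<Rightarrow> nat) \<Rightarrow> 'f::star_scalar^'n^'n \<Rightarrow> 'f^'n^'n" where
  "off \<equiv> proj (\<lambda>_. 0)"

text \<open>The factor \<open>cj z\<close> keeps the determinant equal to one. Since \<open>n \<ge> 5\<close>, two coordinate
  pairs always leave a further index to place it.\<close>

locale classical_group = full_matrix_group G for G :: "('f::star_scalar^'n^'n) set" +
  assumes torus_in: "a \<noteq> c \<Longrightarrow> norm z = 1 \<Longrightarrow>
      monomial id (\<lambda>x. if x = a then z else if x = c then cj z else 1) \<in> G"
    and rotation_in: "a \<noteq> b \<Longrightarrow>
      monomial (Transposition.transpose a b) (\<lambda>x. if x = a then - 1 else 1) \<in> G"
    and card_ge_5: "5 \<le> CARD('n)"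
begin

lemma reductive_pair_off: "reductive_pair G (diag_group \<beta> G) (off \<beta>)"
  using reductive_pair_diag_group[of \<beta> "\<lambda>_. 0"] by (simp add: diag_group_trivial)

lemma exists_other: "\<exists>c :: 'n. c \<notin> {x, y, z, w}"
proof -
  have "card {x, y, z, w} \<le> 4"
    using card_length[of "[x, y, z, w]"] by simp
  then have "{x, y, z, w} \<noteq> UNIV" using card_ge_5 by auto
  then show ?thesis by blast
qed

lemma elem_in: "a \<noteq> b \<Longrightarrow> elem a b q \<in> lie_algebra G"
  by (rule zero_diagonal_in[OF skew_elem]) (auto simp: elem_def matrix_unit_nth)

lemma torus_in_diag_group:
  assumes "a \<noteq> c" "norm z = 1"
  shows "monomial id (\<lambda>x. if x = a then z else if x = c then cj z else 1) \<in> diag_group \<beta> G"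
  using torus_in[OF assms] by (auto simp: diag_group_def block_diagonal_def monomial_def)

lemma rotation_in_diag_group:
  assumes "a \<noteq> b" "\<beta> a = \<beta> b"
  shows "monomial (Transposition.transpose a b) (\<lambda>x. if x = a then - 1 else 1) \<in> diag_group \<beta> G"
proof -
  have "\<beta> (Transposition.transpose a b x) = \<beta> x" for x
    using assms(2) unfolding Transposition.transpose_def by simp
  then have "block_diagonal \<beta> (monomial (Transposition.transpose a b) \<epsilon>)" for \<epsilon> :: "'n \<Rightarrow> 'f"
    unfolding block_diagonal_def monomial_def by auto
  with rotation_in[OF assms(1)] show ?thesis by (simp add: diag_group_def)
qed

section \<open>Gram matrix of an invariant form on elementary skew matrices\<close>

context
  fixes \<beta> :: "'n \<Rightarrow> nat" and g :: "('f, 'n) metric_tensor"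
  assumes metric: "invariant_metric G (diag_group \<beta> G) g"
begin

interpretation R: reductive_pair G "diag_group \<beta> G" "off \<beta>"
  by (rule reductive_pair_off)

abbreviation "b_form \<equiv> base_form (diag_group \<beta> G) g"

lemma base_form_minus_left: "X \<in> lie_algebra G \<Longrightarrow> Y \<in> lie_algebra G \<Longrightarrow> b_form (- X) Y = - b_form X Y"
  using R.base_form_axioms(3)[OF metric, of X Y "-1"] by simp

text \<open>Change the sign of a coordinate \<open>x\<close> that occurs in only the first pair, and
  of a coordinate \<open>y\<close> outside both. Conjugation negates the first matrix and fixes the
  second, so the pairing equals its negative.\<close>

lemma base_form_elem_orthogonal:
  assumes ab: "a \<noteq> b" and cd: "c \<noteq> d" and ne: "{a, b} \<noteq> {c, d}"
  shows "b_form (elem a b p) (elem c d q) = 0"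
proof -
  obtain x where x: "x = a \<or> x = b" "x \<notin> {c, d}"
    using ne ab cd by blast
  obtain y where y: "y \<notin> {a, b, c, d}" using exists_other by blast
  have xy: "x \<noteq> y" using x y by auto
  let ?e = "\<lambda>u. if u = x then - 1 else if u = y then cj (- 1) else (1 :: 'f)"
  let ?T = "monomial id ?e :: 'f^'n^'n"
  have T: "?T \<in> diag_group \<beta> G"
    using xy by (intro torus_in_diag_group) auto
  have "?T ** elem a b p ** mstar ?T = - elem a b p"
    using x(1) y ab by (subst elem_conj[of id a a b b]) (auto simp: elem_minus)
  moreover have "?T ** elem c d q ** mstar ?T = elem c d q"
    using x(2) y by (subst elem_conj[of id c c d d]) auto
  ultimately have "b_form (- elem a b p) (elem c d q) = b_form (elem a b p) (elem c d q)"
    using R.base_form_conj[OF metric T elem_in[OF ab] elem_in[OF cd], of p q] by simp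
  then show ?thesis
    using base_form_minus_left[OF elem_in[OF ab] elem_in[OF cd], of p q] by simp
qed

text \<open>The diagonal matrix with \<open>z\<close> at \<open>a\<close> and its conjugate at a
  third index acts on this copy of F as left multiplication by \<open>z\<close>.\<close>

lemma base_form_elem_unit:
  assumes ab: "a \<noteq> b" and z: "norm z = 1"
  shows "b_form (elem a b (z * p)) (elem a b (z * q)) = b_form (elem a b p) (elem a b q)"
proof -
  obtain c where c: "c \<notin> {a, b, a, b}" using exists_other by blast
  let ?e = "\<lambda>u. if u = a then z else if u = c then cj z else 1"
  let ?T = "monomial id ?e :: 'f^'n^'n"
  have T: "?T \<in> diag_group \<beta> G"
    using c z by (intro torus_in_diag_group) auto
  have "?T ** elem a b r ** mstar ?T = elem a b (z * r)" for r
    using c ab by (subst elem_conj[of id a a b b]) auto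
  then show ?thesis
    using R.base_form_conj[OF metric T elem_in[OF ab] elem_in[OF ab], of p q] by simp
qed

text \<open>Unit scalars are transitive on the unit sphere of F, so the quadratic form is a multiple
  of the squared norm; polarization gives the bilinear statement.\<close>

lemma base_form_elem:
  assumes ab: "a \<noteq> b"
  shows "b_form (elem a b p) (elem a b q) = b_form (elem a b 1) (elem a b 1) * inner p q"
proof -
  define l where "l = b_form (elem a b 1) (elem a b 1)"
  have sc: "b_form (elem a b (r *\<^sub>R p)) (elem a b (r *\<^sub>R p)) = r\<^sup>2 * b_form (elem a b p) (elem a b p)" for r p
    using R.base_form_axioms(1,3)[OF metric] elem_in[OF ab]
    by (simp add: elem_scaleR lie_scaleR power2_eq_square)
  have sq: "b_form (elem a b p) (elem a b p) = l * inner p p" for p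
  proof (cases "p = 0")
    case True
    then show ?thesis using R.base_form_zero[OF metric lie_0] by simp
  next
    case False
    let ?z = "(1 / norm p) *\<^sub>R p"
    have "p = norm p *\<^sub>R (?z * 1)" using False by simp
    then have "b_form (elem a b p) (elem a b p) = (norm p)\<^sup>2 * b_form (elem a b (?z * 1)) (elem a b (?z * 1))"
      using sc[of "norm p" "?z * 1"] by simp
    also have "\<dots> = (norm p)\<^sup>2 * l"
      using base_form_elem_unit[OF ab, of ?z 1 1] False by (simp add: l_def)
    finally show ?thesis by (simp add: power2_norm_eq_inner)
  qed
  have "b_form (elem a b (p + q)) (elem a b (p + q)) =
      b_form (elem a b p) (elem a b p) + b_form (elem a b q) (elem a b q) + 2 * b_form (elem a b p) (elem a b q)"
  proof -
    have E: "elem a b r \<in> lie_algebra G" for r by (rule elem_in[OF ab])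
    note add = R.base_form_axioms(2)[OF metric] and sym = R.base_form_axioms(1)[OF metric]
    have "b_form (elem a b p + elem a b q) (elem a b p + elem a b q) =
        b_form (elem a b p + elem a b q) (elem a b p) + b_form (elem a b p + elem a b q) (elem a b q)"
      using add[OF E E lie_add[OF E E], of p q p q] sym[OF E lie_add[OF E E]] by simp
    then show ?thesis
      using add[OF E E E, of p q p] add[OF E E E, of p q q] sym[OF E E, of q p] by (simp add: elem_add)
  qed
  then have "2 * b_form (elem a b p) (elem a b q) = 2 * (l * inner p q)"
    unfolding sq inner_add_left inner_add_right inner_commute[of q p] distrib_left by linarith
  then show ?thesis by (simp add: l_def)
qed

text \<open>The quarter turn in the plane of \<open>a\<close> and \<open>a'\<close> belongs to the
  isotropy group and carries one matrix to the other. Its minus sign stands at \<open>a\<close>, so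
  the image has coefficient 1.\<close>

lemma base_form_elem_class:
  assumes "\<beta> a = \<beta> a'" "a \<noteq> b" "a' \<noteq> b"
  shows "b_form (elem a b 1) (elem a b 1) = b_form (elem a' b 1) (elem a' b 1)"
proof (cases "a = a'")
  case False
  let ?s = "Transposition.transpose a a'" and ?e = "\<lambda>x. if x = a then - 1 else (1 :: 'f)"
  let ?R = "monomial ?s ?e :: 'f^'n^'n"
  have R: "?R \<in> diag_group \<beta> G" using False assms(1) by (rule rotation_in_diag_group)
  have "?R ** elem a b 1 ** mstar ?R = elem a' b 1"
    using False assms(2,3) by (subst elem_conj[of ?s a' a b b]) (auto simp: Transposition.transpose_def)
  then show ?thesis
    using R.base_form_conj[OF metric R elem_in[OF assms(2)] elem_in[OF assms(2)], of 1 1] by simp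
qed simp

definition metric_weight :: "'n \<Rightarrow> 'n \<Rightarrow> real" where
  "metric_weight a b = (if \<beta> a = \<beta> b then 0 else b_form (elem a b 1) (elem a b 1))"

lemma metric_weight_sym: "metric_weight a b = metric_weight b a"
proof (cases "\<beta> a = \<beta> b")
  case False
  then have ab: "a \<noteq> b" by auto
  have swap: "elem b a 1 = elem a b (- 1)" using elem_swap[of b a "- 1"] by simp
  then show ?thesis
    using False base_form_elem[OF ab, of "- 1" "- 1"] unfolding metric_weight_def swap
    by (simp add: dot_square_norm)
qed (simp add: metric_weight_def)

lemma class_weight_metric_weight: "class_weight \<beta> metric_weight"
  unfolding class_weight_def
proof (intro conjI allI impI metric_weight_sym)
  fix a a' b assume e: "\<beta> a = \<beta> a'"
  show "metric_weight a b = metric_weight a' b"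
  proof (cases "\<beta> a = \<beta> b")
    case False
    then have "a \<noteq> b" "a' \<noteq> b" using e by auto
    then show ?thesis using e base_form_elem_class[OF e, of b] unfolding metric_weight_def by simp
  qed (use e in \<open>simp add: metric_weight_def\<close>)
qed

lemma metric_weight_pos: "\<beta> a \<noteq> \<beta> b \<Longrightarrow> 0 < metric_weight a b"
proof -
  assume ne: "\<beta> a \<noteq> \<beta> b"
  then have ab: "a \<noteq> b" by auto
  have "\<not> block_diagonal \<beta> (elem a b (1 :: 'f))"
    unfolding block_diagonal_def using ne elem_nth_same[OF ab, of "1 :: 'f"] by (metis zero_neq_one)
  then have "elem a b (1 :: 'f) \<notin> lie_algebra (diag_group \<beta> G)"
    by (simp add: lie_diag_group)
  then show ?thesis
    using ne R.base_form_axioms(4)[OF metric elem_in[OF ab] elem_in[OF ab]] by (simp add: metric_weight_def)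
qed

text \<open>The elementary matrices diagonalize both forms, so coefficients can be compared.
  \<open>?F\<close> stands in for \<open>b_form\<close> because the expansion needs bilinearity on
  all matrices.\<close>

lemma base_form_weight_off:
  assumes X: "off \<beta> X = X" and Y: "off \<beta> Y = Y"
  shows "b_form X Y = ip (weigh metric_weight X) Y"
proof -
  let ?F = "\<lambda>U V. b_form (off \<beta> U) (off \<beta> V)"
  interpret F: bounded_bilinear ?F by (rule R.bounded_bilinear_form[OF metric])
  have F_elem: "?F (elem a b p) (elem c d q) = b_form (elem a b p) (elem c d q)" if "a \<noteq> b" "c \<noteq> d" for a b c d p q
    using that by (intro R.base_form_P[OF metric] elem_in)
  have skew: "mstar X = - X" "mstar Y = - Y" using X Y by (auto simp: proj_fixed_iff)
  have X0: "X $ a $ b = 0" and Y0: "Y $ a $ b = 0" if "\<beta> a = \<beta> b" for a b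
    using X Y that unfolding proj_fixed_iff by auto
  have row: "?F (elem a b p) Y = metric_weight a b * inner p (Y $ a $ b)" if ne: "\<beta> a \<noteq> \<beta> b" for a b p
  proof -
    have ab: "a \<noteq> b" using ne by auto
    let ?t = "\<lambda>q. ?F (elem a b p) (elem (fst q) (snd q) (Y $ fst q $ snd q))"
    have z: "?t q = 0" if q: "q \<in> UNIV - {(a, b), (b, a)}" for q
    proof (cases "\<beta> (fst q) = \<beta> (snd q)")
      case True
      then show ?thesis by (simp add: Y0 F.zero_right)
    next
      case False
      then have ne': "fst q \<noteq> snd q" by auto
      have "{a, b} \<noteq> {fst q, snd q}" using q by (cases q) (auto simp: doubleton_eq_iff)
      then show ?thesis using base_form_elem_orthogonal[OF ab ne'] by (simp add: F_elem[OF ab ne'])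
    qed
    have "Y $ b $ a = - cj (Y $ a $ b)"
      using arg_cong[OF skew(2), of "\<lambda>Y. Y $ b $ a"] by (simp add: mstar_nth)
    \<comment> \<open>The two ordered pairs describe the same elementary matrix, so their halves add
      up to one full term.\<close>
    then have "?t (b, a) = ?t (a, b)" by (simp add: elem_swap)
    have "?F (elem a b p) Y = (\<Sum>q\<in>UNIV. (1/2) *\<^sub>R ?t q)"
      by (subst skew_sum_elem[OF skew(2)]) (simp only: F.sum_right F.scaleR_right)
    also have "\<dots> = (\<Sum>q\<in>{(a, b), (b, a)}. (1/2) *\<^sub>R ?t q)"
    proof (rule sum.mono_neutral_right[OF finite_class.finite_UNIV subset_UNIV], rule ballI)
      fix q assume "q \<in> UNIV - {(a, b), (b, a)}"
      then show "(1/2) *\<^sub>R ?t q = 0" by (simp only: z scaleR_zero_right)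
    qed
    also have "\<dots> = (1/2) *\<^sub>R ?t (a, b) + (1/2) *\<^sub>R ?t (b, a)" using ab by simp
    also have "\<dots> = ?t (a, b)" unfolding \<open>?t (b, a) = ?t (a, b)\<close> by simp
    also have "\<dots> = metric_weight a b * inner p (Y $ a $ b)"
      using ne base_form_elem[OF ab, of p "Y $ a $ b"] unfolding metric_weight_def fst_conv snd_conv F_elem[OF ab ab]
      by simp
    finally show ?thesis .
  qed
  have "b_form X Y = ?F X Y" by (simp add: X Y)
  also have "\<dots> = (\<Sum>q\<in>UNIV. (1/2) *\<^sub>R ?F (elem (fst q) (snd q) (X $ fst q $ snd q)) Y)"
    by (subst skew_sum_elem[OF skew(1)]) (simp only: F.sum_left F.scaleR_left)
  also have "\<dots> = (\<Sum>q\<in>UNIV. (1/2) * inner (weigh metric_weight X $ fst q $ snd q) (Y $ fst q $ snd q))"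
  proof (rule sum.cong[OF refl])
    fix q
    show "(1/2) *\<^sub>R ?F (elem (fst q) (snd q) (X $ fst q $ snd q)) Y =
        (1/2) * inner (weigh metric_weight X $ fst q $ snd q) (Y $ fst q $ snd q)"
      by (cases "\<beta> (fst q) = \<beta> (snd q)") (simp_all add: X0 F.zero_left row)
  qed
  also have "\<dots> = 1/2 * inner (weigh metric_weight X) Y"
  proof -
    have "inner Z Y = (\<Sum>q\<in>UNIV. inner (Z $ fst q $ snd q) (Y $ fst q $ snd q))" for Z :: "'f^'n^'n"
      by (simp add: inner_vec_def sum.cartesian_product split_def)
    then show ?thesis by (simp only: sum_distrib_left)
  qed
  also have "\<dots> = ip (weigh metric_weight X) Y"
  proof (rule ip_skew[symmetric])
    show "mstar (weigh metric_weight X) = - weigh metric_weight X"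
      by (subst mstar_weigh[OF metric_weight_sym]) (simp add: skew vec_eq_iff)
  qed
  finally show ?thesis .
qed

text \<open>From the complement to the whole Lie algebra: weights inside blocks are 0, so both sides
  ignore block-diagonal parts.\<close>

lemma base_form_weight:
  assumes X: "X \<in> lie_algebra G" and Y: "Y \<in> lie_algebra G"
  shows "b_form X Y = ip (weigh metric_weight X) Y"
proof -
  have off: "weigh metric_weight (off \<beta> Z) = weigh metric_weight Z" if "Z \<in> lie_algebra G" for Z
    by (auto simp: proj_skew[OF lie_skew[OF that]] vec_eq_iff sep_trivial metric_weight_def)
  have "b_form X Y = b_form (off \<beta> X) (off \<beta> Y)"
    by (rule R.base_form_P[OF metric X Y, symmetric])
  also have "\<dots> = ip (weigh metric_weight X) (off \<beta> Y)"
    by (simp only: base_form_weight_off[OF proj_proj proj_proj] off[OF X])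
  also have "\<dots> = ip X (weigh metric_weight Y)"
    by (simp only: ip_weigh[of metric_weight, OF metric_weight_sym] off[OF Y])
  finally show ?thesis
    by (simp only: ip_weigh[of metric_weight, OF metric_weight_sym])
qed

end

theorem invariant_metric_weight:
  assumes "invariant_metric G (diag_group \<beta> G) g"
  obtains l where "class_weight \<beta> l" "\<And>a b. \<beta> a \<noteq> \<beta> b \<Longrightarrow> 0 < l a b" "\<And>a b. \<beta> a = \<beta> b \<Longrightarrow> l a b = 0"
    "\<And>X Y. X \<in> lie_algebra G \<Longrightarrow> Y \<in> lie_algebra G \<Longrightarrow> base_form (diag_group \<beta> G) g X Y = ip (weigh l X) Y"
proof (rule that)
  show "class_weight \<beta> (metric_weight \<beta> g)" by (rule class_weight_metric_weight[OF assms])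
  show "\<And>a b. \<beta> a \<noteq> \<beta> b \<Longrightarrow> 0 < metric_weight \<beta> g a b" by (rule metric_weight_pos[OF assms])
  show "\<And>a b. \<beta> a = \<beta> b \<Longrightarrow> metric_weight \<beta> g a b = 0" by (simp add: metric_weight_def[OF assms])
  show "\<And>X Y. X \<in> lie_algebra G \<Longrightarrow> Y \<in> lie_algebra G \<Longrightarrow>
      base_form (diag_group \<beta> G) g X Y = ip (weigh (metric_weight \<beta> g) X) Y"
    by (rule base_form_weight[OF assms])
qed

end

section \<open>Geodesic vectors of weighted metrics\<close>

text \<open>Meaningful only if \<open>b\<close> is invariant under conjugation by the isotropy group and vanishes on its
  Lie algebra: then all representatives of the two tangent vectors give the same value.\<close>

definition metric_of ::
    "('f::star_scalar^'n^'n \<Rightarrow> 'f^'n^'n \<Rightarrow> real) \<Rightarrow> ('f, 'n) metric_tensor" where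
  "metric_of b T T' = (SOME r. \<exists>a v v'. (a, v) \<in> T \<and> (a, v') \<in> T' \<and> r = b (mstar a ** v) (mstar a ** v'))"

lemma weigh_block_diagonal:
  "(\<And>a b. \<beta> a = \<beta> b \<Longrightarrow> l a b = 0) \<Longrightarrow> block_diagonal \<beta> X \<Longrightarrow> weigh l X = 0"
  by (auto simp: block_diagonal_def vec_eq_iff)

lemma skew_weigh: "(\<And>a b. l a b = l b a) \<Longrightarrow> mstar X = - X \<Longrightarrow> mstar (weigh l X) = - weigh l X"
  by (subst mstar_weigh) (simp_all add: vec_eq_iff)

context matrix_group
begin

lemma metric_of_tangent:
  fixes l :: "'n \<Rightarrow> 'n \<Rightarrow> real"
  assumes l: "class_weight \<beta> l" "\<And>a b. \<beta> a = \<beta> b \<Longrightarrow> l a b = 0"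
    and a: "a \<in> G" and X: "X \<in> lie_algebra G" and Y: "Y \<in> lie_algebra G"
  defines "b \<equiv> \<lambda>X Y. ip (weigh l X) Y"
  shows "metric_of b (tangent (diag_group \<beta> G) a (a ** X)) (tangent (diag_group \<beta> G) a (a ** Y)) = b X Y"
proof -
  interpret K: matrix_group "diag_group \<beta> G" by (rule matrix_group_diag_group)
  let ?K = "diag_group \<beta> G"
  have pull: "mstar (a ** k) ** ((a ** Z + a ** w) ** k) = mstar k ** (Z + w) ** k" for k Z w
  proof -
    have "mstar (a ** k) ** ((a ** Z + a ** w) ** k) = mstar k ** (mstar a ** a) ** (Z + w) ** k"
      by (simp add: mstar_mult matrix_mul_assoc)
    then show ?thesis by (simp only: mstar_mult_self[OF a] matrix_mul_rid)
  qed
  have conj: "b (mstar k ** Z ** k) (mstar k ** W ** k) = b Z W" if "k \<in> ?K" for k Z W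
  proof -
    have d: "block_diagonal \<beta> k" "block_diagonal \<beta> (mstar k)"
      using that by (auto simp: diag_group_def block_diagonal_mstar)
    show ?thesis
      unfolding b_def weigh_mult_right[OF d(1) l(1)] weigh_mult_left[OF d(2) l(1)]
      using ip_conj[of "mstar k" "weigh l Z" W] K.mult_mstar_self[OF that] by simp
  qed
  have lie: "b (X + w) (Y + w') = b X Y" if "w \<in> lie_algebra ?K" "w' \<in> lie_algebra ?K" for w w'
  proof -
    have z: "weigh l w = 0" "weigh l w' = 0"
      using that by (auto simp: lie_diag_group intro!: weigh_block_diagonal[OF l(2)])
    have "ip (weigh l X) w' = 0"
      using ip_weigh[of l X w'] class_weight_sym[OF l(1)] by (simp add: z)
    then show ?thesis by (simp add: b_def weigh_add z ip_add_right)
  qed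
  have uniq: "r = b X Y" if "(c, v) \<in> tangent ?K a (a ** X)" "(c, v') \<in> tangent ?K a (a ** Y)"
    "r = b (mstar c ** v) (mstar c ** v')" for r c v v'
  proof -
    from that(1) obtain k w where k: "c = a ** k" "v = (a ** X + a ** w) ** k" "k \<in> ?K" "w \<in> lie_algebra ?K"
      unfolding tangent_def by blast
    from that(2) obtain k' w' where k': "c = a ** k'" "v' = (a ** Y + a ** w') ** k'" "k' \<in> ?K" "w' \<in> lie_algebra ?K"
      unfolding tangent_def by blast
    \<comment> \<open>Both representatives are taken over the same group element, which forces
      \<open>k = k'\<close>; only conjugation by a common element preserves the value in
      general.\<close>
    have "mstar a ** (a ** k) = mstar a ** (a ** k')" using k k' by simp
    then have "k = k'" by (simp add: matrix_mul_assoc mstar_mult_self[OF a])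
    then have "r = b (mstar k ** (X + w) ** k) (mstar k ** (Y + w') ** k)"
      using that(3) unfolding k(2) k'(2) unfolding k(1) pull[of k] \<open>k = k'\<close> pull[of k'] by simp
    also have "\<dots> = b X Y" by (simp only: conj[OF k(3)] lie[OF k(4) k'(4)])
    finally show ?thesis .
  qed
  have "(a, a ** Z) \<in> tangent ?K a (a ** Z)" for Z
  proof -
    have "(a, a ** Z) = (a ** mat 1, (a ** Z + a ** 0) ** mat 1)" by simp
    then show ?thesis unfolding tangent_def using K.mat_1_in K.lie_0 by blast
  qed
  then have "\<exists>r c v v'. (c, v) \<in> tangent ?K a (a ** X) \<and> (c, v') \<in> tangent ?K a (a ** Y) \<and>
      r = b (mstar c ** v) (mstar c ** v')" by blast
  from someI_ex[OF this] show ?thesis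
    unfolding metric_of_def using uniq by blast
qed

lemma base_form_metric_of:
  assumes "class_weight \<beta> l" "\<And>a b. \<beta> a = \<beta> b \<Longrightarrow> l a b = 0" "X \<in> lie_algebra G" "Y \<in> lie_algebra G"
  shows "base_form (diag_group \<beta> G) (metric_of (\<lambda>X Y. ip (weigh l X) Y)) X Y = ip (weigh l X) Y"
  using metric_of_tangent[OF assms(1,2) mat_1_in assms(3,4)] by (simp add: base_form_def)

lemma invariant_metric_of:
  fixes l :: "'n \<Rightarrow> 'n \<Rightarrow> real"
  assumes l: "class_weight \<beta> l" "\<And>a b. \<beta> a = \<beta> b \<Longrightarrow> l a b = 0" "\<And>a b. \<beta> a \<noteq> \<beta> b \<Longrightarrow> 0 < l a b"
  shows "invariant_metric G (diag_group \<beta> G) (metric_of (\<lambda>X Y. ip (weigh l X) Y))"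
  unfolding invariant_metric_def
proof (intro ballI)
  fix a X Y assume a: "a \<in> G" and X: "X \<in> lie_algebra G" and Y: "Y \<in> lie_algebra G"
  let ?K = "diag_group \<beta> G" and ?g = "metric_of (\<lambda>X Y. ip (weigh l X) Y)"
  note sym = class_weight_sym[OF l(1)]
  have g: "?g (tangent ?K a (a ** X)) (tangent ?K a (a ** Y)) = ip (weigh l X) Y"
    if "a \<in> G" "X \<in> lie_algebra G" "Y \<in> lie_algebra G" for a X Y
    using metric_of_tangent[OF l(1,2) that] .
  show "?g (tangent ?K a (a ** X)) (tangent ?K a (a ** Y)) =
         ?g (tangent ?K a (a ** Y)) (tangent ?K a (a ** X)) \<and>
       (\<forall>Z\<in>lie_algebra G. ?g (tangent ?K a (a ** (X + Y))) (tangent ?K a (a ** Z)) =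
         ?g (tangent ?K a (a ** X)) (tangent ?K a (a ** Z)) +
         ?g (tangent ?K a (a ** Y)) (tangent ?K a (a ** Z))) \<and>
       (\<forall>r. ?g (tangent ?K a (a ** (r *\<^sub>R X))) (tangent ?K a (a ** Y)) =
         r * ?g (tangent ?K a (a ** X)) (tangent ?K a (a ** Y))) \<and>
       (X \<notin> lie_algebra ?K \<longrightarrow> 0 < ?g (tangent ?K a (a ** X)) (tangent ?K a (a ** X))) \<and>
       (\<forall>b\<in>G. ?g (tangent ?K (b ** a) (b ** a ** X)) (tangent ?K (b ** a) (b ** a ** Y)) =
         ?g (tangent ?K a (a ** X)) (tangent ?K a (a ** Y)))"
  proof (intro conjI ballI allI impI)
    show "?g (tangent ?K a (a ** X)) (tangent ?K a (a ** Y)) = ?g (tangent ?K a (a ** Y)) (tangent ?K a (a ** X))"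
      unfolding g[OF a X Y] g[OF a Y X] by (subst ip_weigh[OF sym]) (rule ip_commute)
  next
    fix Z assume Z: "Z \<in> lie_algebra G"
    show "?g (tangent ?K a (a ** (X + Y))) (tangent ?K a (a ** Z)) =
         ?g (tangent ?K a (a ** X)) (tangent ?K a (a ** Z)) + ?g (tangent ?K a (a ** Y)) (tangent ?K a (a ** Z))"
      unfolding g[OF a X Z] g[OF a Y Z] g[OF a lie_add[OF X Y] Z] by (simp add: weigh_add ip_add_left)
  next
    fix r
    show "?g (tangent ?K a (a ** (r *\<^sub>R X))) (tangent ?K a (a ** Y)) = r * ?g (tangent ?K a (a ** X)) (tangent ?K a (a ** Y))"
      unfolding g[OF a X Y] g[OF a lie_scaleR[OF X] Y] by (simp add: weigh_scaleR ip_scaleR_left)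
  next
    assume "X \<notin> lie_algebra ?K"
    then obtain x y where xy: "\<beta> x \<noteq> \<beta> y" "X $ x $ y \<noteq> 0"
      using X by (auto simp: lie_diag_group block_diagonal_def)
    have nn: "0 \<le> l u v" for u v using l(2,3)[of u v] by (cases "\<beta> u = \<beta> v") auto
    have "0 < (\<Sum>u\<in>UNIV. \<Sum>v\<in>UNIV. l u v * inner (X $ u $ v) (X $ u $ v))"
    proof (rule sum_pos2[of _ x])
      show "0 < (\<Sum>v\<in>UNIV. l x v * inner (X $ x $ v) (X $ x $ v))"
        by (rule sum_pos2[of _ y]) (use xy l(3) nn in auto)
    qed (auto intro!: sum_nonneg mult_nonneg_nonneg nn)
    then show "0 < ?g (tangent ?K a (a ** X)) (tangent ?K a (a ** X))"
      unfolding g[OF a X X] ip_skew[OF skew_weigh[OF sym lie_skew[OF X]]] by (simp add: inner_vec_def)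
  next
    fix b assume "b \<in> G"
    then show "?g (tangent ?K (b ** a) (b ** a ** X)) (tangent ?K (b ** a) (b ** a ** Y)) =
         ?g (tangent ?K a (a ** X)) (tangent ?K a (a ** Y))"
      unfolding g[OF a X Y] using g[OF mult_in[OF _ a] X Y] by simp
  qed
qed

end

lemma commutator_skew: "mstar X = - X \<Longrightarrow> mstar Y = - Y \<Longrightarrow> mstar (commutator X Y) = - commutator X Y"
  by (simp add: commutator_def mstar_diff mstar_mult)

text \<open>For \<open>a\<close>, \<open>b\<close> in one class the weights occurring in the two
  products agree term by term. On G/H this makes the projection in the geodesic criterion
  disappear.\<close>

lemma commutator_weigh_diagonal:
  assumes l: "class_weight \<alpha> l" and ab: "\<alpha> a = \<alpha> b"
  shows "commutator (weigh l X) X $ a $ b = 0"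
proof -
  have "l a c = l c b" for c using l ab class_weight_sym[OF l, of c b] unfolding class_weight_def by metis
  then have "weigh l X $ a $ c * X $ c $ b = X $ a $ c * weigh l X $ c $ b" for c by simp
  then show ?thesis by (simp add: commutator_def matrix_matrix_mult_def del: weigh_nth)
qed

text \<open>This is [h, n] contained in n: multiplication by a block-diagonal matrix keeps the
  diagonal blocks of \<open>N\<close> zero.\<close>

lemma commutator_diagonal:
  assumes Q: "block_diagonal \<alpha> Q" and N: "\<And>a b. \<alpha> a = \<alpha> b \<Longrightarrow> N $ a $ b = 0" and ab: "\<alpha> a = \<alpha> b"
  shows "commutator Q N $ a $ b = 0"
proof -
  have "Q $ a $ c * N $ c $ b = 0" "N $ a $ c * Q $ c $ b = 0" for c
    using ab Q N[of c b] N[of a c] unfolding block_diagonal_def by (cases "\<alpha> a = \<alpha> c"; simp)+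
  then show ?thesis by (simp add: commutator_def matrix_matrix_mult_def del: mult_eq_0_iff)
qed

section \<open>Geodesic and pi-equigeodesic vectors in terms of weights\<close>

context classical_group
begin

lemma geodesic_vector_weight:
  assumes g: "invariant_metric G (diag_group \<beta> G) g"
    and l: "class_weight \<beta> l"
      "\<And>X Y. X \<in> lie_algebra G \<Longrightarrow> Y \<in> lie_algebra G \<Longrightarrow> base_form (diag_group \<beta> G) g X Y = ip (weigh l X) Y"
    and X: "off \<beta> X = X"
  shows "geodesic_vector G (diag_group \<beta> G) g X \<longleftrightarrow> off \<beta> (commutator (weigh l X) X) = 0"
proof -
  interpret R: reductive_pair G "diag_group \<beta> G" "off \<beta>" by (rule reductive_pair_off)
  let ?Z = "commutator (weigh l X) X"
  note sym = class_weight_sym[OF l(1)]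
  have skew: "mstar X = - X" using X by (simp add: proj_fixed_iff)
  have Z: "mstar ?Z = - ?Z" by (rule commutator_skew[OF skew_weigh[OF sym skew] skew])
  have sw: "weigh (sep (\<lambda>_. 0) \<beta>) (weigh l X) = weigh l X"
  proof -
    have "\<beta> a \<noteq> \<beta> b \<or> X $ a $ b = 0" for a b using X unfolding proj_fixed_iff by blast
    then show ?thesis by (auto simp: vec_eq_iff sep_trivial)
  qed
  have eq: "base_form (diag_group \<beta> G) g X (off \<beta> (commutator X w)) = ip ?Z w" if w: "off \<beta> w = w" for w
  proof -
    have "mstar w = - w" using w by (simp add: proj_fixed_iff)
    then have "mstar (commutator X w) = - commutator X w" by (rule commutator_skew[OF skew])
    then have "ip (weigh l X) (off \<beta> (commutator X w)) = ip (weigh l X) (commutator X w)"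
      by (simp only: proj_skew ip_weigh[of "sep (\<lambda>_. 0) \<beta>", OF sep_sym, symmetric] sw)
    then show ?thesis
      using l(2)[OF R.complement_in[OF X] R.P_in[of "commutator X w"]] by (simp add: ip_commutator)
  qed
  have "(\<forall>w :: 'f^'n^'n. off \<beta> w = w \<longrightarrow> ip ?Z w = 0) \<longleftrightarrow> off \<beta> ?Z = 0"
  proof
    assume "\<forall>w :: 'f^'n^'n. off \<beta> w = w \<longrightarrow> ip ?Z w = 0"
    \<comment> \<open>Nondegeneracy: the projected commutator itself is an admissible test
      vector.\<close>
    then have "ip ?Z (off \<beta> (off \<beta> ?Z)) = 0" by (simp only: proj_proj)
    then have "ip (weigh (sep (\<lambda>_. 0) \<beta>) ?Z) (off \<beta> ?Z) = 0"
      by (simp only: proj_skew[OF skew_proj] ip_weigh[of "sep (\<lambda>_. 0) \<beta>", OF sep_sym])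
    then have "ip (off \<beta> ?Z) (off \<beta> ?Z) = 0"
      by (simp only: proj_skew[OF Z])
    then show "off \<beta> ?Z = 0" by (simp only: ip_skew_eq_0[OF skew_proj])
  next
    assume z: "off \<beta> ?Z = 0"
    show "\<forall>w :: 'f^'n^'n. off \<beta> w = w \<longrightarrow> ip ?Z w = 0"
    proof (intro allI impI)
      fix w :: "'f^'n^'n" assume w: "off \<beta> w = w"
      then have "mstar w = - w" by (simp add: proj_fixed_iff)
      have "ip ?Z w = ip ?Z (off \<beta> w)" by (simp only: w)
      also have "\<dots> = ip (off \<beta> ?Z) w"
        by (simp only: proj_skew[OF \<open>mstar w = - w\<close>] proj_skew[OF Z] ip_weigh[of "sep (\<lambda>_. 0) \<beta>", OF sep_sym])
      finally show "ip ?Z w = 0" by (simp add: z)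
    qed
  qed
  then show ?thesis unfolding R.geodesic_vector_iff[OF g X] using eq by (simp cong: all_cong imp_cong)
qed

lemma geodesic_vector_weight_class:
  assumes g: "invariant_metric G (diag_group \<alpha> G) g"
    and l: "class_weight \<alpha> l"
      "\<And>X Y. X \<in> lie_algebra G \<Longrightarrow> Y \<in> lie_algebra G \<Longrightarrow> base_form (diag_group \<alpha> G) g X Y = ip (weigh l X) Y"
    and X: "off \<alpha> X = X"
  shows "geodesic_vector G (diag_group \<alpha> G) g X \<longleftrightarrow> commutator (weigh l X) X = 0"
proof -
  let ?Z = "commutator (weigh l X) X"
  have skew: "mstar X = - X" using X by (simp add: proj_fixed_iff)
  have Z: "mstar ?Z = - ?Z" by (rule commutator_skew[OF skew_weigh[OF class_weight_sym[OF l(1)] skew] skew])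
  have "off \<alpha> ?Z = ?Z"
    using commutator_weigh_diagonal[OF l(1)] Z by (auto simp: proj_fixed_iff)
  then show ?thesis using geodesic_vector_weight[OF g l X] by simp
qed

text \<open>\<open>one_pair\<close> says that only a single pair of K-blocks is merged, so an
  invariant metric acts on p by one scalar. \<open>l\<close> is the weight of the base metric, and
  \<open>Q\<close>, \<open>N\<close> are the components in p and n.\<close>

context
  fixes \<alpha> \<beta> :: "'n \<Rightarrow> nat" and gb :: "('f, 'n) metric_tensor" and l :: "'n \<Rightarrow> 'n \<Rightarrow> real"
    and Q N :: "'f^'n^'n"
  assumes finer: "\<And>a b. \<beta> a = \<beta> b \<Longrightarrow> \<alpha> a = \<alpha> b"
    and one_pair: "\<And>a b c d. \<alpha> a = \<alpha> b \<Longrightarrow> \<beta> a \<noteq> \<beta> b \<Longrightarrow> \<alpha> c = \<alpha> d \<Longrightarrow> \<beta> c \<noteq> \<beta> d \<Longrightarrow>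
      \<beta> a = \<beta> c \<and> \<beta> b = \<beta> d \<or> \<beta> a = \<beta> d \<and> \<beta> b = \<beta> c"
    and gb: "invariant_metric G (diag_group \<alpha> G) gb"
    and l: "class_weight \<alpha> l" "\<And>a b. \<alpha> a \<noteq> \<alpha> b \<Longrightarrow> 0 < l a b" "\<And>a b. \<alpha> a = \<alpha> b \<Longrightarrow> l a b = 0"
      "\<And>X Y. X \<in> lie_algebra G \<Longrightarrow> Y \<in> lie_algebra G \<Longrightarrow> base_form (diag_group \<alpha> G) gb X Y = ip (weigh l X) Y"
    and Q: "proj \<alpha> \<beta> Q = Q" and N: "off \<alpha> N = N"
begin

lemma skew_Q: "mstar Q = - Q" and skew_N: "mstar N = - N"
  using Q N by (simp_all add: proj_fixed_iff)

lemma Q_zero: "\<alpha> a \<noteq> \<alpha> b \<or> \<beta> a = \<beta> b \<Longrightarrow> Q $ a $ b = 0"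
  using Q unfolding proj_fixed_iff by blast

lemma N_zero: "\<alpha> a = \<alpha> b \<Longrightarrow> N $ a $ b = 0"
  using N unfolding proj_fixed_iff by blast

lemma off_sum: "off \<beta> (Q + N) = Q + N"
proof -
  have "\<beta> a \<noteq> \<beta> b \<or> Q $ a $ b + N $ a $ b = 0" for a b
    using Q_zero[of a b] N_zero[of a b] finer[of a b] by auto
  then show ?thesis
    by (simp add: proj_fixed_iff mstar_add skew_Q skew_N)
qed

lemma block_diagonal_Q: "block_diagonal \<alpha> Q"
  unfolding block_diagonal_def using Q_zero by blast

lemma commutator_Q_N_diagonal: "\<alpha> a = \<alpha> b \<Longrightarrow> commutator Q N $ a $ b = 0"
  by (rule commutator_diagonal[OF block_diagonal_Q N_zero])

text \<open>The weight is constant on the blocks of H, so it commutes with multiplication by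
  \<open>Q\<close>; the sign is the order of the commutator.\<close>

lemma commutator_weigh_N_Q: "commutator (weigh l N) Q = - weigh l (commutator Q N)"
  by (simp add: commutator_def weigh_diff weigh_mult_left[OF block_diagonal_Q l(1)]
    weigh_mult_right[OF block_diagonal_Q l(1)])

text \<open>\<open>l\<close> is 0 inside the blocks of H and \<open>sep\<close> is 0 between them,
  so n and p are scaled independently.\<close>

definition fibre_weight :: "real \<Rightarrow> 'n \<Rightarrow> 'n \<Rightarrow> real" where
  "fibre_weight r a b = l a b + r * sep \<alpha> \<beta> a b"

lemma weigh_fibre_weight: "weigh (fibre_weight r) X = weigh l X + r *\<^sub>R weigh (sep \<alpha> \<beta>) X"
  by (simp add: vec_eq_iff fibre_weight_def scaleR_add_left)

lemma fibre_weight: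
  assumes "0 < r"
  shows "class_weight \<beta> (fibre_weight r)" "\<And>a b. \<beta> a = \<beta> b \<Longrightarrow> fibre_weight r a b = 0"
    "\<And>a b. \<beta> a \<noteq> \<beta> b \<Longrightarrow> 0 < fibre_weight r a b"
proof -
  have "class_weight \<beta> l" "class_weight \<beta> (sep \<alpha> \<beta>)"
    using class_weight_coarser[OF l(1)] class_weight_sep[of \<beta> \<alpha>] finer by blast+
  then show "class_weight \<beta> (fibre_weight r)"
    unfolding class_weight_def fibre_weight_def by metis
  show "fibre_weight r a b = 0" if "\<beta> a = \<beta> b" for a b
    using l(3)[OF finer[OF that]] that by (simp add: fibre_weight_def sep_def)
  show "0 < fibre_weight r a b" if "\<beta> a \<noteq> \<beta> b" for a b
    using l(2)[of a b] l(3)[of a b] that assms by (cases "\<alpha> a = \<alpha> b") (simp_all add: fibre_weight_def sep_def)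
qed

definition fibre_metric :: "real \<Rightarrow> ('f, 'n) metric_tensor" where
  "fibre_metric r = metric_of (\<lambda>X Y. ip (weigh (fibre_weight r) X) Y)"

lemma fibre_metric_tangent:
  "0 < r \<Longrightarrow> a \<in> G \<Longrightarrow> X \<in> lie_algebra G \<Longrightarrow> Y \<in> lie_algebra G \<Longrightarrow>
    fibre_metric r (tangent (diag_group \<beta> G) a (a ** X)) (tangent (diag_group \<beta> G) a (a ** Y)) =
      ip (weigh (fibre_weight r) X) Y"
  unfolding fibre_metric_def using fibre_weight[of r] by (intro metric_of_tangent)

text \<open>Testing horizontality against the p-component of \<open>X\<close> itself gives
  \<open>r\<close> times its squared length. So horizontal vectors have no p-component, and on them
  the weight is that of the base metric.\<close>

lemma fibre_metric_submersion:
  assumes r: "0 < r"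
  shows "riemannian_submersion G (diag_group \<alpha> G) (diag_group \<beta> G) (fibre_metric r) gb"
  unfolding riemannian_submersion_def
proof (intro ballI impI)
  interpret H: reductive_pair G "diag_group \<alpha> G" "off \<alpha>" by (rule reductive_pair_off)
  fix a X Y assume a: "a \<in> G" and X: "X \<in> lie_algebra G" and Y: "Y \<in> lie_algebra G"
    and hor: "horizontal (diag_group \<alpha> G) (diag_group \<beta> G) (fibre_metric r) a (a ** X)"
  let ?s = "sep \<alpha> \<beta>" and ?Z = "proj \<alpha> \<beta> X"
  have Z: "?Z = weigh ?s X" by (rule proj_skew[OF lie_skew[OF X]])
  have "?Z \<in> lie_algebra (diag_group \<alpha> G)"
    using reductive_pair_diag_group[OF finer] by (rule reductive_pair.P_in)
  moreover have ZG: "?Z \<in> lie_algebra G" using calculation by (simp add: lie_diag_group)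
  ultimately have "ip (weigh (fibre_weight r) X) ?Z = 0"
    using hor fibre_metric_tangent[OF r a X ZG] by (simp add: horizontal_def)
  moreover have "ip (weigh l X) ?Z = 0"
  proof -
    have "ip (weigh l X) ?Z = ip X (weigh l ?Z)"
      by (rule ip_weigh[OF class_weight_sym[OF l(1)]])
    also have "weigh l ?Z = 0" using l(3) by (auto simp: Z vec_eq_iff sep_def)
    finally show ?thesis by simp
  qed
  ultimately have "ip ?Z ?Z = 0"
    using r unfolding weigh_fibre_weight Z[symmetric] by (simp add: ip_add_left ip_scaleR_left)
  then have "?Z = 0" by (simp only: ip_skew_eq_0[OF skew_proj])
  then have "weigh (fibre_weight r) X = weigh l X" by (simp add: weigh_fibre_weight Z[symmetric])
  then show "gb (tangent (diag_group \<alpha> G) a (a ** X)) (tangent (diag_group \<alpha> G) a (a ** Y)) =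
      fibre_metric r (tangent (diag_group \<beta> G) a (a ** X)) (tangent (diag_group \<beta> G) a (a ** Y))"
    unfolding fibre_metric_tangent[OF r a X Y] H.base_form_axioms(5)[OF gb X Y a] l(4)[OF X Y] by simp
qed

text \<open>In \<open>[\<Lambda>X, X]\<close> the coefficient of the fibre parameter \<open>r\<close> is \<open>[X\<^sub>\<pp>, X\<^sub>\<nn>]\<close>, so it vanishes
  once two values of \<open>r\<close> give geodesics.\<close>

lemma pi_equigeodesicD:
  assumes "pi_equigeodesic G (diag_group \<alpha> G) (diag_group \<beta> G) gb (Q + N)"
  shows "commutator Q N = 0" "commutator (weigh l N) N = 0"
proof -
  have lQ: "weigh l Q = 0"
    using l(3) Q_zero by (simp add: vec_eq_iff) blast
  have sN: "weigh (sep \<alpha> \<beta>) N = 0"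
    using N_zero by (auto simp: vec_eq_iff sep_def)
  have sQ: "weigh (sep \<alpha> \<beta>) Q = Q" using Q by (simp add: proj_skew[OF skew_Q])
  have "off \<beta> (commutator (weigh (fibre_weight r) (Q + N)) (Q + N)) = 0" if r: "0 < r" for r
  proof -
    have "invariant_metric G (diag_group \<beta> G) (fibre_metric r)"
      unfolding fibre_metric_def by (rule invariant_metric_of[OF fibre_weight[OF r]])
    moreover from this have "geodesic_vector G (diag_group \<beta> G) (fibre_metric r) (Q + N)"
      using assms fibre_metric_submersion[OF r] unfolding pi_equigeodesic_def by blast
    ultimately show ?thesis
      using geodesic_vector_weight[OF _ fibre_weight(1)[OF r] _ off_sum]
        base_form_metric_of[OF fibre_weight(1,2)[OF r]]
      unfolding fibre_metric_def by blast
  qed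
  moreover have "commutator (weigh (fibre_weight r) (Q + N)) (Q + N) =
      commutator (weigh l N) N - weigh l (commutator Q N) + r *\<^sub>R commutator Q N" for r
  proof -
    have "weigh (fibre_weight r) (Q + N) = weigh l N + r *\<^sub>R Q"
      by (simp add: weigh_fibre_weight weigh_add lQ sN sQ)
    moreover have "commutator (weigh l N + r *\<^sub>R Q) (Q + N) =
        commutator (weigh l N) N + commutator (weigh l N) Q + r *\<^sub>R commutator Q N"
      by (simp add: commutator_def scaleR_diff_right scaleR_add_right)
    ultimately show ?thesis by (simp add: commutator_weigh_N_Q)
  qed
  ultimately have *: "off \<beta> (commutator (weigh l N) N - weigh l (commutator Q N) + r *\<^sub>R commutator Q N) = 0"
    if "0 < r" for r using that by simp
  note lin = linear_add[OF linear_proj] linear_diff[OF linear_proj] linear_scale[OF linear_proj]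
  have skewC: "mstar (commutator Q N) = - commutator Q N" by (rule commutator_skew[OF skew_Q skew_N])
  have offC: "off \<beta> (commutator Q N) = commutator Q N"
    using commutator_Q_N_diagonal finer skewC unfolding proj_fixed_iff by blast
  have "off \<beta> (commutator Q N) = 0"
    using *[of 1] *[of 2] unfolding lin by (simp add: scaleR_2 flip: add.assoc)
  then show QN: "commutator Q N = 0" by (simp add: offC)
  have "off \<beta> (commutator (weigh l N) N) = 0"
    using *[of 1] unfolding QN by (simp add: linear_0[OF linear_weigh])
  moreover have "off \<beta> (commutator (weigh l N) N) = commutator (weigh l N) N"
    unfolding proj_fixed_iff
  proof (intro conjI allI)
    show "mstar (commutator (weigh l N) N) = - commutator (weigh l N) N"
      by (rule commutator_skew[OF skew_weigh[OF class_weight_sym[OF l(1)] skew_N] skew_N])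
    \<comment> \<open>\<open>0 = 0\<close> is the condition on the first labelling in
      \<open>proj_fixed_iff\<close>, which is constant for \<open>off\<close>.\<close>
    show "0 = 0 \<and> \<beta> a \<noteq> \<beta> b \<or> commutator (weigh l N) N $ a $ b = 0" for a b
      using commutator_weigh_diagonal[OF l(1) finer, of a b] by (cases "\<beta> a = \<beta> b") simp_all
  qed
  ultimately show "commutator (weigh l N) N = 0" by simp
qed

text \<open>Elementary matrices between different blocks of H are horizontal for every invariant
  metric, so the submersion forces the weight on n to be \<open>l\<close>. On p the weight is one
  scalar, and the commutator splits into multiples and images of the two that are assumed to
  vanish.\<close>

lemma pi_equigeodesicI:
  assumes QN: "commutator Q N = 0" and NN: "commutator (weigh l N) N = 0"
  shows "pi_equigeodesic G (diag_group \<alpha> G) (diag_group \<beta> G) gb (Q + N)"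
  unfolding pi_equigeodesic_def
proof (intro allI impI)
  fix g assume g: "invariant_metric G (diag_group \<beta> G) g"
    and sub: "riemannian_submersion G (diag_group \<alpha> G) (diag_group \<beta> G) g gb"
  from invariant_metric_weight[OF g] obtain m where m: "class_weight \<beta> m"
    "\<And>X Y. X \<in> lie_algebra G \<Longrightarrow> Y \<in> lie_algebra G \<Longrightarrow> base_form (diag_group \<beta> G) g X Y = ip (weigh m X) Y"
    by metis
  note msym = class_weight_sym[OF m(1)]
  have ml: "m a b = l a b" if ab: "\<alpha> a \<noteq> \<alpha> b" for a b
  proof -
    have ne: "a \<noteq> b" using ab by auto
    let ?E = "elem a b (1 :: 'f)"
    have E: "?E \<in> lie_algebra G" by (rule elem_in[OF ne])
    have Ez: "?E $ x $ y = 0" if "\<alpha> x = \<alpha> y" for x y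
    proof -
      have "\<not> (x = a \<and> y = b)" using that ab by blast
      moreover have "\<not> (x = b \<and> y = a)" using that ab by (metis (no_types))
      ultimately show ?thesis by (simp only: elem_def vector_minus_component matrix_unit_nth if_False diff_self)
    qed
    have "ip (weigh m ?E) Z = 0" if "Z \<in> lie_algebra (diag_group \<alpha> G)" for Z
    proof -
      have "inner (?E $ x $ y) (Z $ x $ y) = 0" for x y
        using Ez[of x y] that by (cases "\<alpha> x = \<alpha> y") (auto simp: lie_diag_group block_diagonal_def)
      then show ?thesis
        unfolding weigh_elem[OF msym] by (simp add: ip_scaleR_left ip_skew[OF skew_elem] inner_vec_def)
    qed
    then have "horizontal (diag_group \<alpha> G) (diag_group \<beta> G) g (mat 1) ?E"
      using m(2)[OF E] by (simp add: horizontal_def base_form_def lie_diag_group)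
    then have "base_form (diag_group \<alpha> G) gb ?E ?E = base_form (diag_group \<beta> G) g ?E ?E"
      using sub[unfolded riemannian_submersion_def, THEN bspec, OF mat_1_in, THEN bspec, OF E, THEN bspec, OF E]
      by (simp add: base_form_def)
    then have "l a b * ip ?E ?E = m a b * ip ?E ?E"
      unfolding m(2)[OF E E] l(4)[OF E E] weigh_elem[OF msym] weigh_elem[OF class_weight_sym[OF l(1)]]
      by (simp add: ip_scaleR_left)
    moreover have "?E \<noteq> 0" using elem_nth_same[OF ne, of "1 :: 'f"] by auto
    ultimately show ?thesis by (simp add: ip_skew_eq_0[OF skew_elem])
  qed
  \<comment> \<open>The scalar is the weight at any position of p; symmetry covers the transposed
    position. If there is no such position, \<open>Q\<close> is 0.\<close>
  have "\<exists>r. weigh m Q = r *\<^sub>R Q"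
  proof (cases "\<exists>a b. \<alpha> a = \<alpha> b \<and> \<beta> a \<noteq> \<beta> b")
    case True
    then obtain a b where ab: "\<alpha> a = \<alpha> b" "\<beta> a \<noteq> \<beta> b" by blast
    have "m x y = m a b" if "\<alpha> x = \<alpha> y" "\<beta> x \<noteq> \<beta> y" for x y
      using one_pair[OF that ab]
    proof
      assume "\<beta> x = \<beta> a \<and> \<beta> y = \<beta> b"
      then show ?thesis by (intro class_weight_cong[OF m(1)]) auto
    next
      assume "\<beta> x = \<beta> b \<and> \<beta> y = \<beta> a"
      then have "m x y = m b a" by (intro class_weight_cong[OF m(1)]) auto
      then show ?thesis using msym[of a b] by simp
    qed
    then have "m x y *\<^sub>R Q $ x $ y = m a b *\<^sub>R Q $ x $ y" for x y
      using Q_zero[of x y] by (cases "\<alpha> x = \<alpha> y \<and> \<beta> x \<noteq> \<beta> y") auto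
    then have "weigh m Q = m a b *\<^sub>R Q"
      by (simp add: vec_eq_iff)
    then show ?thesis by blast
  next
    case False
    then have "Q $ a $ b = 0" for a b using Q_zero[of a b] by blast
    then have "Q = 0" by (simp add: vec_eq_iff)
    then show ?thesis by (simp add: linear_0[OF linear_weigh])
  qed
  then obtain r where r: "weigh m Q = r *\<^sub>R Q" ..
  have "m a b *\<^sub>R N $ a $ b = l a b *\<^sub>R N $ a $ b" for a b
    by (cases "\<alpha> a = \<alpha> b") (simp_all only: ml N_zero scaleR_zero_right simp_thms)
  then have "weigh m N = weigh l N" by (simp add: vec_eq_iff)
  moreover have "commutator (r *\<^sub>R Q + weigh l N) (Q + N) =
      commutator (weigh l N) N + commutator (weigh l N) Q + r *\<^sub>R commutator Q N"
    by (simp add: commutator_def scaleR_diff_right scaleR_add_right)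
  ultimately have "commutator (weigh m (Q + N)) (Q + N) = 0"
    by (simp add: weigh_add r QN NN commutator_weigh_N_Q linear_0[OF linear_weigh])
  then show "geodesic_vector G (diag_group \<beta> G) g (Q + N)"
    by (simp add: geodesic_vector_weight[OF g m off_sum] linear_0[OF linear_proj])
qed

theorem pi_equigeodesic_iff:
  "pi_equigeodesic G (diag_group \<alpha> G) (diag_group \<beta> G) gb (Q + N) \<longleftrightarrow>
    commutator Q N = 0 \<and> commutator (weigh l N) N = 0"
  using pi_equigeodesicD pi_equigeodesicI by blast

end

end

section \<open>The three families of groups\<close>

lemma unitary_curve_skew:
  assumes "\<And>t. \<gamma> t \<in> unitary_group" "\<gamma> 0 = mat 1" "(\<gamma> has_vector_derivative D) (at 0)"
  shows "mstar D = - D"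
proof -
  have "bounded_linear (mstar :: 'a^'b^'b \<Rightarrow> _)"
    using linear_mstar by (simp add: linear_conv_bounded_linear)
  from bounded_linear.has_vector_derivative[OF this assms(3)]
  have "((\<lambda>t. mstar (\<gamma> t)) has_vector_derivative mstar D) (at 0)" .
  from matrix_mult_vector_derivative[OF this assms(3)]
  have "((\<lambda>t. mstar (\<gamma> t) ** \<gamma> t) has_vector_derivative D + mstar D) (at 0)"
    by (simp add: assms(2))
  moreover have "(\<lambda>t. mstar (\<gamma> t) ** \<gamma> t) = (\<lambda>_. mat 1)"
    using assms(1) by (simp add: unitary_group_def)
  ultimately have "D + mstar D = 0"
    by (metis has_vector_derivative_const vector_derivative_at)
  then show ?thesis by (simp add: add_eq_0_iff)
qed

lemma skew_mexp_unitary: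
  assumes "mstar D = - D" shows "mexp (t *\<^sub>R D) \<in> unitary_group"
proof -
  have "mstar (mexp (t *\<^sub>R D)) = mexp (- (t *\<^sub>R D))"
    by (simp add: assms mstar_scaleR flip: mexp_mstar)
  then show ?thesis
    using mexp_mult_neg[of "t *\<^sub>R D"] mexp_neg_mult[of "t *\<^sub>R D"] by (simp add: unitary_group_def)
qed

lemma unitary_mult: "A \<in> unitary_group \<Longrightarrow> B \<in> unitary_group \<Longrightarrow> A ** B \<in> unitary_group"
proof -
  assume A: "A \<in> unitary_group" and B: "B \<in> unitary_group"
  have "A ** B ** (mstar B ** mstar A) = A ** (B ** mstar B) ** mstar A"
    "mstar B ** mstar A ** (A ** B) = mstar B ** (mstar A ** A) ** B"
    by (simp_all only: matrix_mul_assoc)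
  with A B show ?thesis by (simp add: unitary_group_def mstar_mult)
qed

text \<open>For an involution the adjoint is again monomial, so the one-sided computation, applied
  to both matrices, gives both unitarity equations over any of the scalars.\<close>

lemma monomial_unitary:
  fixes \<sigma> :: "'n::finite \<Rightarrow> 'n" and \<epsilon> :: "'n \<Rightarrow> 'f::star_scalar"
  assumes inv: "\<And>x. \<sigma> (\<sigma> x) = x" and \<epsilon>: "\<And>x. norm (\<epsilon> x) = 1"
  shows "monomial \<sigma> \<epsilon> \<in> unitary_group"
proof -
  have right: "monomial \<sigma> \<epsilon> ** mstar (monomial \<sigma> \<epsilon>) = mat 1" if "\<And>x. norm (\<epsilon> x) = 1" for \<epsilon> :: "'n \<Rightarrow> 'f"
  proof -
    have eq: "\<sigma> x = \<sigma> y \<longleftrightarrow> x = y" for x y by (metis inv)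
    show ?thesis
      unfolding vec_eq_iff using monomial_conj_nth[of \<sigma> \<epsilon> "mat 1", unfolded matrix_mul_rid] that
      by (simp add: mat_def eq mult_cj)
  qed
  have "mstar (monomial \<sigma> \<epsilon>) = monomial \<sigma> (\<lambda>x. cj (\<epsilon> (\<sigma> x)))"
  proof -
    have "x = \<sigma> y \<longleftrightarrow> y = \<sigma> x" for x y by (metis inv)
    then show ?thesis
      by (simp add: vec_eq_iff mstar_nth monomial_def inv)
  qed
  then show ?thesis
    unfolding unitary_group_def using right[of \<epsilon>] right[of "\<lambda>x. cj (\<epsilon> (\<sigma> x))"] \<epsilon>
    by (metis (mono_tags, lifting) mem_Collect_eq mstar_mstar norm_cj)
qed

lemma torus_unitary:
  "norm z = 1 \<Longrightarrow> monomial id (\<lambda>x. if x = a then z else if x = c then cj z else 1) \<in> unitary_group"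
  by (rule monomial_unitary) simp_all

lemma rotation_unitary:
  "monomial (Transposition.transpose a b) (\<lambda>x. if x = a then - 1 else 1) \<in> unitary_group"
  by (rule monomial_unitary) simp_all

lemma classical_group_Sp:
  assumes "5 \<le> CARD('n::finite)"
  shows "classical_group (Sp_group :: (quat^'n^'n) set)"
proof
  show "mat 1 \<in> (Sp_group :: (quat^'n^'n) set)" by (simp add: Sp_group_def unitary_group_def)
  show "A ** B \<in> Sp_group" if "A \<in> Sp_group" "B \<in> Sp_group" for A B :: "quat^'n^'n"
    using that unitary_mult by (simp add: Sp_group_def)
  show "mstar A \<in> Sp_group" "mstar A ** A = mat 1" if "A \<in> Sp_group" for A :: "quat^'n^'n"
    using that by (simp_all add: Sp_group_def unitary_group_def)
  show "D \<in> lie_algebra Sp_group"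
    if "\<And>t. \<gamma> t \<in> Sp_group" "\<gamma> 0 = mat 1" "(\<gamma> has_vector_derivative D) (at 0)" for \<gamma> and D :: "quat^'n^'n"
    using skew_mexp_unitary[OF unitary_curve_skew[OF that[unfolded Sp_group_def]]]
    by (simp add: lie_algebra_def Sp_group_def)
  show "X \<in> lie_algebra Sp_group" if "mstar X = - X" for X :: "quat^'n^'n"
    using skew_mexp_unitary[OF that] by (simp add: lie_algebra_def Sp_group_def)
qed (use assms torus_unitary rotation_unitary in \<open>simp_all add: Sp_group_def\<close>)

text \<open>Jacobi's formula at the identity. In the Leibniz expansion a permutation other than the
  identity moves at least two indices, so after one factor is differentiated a zero off-diagonal
  entry still remains.\<close>

lemma det_derivative:
  fixes \<gamma> :: "real \<Rightarrow> 'f::{star_scalar, real_normed_field}^'n^'n"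
  assumes \<gamma>: "(\<gamma> has_vector_derivative D) (at t0)" "\<gamma> t0 = mat 1"
  shows "((\<lambda>t. det (\<gamma> t)) has_vector_derivative trace D) (at t0)"
proof -
  have entry: "((\<lambda>t. \<gamma> t $ i $ j) has_derivative (\<lambda>h. h *\<^sub>R D $ i $ j)) (at t0)" for i j
    using bounded_linear.has_vector_derivative[OF linear_entry[unfolded linear_conv_bounded_linear] \<gamma>(1), of i j]
    by (simp add: has_vector_derivative_def)
  let ?S = "{p. p permutes (UNIV :: 'n set)}"
  have "((\<lambda>t. det (\<gamma> t)) has_derivative (\<lambda>h. \<Sum>p\<in>?S. of_int (sign p) *
      (\<Sum>i\<in>UNIV. (h *\<^sub>R D $ i $ p i) * (\<Prod>j\<in>UNIV - {i}. \<gamma> t0 $ j $ p j)))) (at t0)"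
    unfolding det_def
    by (intro has_derivative_sum has_derivative_mult_right has_derivative_prod entry)
  moreover have "(\<Sum>p\<in>?S. of_int (sign p) *
      (\<Sum>i\<in>UNIV. (h *\<^sub>R D $ i $ p i) * (\<Prod>j\<in>UNIV - {i}. \<gamma> t0 $ j $ p j))) = h *\<^sub>R trace D" for h
  proof -
    have z: "(\<Prod>j\<in>UNIV - {i}. (mat 1 :: 'f^'n^'n) $ j $ p j) = 0" if p: "p permutes UNIV" "p \<noteq> id" for p and i :: 'n
    proof -
      obtain j where j: "p j \<noteq> j" using p(2) by (auto simp: fun_eq_iff)
      have inj: "inj p" using p(1) by (rule permutes_inj)
      then have "p (p j) \<noteq> p j" using j by (auto dest: injD)
      then obtain j' where "j' \<noteq> i" "p j' \<noteq> j'" using j by metis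
      then show ?thesis
        by (intro prod_zero) (auto simp: mat_def intro!: bexI[of _ j'])
    qed
    have "(\<Sum>p\<in>?S. of_int (sign p) *
        (\<Sum>i\<in>UNIV. (h *\<^sub>R D $ i $ p i) * (\<Prod>j\<in>UNIV - {i}. \<gamma> t0 $ j $ p j))) =
        (\<Sum>p\<in>{id}. of_int (sign p) *
        (\<Sum>i\<in>UNIV. (h *\<^sub>R D $ i $ p i) * (\<Prod>j\<in>UNIV - {i}. \<gamma> t0 $ j $ p j)))"
    proof (rule sum.mono_neutral_right)
      show "\<forall>p\<in>?S - {id}. of_int (sign p) *
        (\<Sum>i\<in>UNIV. (h *\<^sub>R D $ i $ p i) * (\<Prod>j\<in>UNIV - {i}. \<gamma> t0 $ j $ p j)) = 0"
      proof
        fix p assume "p \<in> ?S - {id}"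
        then have "(\<Prod>j\<in>UNIV - {i}. \<gamma> t0 $ j $ p j) = 0" for i
          unfolding \<gamma>(2) by (intro z) auto
        then show "of_int (sign p) *
            (\<Sum>i\<in>UNIV. (h *\<^sub>R D $ i $ p i) * (\<Prod>j\<in>UNIV - {i}. \<gamma> t0 $ j $ p j)) = 0"
          by (simp only: mult_zero_right sum.neutral_const)
      qed
    qed (simp_all add: permutes_id)
    also have "\<dots> = (\<Sum>i\<in>UNIV. h *\<^sub>R D $ i $ i)"
      by (simp add: \<gamma>(2) mat_def sign_id)
    finally show ?thesis by (simp add: trace_def scaleR_sum_right)
  qed
  ultimately show ?thesis by (simp add: has_vector_derivative_def)
qed

text \<open>Writing exp(sD) as exp(tD) exp((s - t)D) moves each derivative to the identity, where it
  is the trace; so the determinant is constant along the one-parameter group.\<close>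

lemma det_mexp_traceless:
  fixes D :: "'f::{star_scalar, real_normed_field}^'n^'n"
  assumes "trace D = 0" shows "det (mexp (t *\<^sub>R D)) = 1"
proof -
  let ?f = "\<lambda>t. det (mexp (t *\<^sub>R D))"
  have "(?f has_vector_derivative 0) (at t within UNIV)" for t
  proof -
    have "((\<lambda>s. (s - t) *\<^sub>R D) has_vector_derivative D) (at t)"
      by (auto intro!: derivative_eq_intros simp: has_vector_derivative_def)
    from mexp_has_vector_derivative[OF this]
    have "((\<lambda>s. mexp ((s - t) *\<^sub>R D)) has_vector_derivative D) (at t)" by simp
    from det_derivative[OF this] assms
    have "((\<lambda>s. det (mexp ((s - t) *\<^sub>R D))) has_vector_derivative 0) (at t)" by simp
    from bounded_linear.has_vector_derivative[OF bounded_linear_mult_right this, of "?f t"]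
    have "((\<lambda>s. ?f t * det (mexp ((s - t) *\<^sub>R D))) has_vector_derivative 0) (at t)" by simp
    moreover have "?f t * det (mexp ((s - t) *\<^sub>R D)) = ?f s" for s
      using mexp_add_line[of t "s - t" D] by (simp add: det_mul[symmetric])
    ultimately show ?thesis by simp
  qed
  then obtain c where "\<And>t. ?f t = c"
    using has_vector_derivative_zero_constant[of UNIV ?f] by auto
  from this[of t] this[of 0] show ?thesis by simp
qed

lemma det_torus:
  fixes z :: "'f::{star_scalar, real_normed_field}" and a c :: "'n::finite"
  assumes "a \<noteq> c" "norm z = 1"
  shows "det (monomial id (\<lambda>x. if x = a then z else if x = c then cj z else 1) :: 'f^'n^'n) = 1"
proof -
  let ?e = "\<lambda>x. if x = a then z else if x = c then cj z else 1"
  have "det (monomial id ?e) = prod ?e UNIV"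
    by (subst det_diagonal) (auto simp: monomial_def)
  also have "\<dots> = prod ?e {a, c}"
    by (rule prod.mono_neutral_right) auto
  also have "\<dots> = z * cj z" using assms(1) by simp
  finally show ?thesis using assms(2) by (simp add: mult_cj)
qed

lemma det_rotation:
  fixes a b :: "'n::finite"
  assumes "a \<noteq> b"
  shows "det (monomial (Transposition.transpose a b) (\<lambda>x. if x = a then - 1 else 1) ::
    'f::{star_scalar, real_normed_field}^'n^'n) = 1"
proof -
  let ?s = "Transposition.transpose a b"
  \<comment> \<open>The -1 stands at \<open>b\<close> because row \<open>a\<close> of the permuted
    matrix is row \<open>b\<close> of the diagonal one; the sign of the transposition cancels it in
    the determinant.\<close>
  let ?e = "\<lambda>x. if x = b then - 1 else (1 :: 'f)"
  let ?D = "monomial id ?e :: 'f^'n^'n"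
  have "?s x = b \<longleftrightarrow> x = a" for x
    by (metis Transposition.transpose_apply_first Transposition.transpose_involutory)
  then have "monomial ?s (\<lambda>x. if x = a then - 1 else 1) = (\<chi> x. ?D $ ?s x)"
    by (simp add: vec_eq_iff monomial_def)
  then have "det (monomial ?s (\<lambda>x. if x = a then - 1 else 1) :: 'f^'n^'n) = of_int (sign ?s) * det ?D"
    using det_permute_rows[of ?s ?D] by (simp add: permutes_swap_id)
  moreover have "det ?D = prod ?e UNIV"
    by (subst det_diagonal) (auto simp: monomial_def)
  moreover have "prod ?e UNIV = prod ?e {b}"
    by (rule prod.mono_neutral_right) auto
  ultimately show ?thesis using assms by (simp add: sign_swap_id)
qed

text \<open>The field sort makes the determinant available. Velocities of curves at the identity are
  skew and traceless, and such matrices exponentiate back into the group.\<close>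

lemma classical_group_special:
  assumes "5 \<le> CARD('n::finite)"
  shows "classical_group {A \<in> unitary_group :: ('f::{star_scalar, real_normed_field}^'n^'n) set. det A = 1}"
    (is "classical_group ?G")
proof
  show "mat 1 \<in> ?G" by (simp add: unitary_group_def)
  show "A ** B \<in> ?G" if "A \<in> ?G" "B \<in> ?G" for A B
    using that by (simp add: unitary_mult det_mul)
  show "mstar A \<in> ?G" if "A \<in> ?G" for A
  proof -
    have "det (A ** mstar A) = 1" using that by (simp add: unitary_group_def)
    then show ?thesis using that by (simp add: unitary_group_def det_mul)
  qed
  show "mstar A ** A = mat 1" if "A \<in> ?G" for A
    using that by (simp add: unitary_group_def)
  have lie: "X \<in> lie_algebra ?G" if "mstar X = - X" "trace X = 0" for X
    using skew_mexp_unitary[OF that(1)] det_mexp_traceless[OF that(2)] by (simp add: lie_algebra_def)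
  show "D \<in> lie_algebra ?G"
    if \<gamma>: "\<And>t. \<gamma> t \<in> ?G" "\<gamma> 0 = mat 1" "(\<gamma> has_vector_derivative D) (at 0)" for \<gamma> D
  proof (rule lie)
    have U: "\<gamma> t \<in> unitary_group" "det (\<gamma> t) = 1" for t using \<gamma>(1)[of t] by simp_all
    show "mstar D = - D" by (rule unitary_curve_skew[OF U(1) \<gamma>(2,3)])
    have "((\<lambda>t. 1) has_vector_derivative trace D) (at 0)"
      using det_derivative[OF \<gamma>(3,2)] by (simp add: U(2))
    then show "trace D = 0" by (metis has_vector_derivative_const vector_derivative_at)
  qed
  show "X \<in> lie_algebra ?G" if "mstar X = - X" "\<And>a. X $ a $ a = 0" for X
    using that by (intro lie) (simp_all add: trace_def)
qed (use assms torus_unitary rotation_unitary in \<open>simp_all add: det_torus det_rotation\<close>)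

section \<open>Blocks\<close>

lemma block_nth: "block d X i j $ a $ b = (if blk d a = i \<and> blk d b = j then X $ a $ b else 0)"
  by (simp add: block_def)

lemma block_subgroup_eq: "block_subgroup d G = diag_group (blk d) G"
  by (simp add: block_subgroup_def diag_group_def block_diagonal_def)

lemma blk_exists:
  assumes "CARD('n::{finite,linorder}) = (\<Sum>i=1..s. d i)"
  shows "card {b. b \<le> (a :: 'n)} \<le> (\<Sum>k=1..s. d k)"
  using card_mono[of UNIV "{b. b \<le> a}"] assms by simp

lemma blk_pos:
  assumes "CARD('n::{finite,linorder}) = (\<Sum>i=1..s. d i)"
  shows "1 \<le> blk d (a :: 'n)" "blk d a \<le> s"
proof -
  have "card {b. b \<le> a} \<le> (\<Sum>k=1..blk d a. d k)"
    unfolding blk_def by (rule LeastI[of _ s]) (rule blk_exists[OF assms])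
  moreover have "0 < card {b. b \<le> a}"
    by (rule card_gt_0_iff[THEN iffD2]) auto
  ultimately show "1 \<le> blk d a" by (cases "blk d a") auto
  show "blk d a \<le> s"
    unfolding blk_def by (rule Least_le) (rule blk_exists[OF assms])
qed

text \<open>Merging removes the boundary between the first two intervals, so partial sums shift by
  one index.\<close>

lemma sum_merge12: "1 \<le> i \<Longrightarrow> (\<Sum>k=1..i. merge12 d k) = (\<Sum>k=1..i+1. d k)"
proof (induction i rule: nat_induct_at_least)
  case base
  then show ?case by (simp add: merge12_def numeral_2_eq_2)
next
  case (Suc i)
  then show ?case by (simp add: merge12_def)
qed

text \<open>\<open>blk\<close> is the least index whose partial sum reaches the rank of
  \<open>a\<close>; by the shift of partial sums, labels 1 and 2 become 1 and later labels drop by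
  one.\<close>

lemma blk_merge12:
  assumes "CARD('n::{finite,linorder}) = (\<Sum>i=1..s. d i)"
  shows "blk (merge12 d) (a :: 'n) = (if blk d a \<le> 1 then 1 else blk d a - 1)"
proof -
  let ?c = "card {b. b \<le> a}"
  have c: "0 < ?c" by (rule card_gt_0_iff[THEN iffD2]) auto
  have le: "?c \<le> (\<Sum>k=1..blk d a. d k)"
    unfolding blk_def by (rule LeastI[of _ s]) (rule blk_exists[OF assms])
  have least: "blk d a \<le> i" if "?c \<le> (\<Sum>k=1..i. d k)" for i
    unfolding blk_def using that by (rule Least_le)
  let ?m = "if blk d a \<le> 1 then 1 else blk d a - 1"
  show ?thesis
    unfolding blk_def[of "merge12 d"]
  proof (rule Least_equality)
    have "?c \<le> (\<Sum>k=1..?m + 1. d k)"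
      by (rule order_trans[OF le]) (rule sum_mono2; auto)
    then show "?c \<le> (\<Sum>k=1..?m. merge12 d k)" by (subst sum_merge12) auto
  next
    fix i assume i: "?c \<le> (\<Sum>k=1..i. merge12 d k)"
    then have "1 \<le> i" using c by (cases i) auto
    with i have "?c \<le> (\<Sum>k=1..i+1. d k)" by (simp only: sum_merge12)
    then have "blk d a \<le> i + 1" by (rule least)
    with \<open>1 \<le> i\<close> show "?m \<le> i" by auto
  qed
qed

lemma mstar_block: "mstar (block d X i j) = block d (mstar X) j i"
  by (simp add: vec_eq_iff mstar_nth block_nth)

lemma block_minus: "block d (- X) i j = - block d X i j"
  and block_add: "block d (X + Y) i j = block d X i j + block d Y i j"
  and block_diff: "block d (X - Y) i j = block d X i j - block d Y i j"
  by (simp_all add: vec_eq_iff block_nth)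

lemma block_skew: "mstar X = - X \<Longrightarrow> block d X j i = - mstar (block d X i j)"
  by (simp add: mstar_block block_minus)

lemma block_eq_0_iff: "block d X i j = 0 \<longleftrightarrow> (\<forall>a b. blk d a = i \<longrightarrow> blk d b = j \<longrightarrow> X $ a $ b = 0)"
  by (auto simp: vec_eq_iff block_nth)

text \<open>\<open>\<beta>\<close> labels the blocks of K and \<open>\<alpha>\<close> those of H; as
  parameters they fit the labelled groups above.\<close>

locale block_structure =
  fixes d :: "nat \<Rightarrow> nat" and s :: nat and \<beta> \<alpha> :: "'n::{finite,linorder} \<Rightarrow> nat"
  assumes s: "3 \<le> s" and card: "CARD('n) = (\<Sum>i=1..s. d i)"
    and \<beta>_def: "\<beta> = blk d" and \<alpha>_def: "\<alpha> = blk (merge12 d)"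
begin

lemma \<beta>_range: "\<beta> a \<in> {1..s}" "1 \<le> \<beta> a" "\<beta> a \<le> s"
  using blk_pos[OF card, of a] by (simp_all add: \<beta>_def)

lemma \<alpha>_eq_iff: "\<alpha> a = \<alpha> b \<longleftrightarrow> \<beta> a = \<beta> b \<or> \<beta> a \<le> 2 \<and> \<beta> b \<le> 2"
  using \<beta>_range(2)[of a] \<beta>_range(2)[of b] unfolding \<alpha>_def \<beta>_def blk_merge12[OF card] by auto

lemma finer: "\<beta> a = \<beta> b \<Longrightarrow> \<alpha> a = \<alpha> b"
  by (simp add: \<alpha>_eq_iff)

lemma one_pair:
  "\<alpha> a = \<alpha> b \<Longrightarrow> \<beta> a \<noteq> \<beta> b \<Longrightarrow> \<alpha> c = \<alpha> d' \<Longrightarrow> \<beta> c \<noteq> \<beta> d' \<Longrightarrow>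
    \<beta> a = \<beta> c \<and> \<beta> b = \<beta> d' \<or> \<beta> a = \<beta> d' \<and> \<beta> b = \<beta> c"
  using \<beta>_range(2)[of a] \<beta>_range(2)[of b] \<beta>_range(2)[of c] \<beta>_range(2)[of d'] unfolding \<alpha>_eq_iff by linarith

lemma two_blocks: "\<alpha> a = \<alpha> b \<Longrightarrow> \<alpha> b = \<alpha> c \<Longrightarrow> \<beta> a = \<beta> b \<or> \<beta> b = \<beta> c \<or> \<beta> a = \<beta> c"
  using \<beta>_range(2)[of a] \<beta>_range(2)[of b] \<beta>_range(2)[of c] unfolding \<alpha>_eq_iff by linarith

lemma block_nth: "block d X i j $ a $ b = (if \<beta> a = i \<and> \<beta> b = j then X $ a $ b else 0)"
  unfolding \<beta>_def by (rule block_nth)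

lemma block_eq_0_iff: "block d X i j = 0 \<longleftrightarrow> (\<forall>a b. \<beta> a = i \<longrightarrow> \<beta> b = j \<longrightarrow> X $ a $ b = 0)"
  unfolding \<beta>_def by (rule block_eq_0_iff)

lemma mm_proj_nth:
  assumes "i \<noteq> j"
  shows "mm_proj d i j X $ a $ b = (if \<beta> a = i \<and> \<beta> b = j \<or> \<beta> a = j \<and> \<beta> b = i then X $ a $ b else 0)"
proof (cases "\<beta> a = i \<and> \<beta> b = j")
  case True
  then show ?thesis using assms by (simp add: mm_proj_def block_nth)
next
  case False
  then show ?thesis unfolding mm_proj_def vector_add_component block_nth by (simp only: if_False add_0_left simp_thms)
qed

lemma mm_iff:
  assumes "1 \<le> i" "i < j" "j \<le> s"
  shows "X \<in> mm d s i j \<longleftrightarrow> mstar X = - X \<and>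
    (\<forall>a b. \<beta> a = i \<and> \<beta> b = j \<or> \<beta> a = j \<and> \<beta> b = i \<or> X $ a $ b = 0)"
proof
  assume X: "X \<in> mm d s i j"
  have z: "X $ a $ b = 0" if "\<not> (\<beta> a = i \<and> \<beta> b = j)" "\<not> (\<beta> a = j \<and> \<beta> b = i)" for a b
  proof -
    have "(\<beta> a, \<beta> b) \<notin> {(i, j), (j, i)}" using that by blast
    then have "block d X (\<beta> a) (\<beta> b) = 0" using X \<beta>_range(1) unfolding mm_def by blast
    then show ?thesis unfolding block_eq_0_iff by blast
  qed
  have e: "X $ a $ b = - cj (X $ b $ a)" if "\<beta> a = j" "\<beta> b = i" for a b
  proof -
    have "block d X j i = - mstar (block d X i j)" using X unfolding mm_def by blast
    then have "block d X j i $ a $ b = - cj (block d X i j $ b $ a)" by (simp add: mstar_nth)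
    then show ?thesis by (simp add: block_nth that)
  qed
  have e': "X $ a $ b = - cj (X $ b $ a)" if "\<beta> a = i" "\<beta> b = j" for a b
    using e[OF that(2,1)] by (simp add: cj_cj)
  have "mstar X $ a $ b = - X $ a $ b" for a b
  proof -
    consider "\<beta> a = i \<and> \<beta> b = j" | "\<beta> a = j \<and> \<beta> b = i"
      | "\<not> (\<beta> a = i \<and> \<beta> b = j)" "\<not> (\<beta> a = j \<and> \<beta> b = i)" by blast
    then show ?thesis
    proof cases
      case 1
      then show ?thesis using e'[of a b] by (simp add: mstar_nth)
    next
      case 2
      then show ?thesis using e[of a b] by (simp add: mstar_nth)
    next
      case 3
      then have "X $ a $ b = 0" "X $ b $ a = 0" by (blast intro: z)+
      then show ?thesis by (simp add: mstar_nth)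
    qed
  qed
  then have "mstar X = - X" by (simp add: vec_eq_iff)
  then show "mstar X = - X \<and> (\<forall>a b. \<beta> a = i \<and> \<beta> b = j \<or> \<beta> a = j \<and> \<beta> b = i \<or> X $ a $ b = 0)"
    using z by blast
next
  assume X: "mstar X = - X \<and> (\<forall>a b. \<beta> a = i \<and> \<beta> b = j \<or> \<beta> a = j \<and> \<beta> b = i \<or> X $ a $ b = 0)"
  have "block d X k l = 0" if "(k, l) \<notin> {(i, j), (j, i)}" for k l
    unfolding block_eq_0_iff using X that by blast
  moreover have "block d X j i = - mstar (block d X i j)"
    by (rule block_skew) (use X in blast)
  ultimately show "X \<in> mm d s i j"
    unfolding mm_def by (intro CollectI conjI ballI impI)
qed

lemma pp_iff: "X \<in> pp d s \<longleftrightarrow> proj \<alpha> \<beta> X = X"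
proof -
  have "(\<alpha> a = \<alpha> b \<and> \<beta> a \<noteq> \<beta> b) \<longleftrightarrow> (\<beta> a = 1 \<and> \<beta> b = 2 \<or> \<beta> a = 2 \<and> \<beta> b = 1)" for a b
    using \<beta>_range(2)[of a] \<beta>_range(2)[of b] unfolding \<alpha>_eq_iff by linarith
  then show ?thesis
    using s unfolding pp_def proj_fixed_iff by (subst mm_iff) auto
qed

text \<open>The fixed points of \<open>off \<alpha>\<close> form a subspace containing every
  summand. Conversely each nonzero entry of such a matrix belongs to exactly one
  \<open>mm_proj\<close>, so the matrix is the sum of these components.\<close>

lemma nn_iff:
  fixes X :: "('f::star_scalar, 'n) sqmat"
  shows "X \<in> nn d s \<longleftrightarrow> off \<alpha> X = X"
proof
  let ?I = "{(i, j). 1 \<le> i \<and> i < j \<and> j \<le> s \<and> (i, j) \<noteq> (1, 2)}"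
  have sub: "subspace {X :: ('f, 'n) sqmat. off \<alpha> X = X}"
    by (simp add: subspace_def linear_0[OF linear_proj] linear_add[OF linear_proj] linear_scale[OF linear_proj])
  have "mm d s i j \<subseteq> {X :: ('f, 'n) sqmat. off \<alpha> X = X}" if "(i, j) \<in> ?I" for i j
  proof
    fix X :: "('f, 'n) sqmat" assume X: "X \<in> mm d s i j"
    have ij: "1 \<le> i" "i < j" "j \<le> s" "3 \<le> j" using that by auto
    have "\<alpha> a \<noteq> \<alpha> b \<or> X $ a $ b = 0" for a b
    proof -
      have "\<beta> a = i \<and> \<beta> b = j \<or> \<beta> a = j \<and> \<beta> b = i \<or> X $ a $ b = 0"
        using X unfolding mm_iff[OF ij(1-3)] by blast
      then show ?thesis using ij(2,4) unfolding \<alpha>_eq_iff by linarith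
    qed
    then show "X \<in> {X :: ('f, 'n) sqmat. off \<alpha> X = X}"
      using X unfolding mm_iff[OF ij(1-3)] proj_fixed_iff by auto
  qed
  then have "nn d s \<subseteq> {X :: ('f, 'n) sqmat. off \<alpha> X = X}"
    unfolding nn_def by (intro span_minimal sub) blast
  then show "X \<in> nn d s \<Longrightarrow> off \<alpha> X = X" by blast
next
  let ?I = "{(i, j). 1 \<le> i \<and> i < j \<and> j \<le> s \<and> (i, j) \<noteq> (1, 2)}"
  assume "off \<alpha> X = X"
  then have skew: "mstar X = - X" and z: "\<And>a b. \<alpha> a = \<alpha> b \<Longrightarrow> X $ a $ b = 0"
    unfolding proj_fixed_iff by blast+
  have fin: "finite ?I" by (rule finite_subset[of _ "{1..s} \<times> {1..s}"]) auto
  let ?p = "\<lambda>q. mm_proj d (fst q) (snd q) X"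
  have mem: "?p q \<in> nn d s" if "q \<in> ?I" for q
  proof -
    obtain i j where q: "q = (i, j)" by (cases q)
    have ij: "1 \<le> i" "i < j" "j \<le> s" using that q by auto
    have "mm_proj d i j X \<in> mm d s i j"
      unfolding mm_iff[OF ij]
    proof (intro conjI allI)
      show "mstar (mm_proj d i j X) = - mm_proj d i j X"
        by (simp add: mm_proj_def mstar_add mstar_block skew block_minus)
      show "\<beta> a = i \<and> \<beta> b = j \<or> \<beta> a = j \<and> \<beta> b = i \<or> mm_proj d i j X $ a $ b = 0" for a b
        unfolding mm_proj_nth[OF less_imp_neq[OF ij(2)]] by (simp only: split: if_split) blast
    qed
    then show ?thesis unfolding nn_def q using that q by (intro span_base) auto
  qed
  have "X $ a $ b = (\<Sum>q\<in>?I. ?p q $ a $ b)" for a b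
  proof (cases "\<alpha> a = \<alpha> b")
    case True
    have "?p q $ a $ b = 0" for q
      unfolding mm_proj_def vector_add_component block_nth z[OF True] by (simp only: if_cancel add_0_left)
    then show ?thesis using z[OF True] by simp
  next
    case False
    \<comment> \<open>The label pair of the entry in increasing order: the only summand that
      contains this entry.\<close>
    define q0 where "q0 = (min (\<beta> a) (\<beta> b), max (\<beta> a) (\<beta> b))"
    have ne: "\<beta> a \<noteq> \<beta> b" using False finer by blast
    have q0: "q0 \<in> ?I"
      using False ne \<beta>_range[of a] \<beta>_range[of b] unfolding \<alpha>_eq_iff q0_def by (auto simp: min_def max_def)
    have "?p q $ a $ b = (if q = q0 then X $ a $ b else 0)" if qI: "q \<in> ?I" for q
    proof -
      obtain i j where q: "q = (i, j)" "i < j" using qI by auto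
      then have "q = q0 \<longleftrightarrow> (\<beta> a = i \<and> \<beta> b = j \<or> \<beta> a = j \<and> \<beta> b = i)"
        using ne unfolding q0_def by (auto simp: min_def max_def)
      then show ?thesis using mm_proj_nth[OF less_imp_neq[OF q(2)]] unfolding q(1) fst_conv snd_conv by (simp only:)
    qed
    then have "(\<Sum>q\<in>?I. ?p q $ a $ b) = (\<Sum>q\<in>?I. if q = q0 then X $ a $ b else 0)"
      by (rule sum.cong[OF refl])
    then show ?thesis using q0 fin by simp
  qed
  then have "X = (\<Sum>q\<in>?I. ?p q)" by (simp add: vec_eq_iff)
  moreover have "(\<Sum>q\<in>?I. ?p q) \<in> nn d s"
    by (rule subspace_sum[OF _ mem]) (simp_all only: nn_def subspace_span)
  ultimately show "X \<in> nn d s" by simp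
qed

text \<open>The coefficients of the base metric as one symmetric function of two labels.
  \<open>\<nu>\<close> carries meaning only for increasing arguments, hence min and max; labels 1
  and 2 share \<open>\<mu>\<close> because they form one block of H.\<close>

definition level_weight :: "(nat \<Rightarrow> real) \<Rightarrow> (nat \<Rightarrow> nat \<Rightarrow> real) \<Rightarrow> nat \<Rightarrow> nat \<Rightarrow> real" where
  "level_weight \<mu> \<nu> i j = (if i = j \<or> i \<le> 2 \<and> j \<le> 2 then 0 else if i \<le> 2 then \<mu> j else if j \<le> 2 then \<mu> i
    else \<nu> (min i j) (max i j))"

text \<open>An entry outside the blocks of H occurs in exactly one summand: in the first sum if one
  label is at most 2, otherwise in the second.\<close>

lemma diagonal_operator_eq:
  "diagonal_operator d s \<mu> \<nu> X = weigh (\<lambda>a b. level_weight \<mu> \<nu> (\<beta> a) (\<beta> b)) X"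
proof -
  let ?J = "{(i, j). 3 \<le> i \<and> i < j \<and> j \<le> s}"
  have fin: "finite ?J" by (rule finite_subset[of _ "{1..s} \<times> {1..s}"]) auto
  have "diagonal_operator d s \<mu> \<nu> X $ a $ b = level_weight \<mu> \<nu> (\<beta> a) (\<beta> b) *\<^sub>R X $ a $ b" for a b
  proof -
    let ?x = "X $ a $ b"
    have S1: "(\<Sum>r=3..s. \<mu> r *\<^sub>R (mm_proj d 1 r X + mm_proj d 2 r X)) $ a $ b =
        (\<Sum>r=3..s. if \<beta> a \<le> 2 \<and> \<beta> b = r \<or> \<beta> b \<le> 2 \<and> \<beta> a = r then \<mu> r *\<^sub>R ?x else 0)"
      unfolding sum_component
    proof (rule sum.cong[OF refl])
      fix r assume r: "r \<in> {3..s}"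
      have "\<beta> a \<le> 2 \<longleftrightarrow> \<beta> a = 1 \<or> \<beta> a = 2" "\<beta> b \<le> 2 \<longleftrightarrow> \<beta> b = 1 \<or> \<beta> b = 2"
        using \<beta>_range(2)[of a] \<beta>_range(2)[of b] by auto
      then show "(\<mu> r *\<^sub>R (mm_proj d 1 r X + mm_proj d 2 r X)) $ a $ b =
          (if \<beta> a \<le> 2 \<and> \<beta> b = r \<or> \<beta> b \<le> 2 \<and> \<beta> a = r then \<mu> r *\<^sub>R ?x else 0)"
        using r unfolding vector_scaleR_component vector_add_component
        by (subst (1 2) mm_proj_nth) (auto simp del: One_nat_def)
    qed
    have S2: "(\<Sum>(i, j)\<in>?J. \<nu> i j *\<^sub>R mm_proj d i j X) $ a $ b =
        (\<Sum>q\<in>?J. if q = (min (\<beta> a) (\<beta> b), max (\<beta> a) (\<beta> b)) then \<nu> (fst q) (snd q) *\<^sub>R ?x else 0)"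
      unfolding sum_component
    proof (rule sum.cong[OF refl])
      fix q assume "q \<in> ?J"
      then obtain i j where q: "q = (i, j)" "i < j" by auto
      then have e: "(i, j) = (min (\<beta> a) (\<beta> b), max (\<beta> a) (\<beta> b)) \<longleftrightarrow> (\<beta> a = i \<and> \<beta> b = j \<or> \<beta> a = j \<and> \<beta> b = i)"
        by (auto simp: min_def max_def)
      show "(case q of (i, j) \<Rightarrow> \<nu> i j *\<^sub>R mm_proj d i j X) $ a $ b =
          (if q = (min (\<beta> a) (\<beta> b), max (\<beta> a) (\<beta> b)) then \<nu> (fst q) (snd q) *\<^sub>R ?x else 0)"
        unfolding q(1) case_prod_conv fst_conv snd_conv vector_scaleR_component mm_proj_nth[OF less_imp_neq[OF q(2)]] e
        by (simp only: if_distrib[of "scaleR (\<nu> i j)"] scaleR_zero_right)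
    qed
    have S2': "(\<Sum>q\<in>?J. if q = (min (\<beta> a) (\<beta> b), max (\<beta> a) (\<beta> b)) then \<nu> (fst q) (snd q) *\<^sub>R ?x else 0) =
        (if 3 \<le> \<beta> a \<and> 3 \<le> \<beta> b \<and> \<beta> a \<noteq> \<beta> b then \<nu> (min (\<beta> a) (\<beta> b)) (max (\<beta> a) (\<beta> b)) *\<^sub>R ?x else 0)"
      using fin \<beta>_range(3)[of a] \<beta>_range(3)[of b] by (auto simp: sum.delta min_def max_def)
    have S1': "(\<Sum>r=3..s. if \<beta> a \<le> 2 \<and> \<beta> b = r \<or> \<beta> b \<le> 2 \<and> \<beta> a = r then \<mu> r *\<^sub>R ?x else 0) =
        (if \<beta> a \<le> 2 \<and> 3 \<le> \<beta> b then \<mu> (\<beta> b) *\<^sub>R ?x else if \<beta> b \<le> 2 \<and> 3 \<le> \<beta> a then \<mu> (\<beta> a) *\<^sub>R ?x else 0)"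
    proof -
      consider "\<beta> a \<le> 2 \<and> 3 \<le> \<beta> b" | "\<beta> b \<le> 2 \<and> 3 \<le> \<beta> a" | "\<beta> a \<le> 2 \<and> \<beta> b \<le> 2" | "3 \<le> \<beta> a \<and> 3 \<le> \<beta> b" by linarith
      then show ?thesis
      proof cases
        case 1
        then have "(\<beta> a \<le> 2 \<and> \<beta> b = r \<or> \<beta> b \<le> 2 \<and> \<beta> a = r) \<longleftrightarrow> r = \<beta> b" for r by auto
        then show ?thesis using 1 \<beta>_range(3)[of b] by simp
      next
        case 2
        then have "(\<beta> a \<le> 2 \<and> \<beta> b = r \<or> \<beta> b \<le> 2 \<and> \<beta> a = r) \<longleftrightarrow> r = \<beta> a" for r by auto
        then show ?thesis using 2 \<beta>_range(3)[of a] by simp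
      next
        case 3
        then show ?thesis by (auto intro!: sum.neutral)
      next
        case 4
        then show ?thesis by simp
      qed
    qed
    show ?thesis
      unfolding diagonal_operator_def vector_add_component S1 S2 S1' S2' level_weight_def
      by simp
  qed
  then show ?thesis by (simp add: vec_eq_iff)
qed

text \<open>With zero padding the rectangular block product is a full matrix product, in which index
  \<open>c\<close> contributes only to the summand k = \<open>\<beta> c\<close>.\<close>

lemma block_mult:
  fixes A C :: "('f::star_scalar, 'n) sqmat"
  shows "block d (A ** C) i j = (\<Sum>k=1..s. block d A i k ** block d C k j)"
proof -
  have "(\<Sum>k=1..s. (block d A i k ** block d C k j) $ a $ b) = block d (A ** C) i j $ a $ b" for a b
  proof -
    have "(\<Sum>k=1..s. (block d A i k ** block d C k j) $ a $ b) =
        (\<Sum>c\<in>UNIV. \<Sum>k=1..s. block d A i k $ a $ c * block d C k j $ c $ b)"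
      by (simp add: matrix_matrix_mult_def) (rule sum.swap)
    also have "\<dots> = (\<Sum>c\<in>UNIV. \<Sum>k=1..s. if k = \<beta> c then (if \<beta> a = i \<and> \<beta> b = j then A $ a $ c * C $ c $ b else 0) else 0)"
      by (intro sum.cong refl) (auto simp: block_nth)
    also have "\<dots> = (\<Sum>c\<in>UNIV. if \<beta> a = i \<and> \<beta> b = j then A $ a $ c * C $ c $ b else 0)"
      using \<beta>_range(1) by (simp del: atLeastAtMost_iff)
    also have "\<dots> = block d (A ** C) i j $ a $ b"
    proof (cases "\<beta> a = i \<and> \<beta> b = j")
      case True
      then show ?thesis by (simp add: block_nth matrix_matrix_mult_def)
    next
      case False
      then show ?thesis unfolding block_nth if_not_P[OF False] by simp
    qed
    finally show ?thesis .
  qed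
  then show ?thesis by (simp add: vec_eq_iff)
qed

text \<open>Skewness reduces to blocks above the diagonal, and \<open>3 \<le> j\<close> leaves out
  only block (1, 2), which lies inside a block of H.\<close>

lemma zero_iff_blocks:
  fixes Z :: "('f::star_scalar, 'n) sqmat"
  assumes skew: "mstar Z = - Z" and diag: "\<And>a b. \<alpha> a = \<alpha> b \<Longrightarrow> Z $ a $ b = 0"
  shows "Z = 0 \<longleftrightarrow> (\<forall>i j. 1 \<le> i \<and> i < j \<and> 3 \<le> j \<and> j \<le> s \<longrightarrow> block d Z i j = 0)"
proof
  assume *: "\<forall>i j. 1 \<le> i \<and> i < j \<and> 3 \<le> j \<and> j \<le> s \<longrightarrow> block d Z i j = 0"
  have up: "Z $ a $ b = 0" if ab: "\<beta> a < \<beta> b" for a b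
  proof (cases "\<alpha> a = \<alpha> b")
    case False
    then have "block d Z (\<beta> a) (\<beta> b) = 0"
      using * ab \<beta>_range[of a] \<beta>_range[of b] unfolding \<alpha>_eq_iff by auto
    then show ?thesis unfolding block_eq_0_iff by blast
  qed (rule diag)
  have "Z $ a $ b = 0" for a b
  proof -
    consider "\<beta> a = \<beta> b" | "\<beta> a < \<beta> b" | "\<beta> b < \<beta> a" by linarith
    then show ?thesis
    proof cases
      case 1
      then show ?thesis by (intro diag finer)
    next
      case 3
      have "cj (Z $ b $ a) = - Z $ a $ b"
        using arg_cong[OF skew, of "\<lambda>Z. Z $ a $ b"] by (simp add: mstar_nth)
      then show ?thesis using up[OF 3] by simp
    qed (rule up)
  qed
  then show "Z = 0" by (simp add: vec_eq_iff)
qed (simp add: block_eq_0_iff)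

lemma level_weight_sym: "level_weight \<mu> \<nu> i j = level_weight \<mu> \<nu> j i"
  by (simp add: level_weight_def min.commute max.commute)

lemma block_weigh:
  "block d (weigh (\<lambda>a b. l (\<beta> a) (\<beta> b)) X) i j = l i j *\<^sub>R block d X i j"
  by (simp add: vec_eq_iff block_nth)

section \<open>Block form of the two commutator conditions\<close>

context
  fixes P N :: "('f::star_scalar, 'n) sqmat" and \<mu> :: "nat \<Rightarrow> real" and \<nu> :: "nat \<Rightarrow> nat \<Rightarrow> real"
  assumes P: "proj \<alpha> \<beta> P = P" and N: "off \<alpha> N = N"
begin

abbreviation "B \<equiv> block d (P + N)"
abbreviation "L \<equiv> level_weight \<mu> \<nu>"
abbreviation "L\<beta> \<equiv> \<lambda>a b. level_weight \<mu> \<nu> (\<beta> a) (\<beta> b)"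

lemma skew_PN: "mstar P = - P" "mstar N = - N" "mstar (P + N) = - (P + N)"
  using P N by (simp_all add: proj_fixed_iff mstar_add)

lemma P_zero: "\<alpha> a \<noteq> \<alpha> b \<or> \<beta> a = \<beta> b \<Longrightarrow> P $ a $ b = 0"
  using P unfolding proj_fixed_iff by blast

lemma N_zero: "\<alpha> a = \<alpha> b \<Longrightarrow> N $ a $ b = 0"
  using N unfolding proj_fixed_iff by blast

lemma block_P_0: "i = j \<or> 3 \<le> i \<or> 3 \<le> j \<Longrightarrow> block d P i j = 0"
  unfolding block_eq_0_iff
proof (intro allI impI)
  fix a b assume ij: "i = j \<or> 3 \<le> i \<or> 3 \<le> j" "\<beta> a = i" "\<beta> b = j"
  have "\<alpha> a \<noteq> \<alpha> b \<or> \<beta> a = \<beta> b" using ij(1) unfolding \<alpha>_eq_iff ij(2,3) by auto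
  then show "P $ a $ b = 0" by (rule P_zero)
qed

lemma block_N_0: "i = j \<or> i \<le> 2 \<and> j \<le> 2 \<Longrightarrow> block d N i j = 0"
  unfolding block_eq_0_iff
proof (intro allI impI)
  fix a b assume ij: "i = j \<or> i \<le> 2 \<and> j \<le> 2" "\<beta> a = i" "\<beta> b = j"
  then have "\<alpha> a = \<alpha> b" unfolding \<alpha>_eq_iff by auto
  then show "N $ a $ b = 0" by (rule N_zero)
qed

lemma block_P: "i \<le> 2 \<Longrightarrow> j \<le> 2 \<Longrightarrow> block d P i j = B i j"
  by (simp add: block_add block_N_0)

lemma block_N: "3 \<le> i \<or> 3 \<le> j \<Longrightarrow> block d N i j = B i j"
  by (simp add: block_add block_P_0)

lemma B_swap: "B j i = - mstar (B i j)"
  by (rule block_skew[OF skew_PN(3)])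

text \<open>\<open>P\<close> has only the blocks (1, 2) and (2, 1), so in column j the product NP
  drops out and rows 1 and 2 keep one summand of PN each. Skewness turns \<open>B 2 1\<close> into
  minus the adjoint of \<open>B 1 2\<close>.\<close>

lemma block_commutator_P_N:
  assumes "3 \<le> j"
  shows "block d (commutator P N) 1 j = B 1 2 ** B 2 j"
    "block d (commutator P N) 2 j = - (mstar (B 1 2) ** B 1 j)"
    "3 \<le> i \<Longrightarrow> block d (commutator P N) i j = 0"
proof -
  have eq: "block d (commutator P N) i j = (\<Sum>k=1..s. block d P i k ** block d N k j)" for i
    unfolding commutator_def block_diff block_mult using assms by (simp add: block_P_0)
  show "block d (commutator P N) i j = 0" if "3 \<le> i"
    unfolding eq using that by (simp add: block_P_0)
  have t1: "block d P 1 k ** block d N k j = (if k = 2 then B 1 2 ** B 2 j else 0)" if k: "1 \<le> k" for k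
  proof -
    consider "k = 1" | "k = 2" | "3 \<le> k" using k by linarith
    then show ?thesis by cases (use assms in \<open>simp_all add: block_P_0 block_P block_N\<close>)
  qed
  have t2: "block d P 2 k ** block d N k j = (if k = 1 then B 2 1 ** B 1 j else 0)" if k: "1 \<le> k" for k
  proof -
    consider "k = 1" | "k = 2" | "3 \<le> k" using k by linarith
    then show ?thesis by cases (use assms in \<open>simp_all add: block_P_0 block_P block_N\<close>)
  qed
  have "block d (commutator P N) 1 j = (\<Sum>k=1..s. if k = 2 then B 1 2 ** B 2 j else 0)"
    unfolding eq by (rule sum.cong[OF refl]) (rule t1, simp)
  then show "block d (commutator P N) 1 j = B 1 2 ** B 2 j" using s by simp
  have "block d (commutator P N) 2 j = (\<Sum>k=1..s. if k = 1 then B 2 1 ** B 1 j else 0)"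
    unfolding eq by (rule sum.cong[OF refl]) (rule t2, simp)
  also have "\<dots> = B 2 1 ** B 1 j" using s by simp
  finally show "block d (commutator P N) 2 j = - (mstar (B 1 2) ** B 1 j)"
    unfolding B_swap[of 2 1] by simp
qed

text \<open>The minus sign is pulled out so that the coefficients have the orientation of the block
  equations.\<close>

lemma block_commutator_weigh:
  "block d (commutator (weigh L\<beta> N) N) i j =
    - (\<Sum>k=1..s. (L k j - L i k) *\<^sub>R (block d N i k ** block d N k j))"
  unfolding commutator_def block_diff block_mult block_weigh
  by (simp add: scaleR_diff_left sum_subtractf)

text \<open>Summands with k at most 2 or k = r contain a zero block of \<open>N\<close>. For k > r
  the block (k, r) is minus the adjoint of (r, k), which reverses the difference of
  coefficients.\<close>

lemma block_commutator_weigh_12: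
  assumes i: "i \<in> {1, 2}" and r: "r \<in> {3..s}"
  shows "block d (commutator (weigh L\<beta> N) N) i r =
    - ((\<Sum>k\<in>{3..<r}. (\<nu> k r - \<mu> k) *\<^sub>R (B i k ** B k r)) +
       (\<Sum>k\<in>{r+1..s}. (\<mu> k - \<nu> r k) *\<^sub>R (B i k ** mstar (B r k))))"
proof -
  let ?f = "\<lambda>k. (L k r - L i k) *\<^sub>R (block d N i k ** block d N k r)"
  have "(\<Sum>k=1..s. ?f k) = (\<Sum>k\<in>{3..<r} \<union> {r+1..s}. ?f k)"
  proof (rule sum.mono_neutral_right)
    show "\<forall>k\<in>{1..s} - ({3..<r} \<union> {r+1..s}). ?f k = 0"
    proof
      fix k assume "k \<in> {1..s} - ({3..<r} \<union> {r+1..s})"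
      then have "k \<le> 2 \<or> k = r" using r by auto
      then show "?f k = 0" using i by (auto simp: block_N_0)
    qed
  qed (use r in auto)
  also have "\<dots> = (\<Sum>k\<in>{3..<r}. ?f k) + (\<Sum>k\<in>{r+1..s}. ?f k)"
    by (rule sum.union_disjoint) auto
  also have "(\<Sum>k\<in>{3..<r}. ?f k) = (\<Sum>k\<in>{3..<r}. (\<nu> k r - \<mu> k) *\<^sub>R (B i k ** B k r))"
    using i r by (intro sum.cong refl) (auto simp: block_N level_weight_def)
  also have "(\<Sum>k\<in>{r+1..s}. ?f k) = (\<Sum>k\<in>{r+1..s}. (\<mu> k - \<nu> r k) *\<^sub>R (B i k ** mstar (B r k)))"
  proof (rule sum.cong[OF refl])
    fix k assume k: "k \<in> {r+1..s}"
    have "block d N k r = - mstar (B r k)" using k r by (simp add: block_N B_swap[of k r])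
    moreover have "L k r = \<nu> r k" "L i k = \<mu> k" using k r i by (auto simp: level_weight_def)
    moreover have "block d N i k = B i k" using k r by (simp add: block_N)
    ultimately show "?f k = (\<mu> k - \<nu> r k) *\<^sub>R (B i k ** mstar (B r k))"
      by (simp add: scaleR_diff_left)
  qed
  finally show ?thesis unfolding block_commutator_weigh by simp
qed

text \<open>The four ranges of k relative to i and j are the four parts of the equation; k = i and k
  = j give zero blocks. Replacing a block below the diagonal by minus the adjoint of its mirror
  image reverses the coefficient for k < i and for k > j only.\<close>

lemma block_commutator_weigh_3:
  assumes ij: "3 \<le> i" "i < j" "j \<le> s"
  shows "block d (commutator (weigh L\<beta> N) N) i j =
    - ((\<mu> i - \<mu> j) *\<^sub>R (mstar (B 1 i) ** B 1 j + mstar (B 2 i) ** B 2 j) +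
       (\<Sum>k\<in>{3..<i}. (\<nu> k i - \<nu> k j) *\<^sub>R (mstar (B k i) ** B k j)) +
       (\<Sum>k\<in>{i+1..<j}. (\<nu> k j - \<nu> i k) *\<^sub>R (B i k ** B k j)) +
       (\<Sum>k\<in>{j+1..s}. (\<nu> i k - \<nu> j k) *\<^sub>R (B i k ** mstar (B j k))))"
proof -
  let ?f = "\<lambda>k. (L k j - L i k) *\<^sub>R (block d N i k ** block d N k j)"
  have N_B: "block d N i k = B i k" "block d N k j = B k j" for k
    using ij by (simp_all add: block_N)
  have "(\<Sum>k=1..s. ?f k) = (\<Sum>k\<in>(({1, 2} \<union> {3..<i}) \<union> {i+1..<j}) \<union> {j+1..s}. ?f k)"
  proof (rule sum.mono_neutral_right)
    show "\<forall>k\<in>{1..s} - ((({1, 2} \<union> {3..<i}) \<union> {i+1..<j}) \<union> {j+1..s}). ?f k = 0"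
    proof
      fix k assume "k \<in> {1..s} - ((({1, 2} \<union> {3..<i}) \<union> {i+1..<j}) \<union> {j+1..s})"
      then have "k = i \<or> k = j" by auto
      then have "block d N i k = 0 \<or> block d N k j = 0" by (auto intro: block_N_0)
      then show "?f k = 0" by auto
    qed
  qed (use ij in auto)
  also have "\<dots> = (\<Sum>k\<in>{1, 2}. ?f k) + (\<Sum>k\<in>{3..<i}. ?f k) + (\<Sum>k\<in>{i+1..<j}. ?f k) + (\<Sum>k\<in>{j+1..s}. ?f k)"
    using ij by (subst sum.union_disjoint, simp, simp, force)+ (rule refl)
  also have "(\<Sum>k\<in>{1, 2}. ?f k) = (\<mu> i - \<mu> j) *\<^sub>R (mstar (B 1 i) ** B 1 j + mstar (B 2 i) ** B 2 j)"
  proof -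
    have "?f k = (\<mu> i - \<mu> j) *\<^sub>R (mstar (B k i) ** B k j)" if "k \<in> {1, 2}" for k
    proof -
      have "L k j = \<mu> j" "L i k = \<mu> i" using that ij by (auto simp: level_weight_def)
      then show ?thesis unfolding N_B B_swap[of i k] by (simp add: scaleR_diff_left)
    qed
    then show ?thesis by (simp add: scaleR_add_right)
  qed
  also have "(\<Sum>k\<in>{3..<i}. ?f k) = (\<Sum>k\<in>{3..<i}. (\<nu> k i - \<nu> k j) *\<^sub>R (mstar (B k i) ** B k j))"
  proof (rule sum.cong[OF refl])
    fix k assume k: "k \<in> {3..<i}"
    have "L k j = \<nu> k j" "L i k = \<nu> k i" using k ij by (auto simp: level_weight_def)
    then show "?f k = (\<nu> k i - \<nu> k j) *\<^sub>R (mstar (B k i) ** B k j)"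
      unfolding N_B B_swap[of i k] by (simp add: scaleR_diff_left)
  qed
  also have "(\<Sum>k\<in>{i+1..<j}. ?f k) = (\<Sum>k\<in>{i+1..<j}. (\<nu> k j - \<nu> i k) *\<^sub>R (B i k ** B k j))"
  proof (rule sum.cong[OF refl])
    fix k assume k: "k \<in> {i+1..<j}"
    have "L k j = \<nu> k j" "L i k = \<nu> i k" using k ij by (auto simp: level_weight_def)
    then show "?f k = (\<nu> k j - \<nu> i k) *\<^sub>R (B i k ** B k j)" unfolding N_B by simp
  qed
  also have "(\<Sum>k\<in>{j+1..s}. ?f k) = (\<Sum>k\<in>{j+1..s}. (\<nu> i k - \<nu> j k) *\<^sub>R (B i k ** mstar (B j k)))"
  proof (rule sum.cong[OF refl])
    fix k assume k: "k \<in> {j+1..s}"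
    have "L k j = \<nu> j k" "L i k = \<nu> i k" using k ij by (auto simp: level_weight_def)
    then show "?f k = (\<nu> i k - \<nu> j k) *\<^sub>R (B i k ** mstar (B j k))"
      unfolding N_B B_swap[of k j] by (simp add: scaleR_diff_left)
  qed
  finally show ?thesis unfolding block_commutator_weigh by simp
qed

theorem block_equations_iff:
  "block_equations d s \<mu> \<nu> (P + N) \<longleftrightarrow> commutator P N = 0 \<and> commutator (weigh L\<beta> N) N = 0"
proof -
  let ?C = "commutator P N" and ?D = "commutator (weigh L\<beta> N) N"
  let ?E = "\<lambda>i r. (\<Sum>k\<in>{3..<r}. (\<nu> k r - \<mu> k) *\<^sub>R (B i k ** B k r)) +
       (\<Sum>k\<in>{r+1..s}. (\<mu> k - \<nu> r k) *\<^sub>R (B i k ** mstar (B r k)))"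
  let ?F = "\<lambda>i j. (\<mu> i - \<mu> j) *\<^sub>R (mstar (B 1 i) ** B 1 j + mstar (B 2 i) ** B 2 j) +
       (\<Sum>k\<in>{3..<i}. (\<nu> k i - \<nu> k j) *\<^sub>R (mstar (B k i) ** B k j)) +
       (\<Sum>k\<in>{i+1..<j}. (\<nu> k j - \<nu> i k) *\<^sub>R (B i k ** B k j)) +
       (\<Sum>k\<in>{j+1..s}. (\<nu> i k - \<nu> j k) *\<^sub>R (B i k ** mstar (B j k)))"
  have "block_diagonal \<alpha> P" unfolding block_diagonal_def using P_zero by blast
  then have "?C = 0 \<longleftrightarrow> (\<forall>i j. 1 \<le> i \<and> i < j \<and> 3 \<le> j \<and> j \<le> s \<longrightarrow> block d ?C i j = 0)"
    by (intro zero_iff_blocks commutator_skew skew_PN commutator_diagonal[OF _ N_zero])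
  also have "\<dots> \<longleftrightarrow> (\<forall>r\<in>{3..s}. block d ?C 1 r = 0 \<and> block d ?C 2 r = 0)"
  proof (intro iffI ballI allI impI)
    fix r assume "\<forall>i j. 1 \<le> i \<and> i < j \<and> 3 \<le> j \<and> j \<le> s \<longrightarrow> block d ?C i j = 0" "r \<in> {3..s}"
    then show "block d ?C 1 r = 0 \<and> block d ?C 2 r = 0" by simp
  next
    fix i j assume *: "\<forall>r\<in>{3..s}. block d ?C 1 r = 0 \<and> block d ?C 2 r = 0"
      and ij: "1 \<le> i \<and> i < j \<and> 3 \<le> j \<and> j \<le> s"
    consider "i = 1" | "i = 2" | "3 \<le> i" using ij by linarith
    then show "block d ?C i j = 0"
      by cases (use * ij block_commutator_P_N(3)[of j i] in auto)
  qed
  also have "\<dots> \<longleftrightarrow> (\<forall>r\<in>{3..s}. B 1 2 ** B 2 r = 0 \<and> mstar (B 1 2) ** B 1 r = 0)"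
  proof (rule ball_cong[OF refl])
    fix r assume "r \<in> {3..s}"
    then have r: "3 \<le> r" by simp
    show "block d ?C 1 r = 0 \<and> block d ?C 2 r = 0 \<longleftrightarrow> B 1 2 ** B 2 r = 0 \<and> mstar (B 1 2) ** B 1 r = 0"
      unfolding block_commutator_P_N(1,2)[OF r] neg_equal_0_iff_equal by (rule refl)
  qed
  finally have C: "?C = 0 \<longleftrightarrow> (\<forall>r\<in>{3..s}. B 1 2 ** B 2 r = 0 \<and> mstar (B 1 2) ** B 1 r = 0)" .
  \<comment> \<open>Labels 1 and 2 are interchangeable in \<open>level_weight\<close>, which is
    compatibility with the blocks of H.\<close>
  have lw: "class_weight \<alpha> L\<beta>"
    unfolding class_weight_def
  proof (intro conjI allI impI level_weight_sym)
    fix a a' b assume e: "\<alpha> a = \<alpha> a'"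
    have "\<beta> a = \<beta> a' \<or> \<beta> a \<le> 2 \<and> \<beta> a' \<le> 2" using e unfolding \<alpha>_eq_iff .
    then show "L\<beta> a b = L\<beta> a' b" by (auto simp: level_weight_def)
  qed
  have "?D = 0 \<longleftrightarrow> (\<forall>i j. 1 \<le> i \<and> i < j \<and> 3 \<le> j \<and> j \<le> s \<longrightarrow> block d ?D i j = 0)"
    by (intro zero_iff_blocks commutator_skew skew_weigh skew_PN level_weight_sym commutator_weigh_diagonal[OF lw])
  also have "\<dots> \<longleftrightarrow> (\<forall>i\<in>{1, 2}. \<forall>r\<in>{3..s}. block d ?D i r = 0) \<and>
      (\<forall>i j. 3 \<le> i \<and> i < j \<and> j \<le> s \<longrightarrow> block d ?D i j = 0)"
  proof (intro iffI conjI ballI allI impI)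
    fix i r :: nat assume "\<forall>i j. 1 \<le> i \<and> i < j \<and> 3 \<le> j \<and> j \<le> s \<longrightarrow> block d ?D i j = 0" "i \<in> {1, 2}" "r \<in> {3..s}"
    then show "block d ?D i r = 0" by auto
  next
    fix i j assume "\<forall>i j. 1 \<le> i \<and> i < j \<and> 3 \<le> j \<and> j \<le> s \<longrightarrow> block d ?D i j = 0" "3 \<le> i \<and> i < j \<and> j \<le> s"
    then show "block d ?D i j = 0" by simp
  next
    fix i j assume *: "(\<forall>i\<in>{1, 2}. \<forall>r\<in>{3..s}. block d ?D i r = 0) \<and>
        (\<forall>i j. 3 \<le> i \<and> i < j \<and> j \<le> s \<longrightarrow> block d ?D i j = 0)"
      and ij: "1 \<le> i \<and> i < j \<and> 3 \<le> j \<and> j \<le> s"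
    consider "i \<in> {1, 2}" | "3 \<le> i" using ij by force
    then show "block d ?D i j = 0"
    proof cases
      case 1
      have "j \<in> {3..s}" using ij by simp
      with bspec[OF conjunct1[OF *] 1] show ?thesis by (rule bspec)
    next
      case 2
      then show ?thesis using conjunct2[OF *] ij by blast
    qed
  qed
  also have "\<dots> \<longleftrightarrow> (\<forall>i\<in>{1, 2}. \<forall>r\<in>{3..s}. ?E i r = 0) \<and> (\<forall>i j. 3 \<le> i \<and> i < j \<and> j \<le> s \<longrightarrow> ?F i j = 0)"
  proof (intro arg_cong2[of _ _ _ _ "(\<and>)"] ball_cong refl all_cong1 imp_cong)
    show "block d ?D i r = 0 \<longleftrightarrow> ?E i r = 0" if "i \<in> {1, 2}" "r \<in> {3..s}" for i r
      unfolding block_commutator_weigh_12[OF that] by (rule neg_equal_0_iff_equal)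
    show "block d ?D i j = 0 \<longleftrightarrow> ?F i j = 0" if "3 \<le> i \<and> i < j \<and> j \<le> s" for i j
      using that unfolding block_commutator_weigh_3[OF conjunct1[OF that] conjunct1[OF conjunct2[OF that]] conjunct2[OF conjunct2[OF that]]]
      by (intro neg_equal_0_iff_equal)
  qed
  finally show ?thesis
    unfolding C block_equations_def Let_def by blast
qed

end

end

text \<open>A relation \<open>R\<close> that selects positions within one pair of H-blocks sees a
  single value of \<open>l\<close>; these values become the coefficients.\<close>

lemma (in block_structure) exists_levels:
  assumes l: "class_weight \<alpha> l" "\<And>a b. \<alpha> a \<noteq> \<alpha> b \<Longrightarrow> 0 < l a b" "\<And>a b. \<alpha> a = \<alpha> b \<Longrightarrow> l a b = 0"
  obtains \<mu> \<nu> where "\<And>r. 0 < \<mu> r" "\<And>i j. 0 < \<nu> i j" "l = (\<lambda>a b. level_weight \<mu> \<nu> (\<beta> a) (\<beta> b))"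
proof -
  have ex: "\<exists>m > 0. \<forall>a b. R a b \<longrightarrow> l a b = m"
    if R: "\<And>a b. R a b \<Longrightarrow> \<alpha> a \<noteq> \<alpha> b" "\<And>a b a' b'. R a b \<Longrightarrow> R a' b' \<Longrightarrow> \<alpha> a = \<alpha> a' \<and> \<alpha> b = \<alpha> b'" for R
  proof (cases "\<exists>a b. R a b")
    case True
    then obtain a b where ab: "R a b" by blast
    have "l a' b' = l a b" if "R a' b'" for a' b'
      using R(2)[OF that ab] by (intro class_weight_cong[OF l(1)]) auto
    then show ?thesis using l(2)[OF R(1)[OF ab]] by blast
  next
    case False
    \<comment> \<open>Default 1 for label pairs that do not occur, so that positivity holds for all
      arguments.\<close>
    then show ?thesis by (intro exI[of _ 1]) auto
  qed
  have "\<exists>m > 0. \<forall>a b. 3 \<le> r \<and> \<beta> a \<le> 2 \<and> \<beta> b = r \<longrightarrow> l a b = m" for r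
    by (rule ex) (auto simp: \<alpha>_eq_iff)
  then obtain \<mu> where \<mu>: "\<And>r. 0 < \<mu> r" "\<And>r a b. 3 \<le> r \<Longrightarrow> \<beta> a \<le> 2 \<Longrightarrow> \<beta> b = r \<Longrightarrow> l a b = \<mu> r"
    by metis
  have "\<exists>m > 0. \<forall>a b. 3 \<le> i \<and> i < j \<and> \<beta> a = i \<and> \<beta> b = j \<longrightarrow> l a b = m" for i j
    by (rule ex) (auto simp: \<alpha>_eq_iff)
  then obtain \<nu> where \<nu>: "\<And>i j. 0 < \<nu> i j"
    "\<And>i j a b. 3 \<le> i \<Longrightarrow> i < j \<Longrightarrow> \<beta> a = i \<Longrightarrow> \<beta> b = j \<Longrightarrow> l a b = \<nu> i j"
    by metis
  have "l a b = level_weight \<mu> \<nu> (\<beta> a) (\<beta> b)" for a b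
  proof -
    have le: "l a b = level_weight \<mu> \<nu> (\<beta> a) (\<beta> b)" if ab: "\<beta> a \<le> \<beta> b" for a b
    proof -
      consider "\<beta> a = \<beta> b \<or> \<beta> b \<le> 2" | "\<beta> a \<le> 2" "3 \<le> \<beta> b" | "3 \<le> \<beta> a" "\<beta> a < \<beta> b"
        using ab by linarith
      then show ?thesis
      proof cases
        case 1
        then have "\<alpha> a = \<alpha> b" using ab unfolding \<alpha>_eq_iff by linarith
        then show ?thesis using 1 ab l(3)[of a b] by (auto simp: level_weight_def)
      next
        case 2
        then show ?thesis using \<mu>(2)[OF 2(2) 2(1) refl] by (simp add: level_weight_def)
      next
        case 3
        then show ?thesis using \<nu>(2)[OF 3 refl refl] by (simp add: level_weight_def)
      qed
    qed
    show ?thesis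
    proof (cases "\<beta> a \<le> \<beta> b")
      case False
      then have "l b a = level_weight \<mu> \<nu> (\<beta> b) (\<beta> a)" by (intro le) simp
      then show ?thesis
        using class_weight_sym[OF l(1), of a b] level_weight_sym[of \<mu> \<nu> "\<beta> a" "\<beta> b"] by (simp only:)
    qed (rule le)
  qed
  then have "l = (\<lambda>a b. level_weight \<mu> \<nu> (\<beta> a) (\<beta> b))" by (intro ext)
  with \<mu>(1) \<nu>(1) show ?thesis by (rule that)
qed

text \<open>One proof for the three families. The same weight \<open>l\<close> yields the operator
  coefficients, the geodesic condition on the base and the block equations, so all conditions are
  compared through the two commutators.\<close>

theorem pi_equigeodesic_flag:
  fixes G :: "('f::star_scalar, 'n::{finite,linorder}) sqmat set" and d :: "nat \<Rightarrow> nat"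
  assumes G: "classical_group G" and s: "3 \<le> s" and card: "CARD('n) = (\<Sum>i=1..s. d i)"
  shows "(\<forall>P\<in>pp d s. equigeodesic (block_subgroup (merge12 d) G) (block_subgroup d G) P) \<and>
    (\<forall>gb. invariant_metric G (block_subgroup (merge12 d) G) gb \<longrightarrow>
      (\<exists>\<mu> \<nu>. (\<forall>r\<in>{3..s}. 0 < \<mu> r) \<and>
         (\<forall>i j. 3 \<le> i \<and> i < j \<and> j \<le> s \<longrightarrow> 0 < \<nu> i j) \<and>
         metric_operator (nn d s) (block_subgroup (merge12 d) G) gb (diagonal_operator d s \<mu> \<nu>) \<and>
         (\<forall>P\<in>pp d s. \<forall>N\<in>nn d s.
            (pi_equigeodesic G (block_subgroup (merge12 d) G) (block_subgroup d G) gb (P + N) \<longleftrightarrow>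
               geodesic_vector G (block_subgroup (merge12 d) G) gb N \<and> commutator P N = 0) \<and>
            (pi_equigeodesic G (block_subgroup (merge12 d) G) (block_subgroup d G) gb (P + N) \<longleftrightarrow>
               block_equations d s \<mu> \<nu> (P + N)))))"
proof -
  interpret classical_group G by (rule G)
  define \<alpha> \<beta> :: "'n \<Rightarrow> nat" where "\<alpha> = blk (merge12 d)" and "\<beta> = blk d"
  interpret b: block_structure d s \<beta> \<alpha>
    by standard (simp_all only: s card \<alpha>_def \<beta>_def)
  have H: "block_subgroup (merge12 d) G = diag_group \<alpha> G" and K: "block_subgroup d G = diag_group \<beta> G"
    by (simp_all only: block_subgroup_eq \<alpha>_def \<beta>_def)
  interpret RH: reductive_pair G "diag_group \<alpha> G" "off \<alpha>" by (rule reductive_pair_off)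
  have fibre: "equigeodesic (diag_group \<alpha> G) (diag_group \<beta> G) P" if "P \<in> pp d s" for P
    by (rule equigeodesic_diag_group[OF b.finer b.two_blocks b.pp_iff[THEN iffD1, OF that]])
  have "\<exists>\<mu> \<nu>. (\<forall>r\<in>{3..s}. 0 < \<mu> r) \<and>
         (\<forall>i j. 3 \<le> i \<and> i < j \<and> j \<le> s \<longrightarrow> 0 < \<nu> i j) \<and>
         metric_operator (nn d s) (diag_group \<alpha> G) gb (diagonal_operator d s \<mu> \<nu>) \<and>
         (\<forall>P\<in>pp d s. \<forall>N\<in>nn d s.
            (pi_equigeodesic G (diag_group \<alpha> G) (diag_group \<beta> G) gb (P + N) \<longleftrightarrow>
               geodesic_vector G (diag_group \<alpha> G) gb N \<and> commutator P N = 0) \<and>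
            (pi_equigeodesic G (diag_group \<alpha> G) (diag_group \<beta> G) gb (P + N) \<longleftrightarrow>
               block_equations d s \<mu> \<nu> (P + N)))"
    if gb: "invariant_metric G (diag_group \<alpha> G) gb" for gb
  proof -
    from invariant_metric_weight[OF gb] obtain l where l: "class_weight \<alpha> l"
      "\<And>a b. \<alpha> a \<noteq> \<alpha> b \<Longrightarrow> 0 < l a b" "\<And>a b. \<alpha> a = \<alpha> b \<Longrightarrow> l a b = 0"
      "\<And>X Y. X \<in> lie_algebra G \<Longrightarrow> Y \<in> lie_algebra G \<Longrightarrow> base_form (diag_group \<alpha> G) gb X Y = ip (weigh l X) Y"
      by metis
    obtain \<mu> \<nu> where pos: "\<And>r. 0 < \<mu> r" "\<And>i j. 0 < \<nu> i j"
      and l_eq: "l = (\<lambda>a b. b.level_weight \<mu> \<nu> (\<beta> a) (\<beta> b))"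
      using b.exists_levels[OF l(1-3)] by metis
    have op: "diagonal_operator d s \<mu> \<nu> X = weigh l X" for X :: "('f, 'n) sqmat"
      unfolding l_eq by (rule b.diagonal_operator_eq)
    have "metric_operator (nn d s) (diag_group \<alpha> G) gb (diagonal_operator d s \<mu> \<nu>)"
      unfolding metric_operator_def op
    proof (intro conjI ballI allI)
      fix X Y :: "('f, 'n) sqmat" and r :: real assume X: "X \<in> nn d s"
      have "mstar X = - X" "\<And>a b. \<alpha> a \<noteq> \<alpha> b \<or> X $ a $ b = 0"
        using X unfolding b.nn_iff proj_fixed_iff by blast+
      then show "weigh l X \<in> nn d s"
        unfolding b.nn_iff proj_fixed_iff using skew_weigh[of l, OF class_weight_sym[OF l(1)]]
        by (metis scaleR_zero_right weigh_nth)
      show "weigh l (r *\<^sub>R X) = r *\<^sub>R weigh l X" by (rule weigh_scaleR)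
      show "weigh l (X + Y) = weigh l X + weigh l Y" by (rule weigh_add)
      assume "Y \<in> nn d s"
      then show "gb (tangent (diag_group \<alpha> G) (mat 1) X) (tangent (diag_group \<alpha> G) (mat 1) Y) = ip (weigh l X) Y"
        using X l(4)[of X Y] RH.complement_in unfolding b.nn_iff base_form_def by blast
    qed
    moreover have "(pi_equigeodesic G (diag_group \<alpha> G) (diag_group \<beta> G) gb (P + N) \<longleftrightarrow>
               geodesic_vector G (diag_group \<alpha> G) gb N \<and> commutator P N = 0) \<and>
            (pi_equigeodesic G (diag_group \<alpha> G) (diag_group \<beta> G) gb (P + N) \<longleftrightarrow>
               block_equations d s \<mu> \<nu> (P + N))" if "P \<in> pp d s" "N \<in> nn d s" for P N
    proof -
      have PN: "proj \<alpha> \<beta> P = P" "off \<alpha> N = N" using that unfolding b.pp_iff b.nn_iff .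
      have pi: "pi_equigeodesic G (diag_group \<alpha> G) (diag_group \<beta> G) gb (P + N) \<longleftrightarrow>
          commutator P N = 0 \<and> commutator (weigh l N) N = 0"
        by (rule pi_equigeodesic_iff[OF b.finer b.one_pair gb l PN])
      moreover have "geodesic_vector G (diag_group \<alpha> G) gb N \<longleftrightarrow> commutator (weigh l N) N = 0"
        by (rule geodesic_vector_weight_class[OF gb l(1,4) PN(2)])
      moreover have "block_equations d s \<mu> \<nu> (P + N) \<longleftrightarrow> commutator P N = 0 \<and> commutator (weigh l N) N = 0"
        unfolding l_eq by (rule b.block_equations_iff[OF PN])
      ultimately show ?thesis by blast
    qed
    ultimately show ?thesis
      using pos by (intro exI[of _ \<mu>] exI[of _ \<nu>]) blast
  qed
  then show ?thesis unfolding H K using fibre by blast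
qed

theorem mainTheorem5:
  fixes d :: "nat \<Rightarrow> nat" and s :: nat
  assumes "CARD('n::{finite,linorder}) \<ge> 5"
    and "s \<ge> 3"
    and "\<forall>i\<in>{1..s}. 0 < d i"
    and "CARD('n) = (\<Sum>i=1..s. d i)"
  shows "
    (let G = SO_group :: (real, 'n) sqmat set;
         H = block_subgroup (merge12 d) G;
         K = block_subgroup d G
     in (\<forall>P\<in>pp d s. equigeodesic H K P) \<and>
        (\<forall>gb. invariant_metric G H gb \<longrightarrow>
          (\<exists>\<mu> \<nu>. (\<forall>r\<in>{3..s}. 0 < \<mu> r) \<and>
             (\<forall>i j. 3 \<le> i \<and> i < j \<and> j \<le> s \<longrightarrow> 0 < \<nu> i j) \<and>
             metric_operator (nn d s) H gb (diagonal_operator d s \<mu> \<nu>) \<and>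
             (\<forall>P\<in>pp d s. \<forall>N\<in>nn d s.
                (pi_equigeodesic G H K gb (P + N) \<longleftrightarrow>
                   geodesic_vector G H gb N \<and> commutator P N = 0) \<and>
                (pi_equigeodesic G H K gb (P + N) \<longleftrightarrow>
                   block_equations d s \<mu> \<nu> (P + N)))))) \<and>
    (let G = SU_group :: (complex, 'n) sqmat set;
         H = block_subgroup (merge12 d) G;
         K = block_subgroup d G
     in (\<forall>P\<in>pp d s. equigeodesic H K P) \<and>
        (\<forall>gb. invariant_metric G H gb \<longrightarrow>
          (\<exists>\<mu> \<nu>. (\<forall>r\<in>{3..s}. 0 < \<mu> r) \<and>
             (\<forall>i j. 3 \<le> i \<and> i < j \<and> j \<le> s \<longrightarrow> 0 < \<nu> i j) \<and>
             metric_operator (nn d s) H gb (diagonal_operator d s \<mu> \<nu>) \<and>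
             (\<forall>P\<in>pp d s. \<forall>N\<in>nn d s.
                (pi_equigeodesic G H K gb (P + N) \<longleftrightarrow>
                   geodesic_vector G H gb N \<and> commutator P N = 0) \<and>
                (pi_equigeodesic G H K gb (P + N) \<longleftrightarrow>
                   block_equations d s \<mu> \<nu> (P + N)))))) \<and>
    (let G = Sp_group :: (quat, 'n) sqmat set;
         H = block_subgroup (merge12 d) G;
         K = block_subgroup d G
     in (\<forall>P\<in>pp d s. equigeodesic H K P) \<and>
        (\<forall>gb. invariant_metric G H gb \<longrightarrow>
          (\<exists>\<mu> \<nu>. (\<forall>r\<in>{3..s}. 0 < \<mu> r) \<and>
             (\<forall>i j. 3 \<le> i \<and> i < j \<and> j \<le> s \<longrightarrow> 0 < \<nu> i j) \<and>
             metric_operator (nn d s) H gb (diagonal_operator d s \<mu> \<nu>) \<and>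
             (\<forall>P\<in>pp d s. \<forall>N\<in>nn d s.
                (pi_equigeodesic G H K gb (P + N) \<longleftrightarrow>
                   geodesic_vector G H gb N \<and> commutator P N = 0) \<and>
                (pi_equigeodesic G H K gb (P + N) \<longleftrightarrow>
                   block_equations d s \<mu> \<nu> (P + N))))))"
proof -
  have "classical_group (SO_group :: (real, 'n) sqmat set)"
    unfolding SO_group_def by (rule classical_group_special[OF assms(1)])
  note SO = pi_equigeodesic_flag[OF this assms(2,4)]
  have "classical_group (SU_group :: (complex, 'n) sqmat set)"
    unfolding SU_group_def by (rule classical_group_special[OF assms(1)])
  note SU = pi_equigeodesic_flag[OF this assms(2,4)]
  note Sp = pi_equigeodesic_flag[OF classical_group_Sp[OF assms(1)] assms(2,4)]
  show ?thesis
    unfolding Let_def by (rule conjI[OF SO conjI[OF SU Sp]])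
qed

end
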